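(* Let $n,p$ be positive integers with $n-p-1>0$ and let $0\le\gamma<p^2+p$. For $N>0$ observe $Y\in\mathbb{R}^{n\times p}$ with independent entries $Y_{ai}\sim\mathrm N(M_{ai},N^{-1})$. Let $\hat M_{\mathrm{SVS}}$ and $\hat M_{\mathrm{MSVS1}}$ be the generalized Bayes estimators with respect to $\pi_{\mathrm{SVS}}(M)=\det(M^\top M)^{-(n-p-1)/2}$ and $\pi_{\mathrm{MSVS1}}(M)=\pi_{\mathrm{SVS}}(M)\|M\|_{\mathrm F}^{-\gamma}$. Then for every $M$ with $K=M^\top M$ nonsingular, $$N^2\left(\mathrm E_M[(\hat M_{\mathrm{MSVS1}}-M)^\top(\hat M_{\mathrm{MSVS1}}-M)]-\mathrm E_M[(\hat M_{\mathrm{SVS}}-M)^\top(\hat M_{\mathrm{SVS}}-M)]\right)\to \gamma(\mathrm{tr}K)^{-2}\left(-2(p+1)(\mathrm{tr}K)I_p+(\gamma+4)K\right)$$ as $N\to\infty$. Consequently, if $p\ge2$ and $0<\gamma<2p-2$, then $\hat M_{\mathrm{MSVS1}}$ asymptotically dominates $\hat M_{\mathrm{SVS}}$ under the matrix quadratic loss, i.e., the limit matrix is negative definite for every such $M$.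
   Context: The generalized Bayes estimator with respect to a nonnegative function $\pi$ with finite marginal $m_\pi(Y)=\int p(Y\mid M)\pi(M)\,\mathrm dM$ is the posterior mean $\int M p(Y\mid M)\pi(M)\,\mathrm dM/m_\pi(Y)$; these marginals are finite for $0\le\gamma<p^2+p$. The matrix quadratic loss of $\hat M$ is the $p\times p$ matrix $(\hat M-M)^\top(\hat M-M)$. *)

theory Defs
  imports "HOL-Probability.Probability"
begin

text \<open>Matrices in R^(n x p) are real^'p^'n (rows indexed by 'n, columns by 'p).
  n = CARD('n), p = CARD('p).\<close>

definition lik :: "real \<Rightarrow> real^'p^'n \<Rightarrow> real^'p^'n \<Rightarrow> real" where
  "lik N M Y = (\<Prod>a\<in>UNIV. \<Prod>i\<in>UNIV. normal_density (M$a$i) (sqrt (1/N)) (Y$a$i))"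

definition marginal :: "real \<Rightarrow> (real^'p^'n \<Rightarrow> real) \<Rightarrow> real^'p^'n \<Rightarrow> real" where
  "marginal N \<pi> Y = (\<integral>M. lik N M Y * \<pi> M \<partial>lborel)"

definition gen_bayes :: "real \<Rightarrow> (real^'p^'n \<Rightarrow> real) \<Rightarrow> real^'p^'n \<Rightarrow> real^'p^'n" where
  "gen_bayes N \<pi> Y = (1 / marginal N \<pi> Y) *\<^sub>R (\<integral>M. (lik N M Y * \<pi> M) *\<^sub>R M \<partial>lborel)"

definition obs_dist :: "real \<Rightarrow> real^'p^'n \<Rightarrow> (real^'p^'n) measure" where
  "obs_dist N M = density lborel (lik N M)"

definition risk_matrix :: "real \<Rightarrow> (real^'p^'n \<Rightarrow> real) \<Rightarrow> real^'p^'n \<Rightarrow> real^'p^'p" where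
  "risk_matrix N \<pi> M =
     (\<integral>Y. transpose (gen_bayes N \<pi> Y - M) ** (gen_bayes N \<pi> Y - M) \<partial>obs_dist N M)"

definition pi_svs :: "real^'p^'n \<Rightarrow> real" where
  "pi_svs M = det (transpose M ** M) powr (- (real CARD('n) - real CARD('p) - 1) / 2)"

text \<open>norm on real^'p^'n is the Frobenius norm.\<close>
definition pi_msvs1 :: "real \<Rightarrow> real^'p^'n \<Rightarrow> real" where
  "pi_msvs1 \<gamma> M = pi_svs M * norm M powr (- \<gamma>)"

definition neg_definite :: "real^'p^'p \<Rightarrow> bool" where
  "neg_definite L \<longleftrightarrow> transpose L = L \<and> (\<forall>x. x \<noteq> 0 \<longrightarrow> x \<bullet> (L *v x) < 0)"

end

theory Submission
  imports Defs
begin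

text \<open>Put \<open>s = 1 / sqrt N\<close>, \<open>Y = M + s z\<close> and \<open>\<theta> = Y + s w\<close> with \<open>z\<close>, \<open>w\<close> standard Gaussian. The posterior mean is then
  \<open>Y + s E[w \<pi>(M + s (z + w))] / E[\<pi>(M + s (z + w))]\<close>, the expectations being over \<open>w\<close>, and only the
  second-order Taylor polynomial of \<open>\<pi>\<close> at \<open>M\<close> matters: in a coordinate \<open>e\<close> the error is
  \<open>s z\<^sub>e + s\<^sup>2 c\<^sub>e + s\<^sup>3 D\<^sub>e(z)\<close>, where \<open>c = \<nabla>\<pi> / \<pi>\<close> at \<open>M\<close> and \<open>D\<close> converges to the Hessian of \<open>log \<pi>\<close>
  applied to \<open>z\<close> while being bounded by a polynomial in \<open>z\<close> uniformly in \<open>s \<le> 1\<close>. Hence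
  \<open>N\<^sup>2 E[error\<^sub>e error\<^sub>f] - N (e \<bullet> f)\<close> tends to \<open>2 \<nabla>\<^sup>2\<pi>(e, f) / \<pi> - c\<^sub>e c\<^sub>f\<close>. For the product prior the
  unknown Hessian of \<open>\<pi>\<^sub>S\<^sub>V\<^sub>S\<close> cancels in the difference of the two risks, and its gradient enters only through
  \<open>M\<^sup>T \<nabla>log \<pi>\<^sub>S\<^sub>V\<^sub>S = - (n - p - 1) I\<close>.

  The global requirements on \<open>\<pi>\<close> are a polynomial lower bound and integrability against a negative power of
  \<open>1 + norm M\<close>. The latter follows by integrating the columns one at a time, since the Gram determinant is the
  product of the squared distances of each column to the span of the preceding ones; homogeneity and a dyadic
  decomposition then give the factor \<open>norm M powr (- \<gamma>)\<close>.\<close>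

section \<open>The standard Gaussian measure on a Euclidean space\<close>

text \<open>The priors are improper and unbounded near rank-deficient matrices, so the Taylor
  remainder at \<open>M\<close> has no polynomial majorant. It is split at a small radius, and
  outside that radius the prior is kept as it stands: there the Gaussian tail, traded against
  integrability with a polynomial weight, costs only \<open>s ^ 3\<close>, which is negligible
  against the \<open>s\<^sup>2\<close> that counts. The posterior mean is a ratio, so its
  denominator must not decay too fast as \<open>z\<close> grows either; the polynomial lower bound
  on the prior serves this purpose. It can be asked for only almost everywhere, because the
  convention \<open>0 powr a = 0\<close> makes the formal density vanish, instead of blowing up,
  where the Gram determinant is zero. An error known up to \<open>o(s ^ 3)\<close> determines the
  risk to order \<open>s ^ 4 = 1 / N\<^sup>2\<close>: the \<open>s\<^sup>2\<close> part of the risk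
  is the same for every prior and the \<open>s ^ 3\<close> part is odd in the noise.\<close>

lemma integral_lborel_prod:
  fixes f :: "'a::euclidean_space \<Rightarrow> real \<Rightarrow> real"
  assumes "\<And>b. b \<in> Basis \<Longrightarrow> integrable lborel (f b)"
  shows "(\<integral>x. (\<Prod>b\<in>Basis. f b (x \<bullet> b)) \<partial>lborel) = (\<Prod>b\<in>Basis. integral\<^sup>L lborel (f b))"
proof -
  interpret product_sigma_finite "\<lambda>_::'a. lborel :: real measure"
    by standard
  have [measurable]: "\<And>b. b \<in> Basis \<Longrightarrow> f b \<in> borel_measurable borel"
    using assms by auto
  have eq: "(\<Prod>b\<in>Basis. f b ((\<Sum>b\<in>Basis. x b *\<^sub>R b) \<bullet> b)) = (\<Prod>b\<in>Basis. f b (x b))" for x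
    by (intro prod.cong) (auto simp: inner_sum_left_Basis)
  show ?thesis
    using assms
    by (subst lborel_eq, subst integral_distr) (auto simp: eq product_integral_prod)
qed

lemma
  fixes f :: "'a::euclidean_space \<Rightarrow> real"
  assumes [measurable]: "f \<in> borel_measurable borel" and c: "c > 0"
  shows integral_lborel_affine:
      "(\<integral>x. f x \<partial>lborel) = c ^ DIM('a) * (\<integral>x. f (t + c *\<^sub>R x) \<partial>lborel)"
    and integrable_lborel_affine:
      "integrable lborel (\<lambda>x. f (t + c *\<^sub>R x)) \<longleftrightarrow> integrable lborel f"
proof -
  have eq: "lborel = density (distr lborel borel (\<lambda>x. t + c *\<^sub>R x)) (\<lambda>_. ennreal (c ^ DIM('a)))"
    using lborel_affine[of c t] c by (simp add: ennreal_power)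
  show "(\<integral>x. f x \<partial>lborel) = c ^ DIM('a) * (\<integral>x. f (t + c *\<^sub>R x) \<partial>lborel)"
    using c by (subst eq, subst integral_density) (auto simp: integral_distr)
  show "integrable lborel (\<lambda>x. f (t + c *\<^sub>R x)) \<longleftrightarrow> integrable lborel f"
    using c by (subst (2) eq, subst integrable_density) (auto simp: integrable_distr_eq)
qed

lemma AE_lborel_affine:
  fixes t :: "'a::euclidean_space"
  assumes [measurable]: "Measurable.pred borel P" and c: "c > 0" and "AE x in lborel. P x"
  shows "AE x in lborel. P (t + c *\<^sub>R x)"
proof -
  have eq: "lborel = density (distr lborel borel (\<lambda>x. t + c *\<^sub>R x)) (\<lambda>_. ennreal (c ^ DIM('a)))"
    using lborel_affine[of c t] c by (simp add: ennreal_power)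
  have "AE x in density (distr lborel borel (\<lambda>x. t + c *\<^sub>R x)) (\<lambda>_. ennreal (c ^ DIM('a))). P x"
    unfolding eq[symmetric] by fact
  then show ?thesis
    using c by (simp add: AE_density AE_distr_iff)
qed

text \<open>The product form makes moments factor over coordinates; the radial form
  \<open>gauss_dens_eq\<close> serves the tail estimates and the symmetry under a change of
  sign.\<close>

definition gauss_dens :: "'a::euclidean_space \<Rightarrow> real" where
  "gauss_dens x = (\<Prod>b\<in>Basis. std_normal_density (x \<bullet> b))"

definition gauss :: "'a::euclidean_space measure" where
  "gauss = density lborel gauss_dens"

lemma gauss_dens_eq:
  "gauss_dens (x::'a::euclidean_space) = (1 / sqrt (2 * pi)) ^ DIM('a) * exp (- (norm x)\<^sup>2 / 2)"
proof -
  have "(norm x)\<^sup>2 = (\<Sum>b\<in>Basis. (x \<bullet> b)\<^sup>2)"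
    by (subst power2_norm_eq_inner, subst euclidean_inner) (simp add: power2_eq_square)
  then show ?thesis
    by (simp add: gauss_dens_def std_normal_density_def prod.distrib prod_dividef exp_sum[symmetric]
        sum_negf sum_divide_distrib power_one_over)
qed

lemma gauss_dens_nonneg [simp]: "0 \<le> gauss_dens x"
  by (simp add: gauss_dens_eq)

lemma gauss_dens_minus [simp]: "gauss_dens (- x) = gauss_dens x"
  by (simp add: gauss_dens_eq)

lemma gauss_dens_measurable [measurable]: "gauss_dens \<in> borel_measurable borel"
  unfolding gauss_dens_eq[abs_def] by measurable

lemma sets_gauss [simp, measurable_cong]: "sets gauss = sets borel"
  by (simp add: gauss_def)

lemma space_gauss [simp]: "space gauss = UNIV"
  by (simp add: gauss_def)

lemma integral_gauss:
  fixes f :: "'a::euclidean_space \<Rightarrow> 'b::{banach, second_countable_topology}"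
  shows "f \<in> borel_measurable borel \<Longrightarrow> integral\<^sup>L gauss f = (\<integral>x. gauss_dens x *\<^sub>R f x \<partial>lborel)"
  unfolding gauss_def by (subst integral_density) auto

lemma integrable_gauss:
  fixes f :: "'a::euclidean_space \<Rightarrow> 'b::{banach, second_countable_topology}"
  shows "f \<in> borel_measurable borel \<Longrightarrow>
   integrable gauss f \<longleftrightarrow> integrable lborel (\<lambda>x. gauss_dens x *\<^sub>R f x)"
  unfolding gauss_def by (subst integrable_density) auto

lemma prob_space_gauss: "prob_space (gauss :: 'a::euclidean_space measure)"
proof
  have "emeasure gauss (UNIV :: 'a set) = (\<integral>\<^sup>+x. (\<Prod>b\<in>Basis. ennreal (std_normal_density ((x::'a) \<bullet> b))) \<partial>lborel)"
    unfolding gauss_def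
    by (subst emeasure_density) (auto simp: gauss_dens_def prod_ennreal)
  also have "\<dots> = (\<Prod>b\<in>(Basis::'a set). \<integral>\<^sup>+t. ennreal (std_normal_density t) \<partial>lborel)"
    by (rule nn_integral_lborel_prod) auto
  also have "\<dots> = 1"
    by (subst nn_integral_eq_integral) (auto intro: AE_I2)
  finally show "emeasure gauss (space (gauss :: 'a measure)) = 1" by simp
qed

text \<open>Any power of \<^term>\<open>1 + norm x\<close> is absorbed by the Gaussian factor, so polynomial
  bounds suffice for all dominated convergence arguments.\<close>

lemma gauss_dens_poly_le:
  "(1 + norm x) ^ k * gauss_dens x \<le> fact k * exp 2 * gauss_dens ((1 / sqrt 2) *\<^sub>R (x::'a::euclidean_space))"
proof -
  let ?K = "(1 / sqrt (2 * pi)) ^ DIM('a)" and ?t = "norm x"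
  \<comment> \<open>A single term of the exponential series gives
    \<open>(1 + t) ^ k \<le> fact k * exp (1 + t)\<close>. Half of the Gaussian exponent then
    absorbs this exponential by completing the square, hence the rescaling by
    \<open>1 / sqrt 2\<close>.\<close>
  have "(\<Sum>n\<in>{k}. inverse (fact n) * (1 + ?t) ^ n) \<le> (\<Sum>n. inverse (fact n) * (1 + ?t) ^ n)"
    using summable_exp[of "1 + ?t"] by (intro sum_le_suminf) auto
  then have "(1 + ?t) ^ k \<le> fact k * exp (1 + ?t)"
    by (simp add: exp_def field_simps)
  then have "(1 + ?t) ^ k * exp (- ?t\<^sup>2 / 2) \<le> fact k * exp (1 + ?t) * exp (- ?t\<^sup>2 / 2)"
    by (intro mult_right_mono) auto
  also have "\<dots> = fact k * exp (1 + ?t - ?t\<^sup>2 / 2)"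
    by (simp add: exp_add[symmetric] exp_diff exp_minus field_simps)
  also have "1 + ?t - ?t\<^sup>2 / 2 \<le> 2 - ?t\<^sup>2 / 4"
    using zero_le_power2[of "?t / 2 - 1"] by (simp add: power2_eq_square algebra_simps)
  finally have "(1 + ?t) ^ k * exp (- ?t\<^sup>2 / 2) \<le> fact k * (exp 2 * exp (- ?t\<^sup>2 / 4))"
    by (simp add: mult_exp_exp)
  then have "?K * ((1 + ?t) ^ k * exp (- ?t\<^sup>2 / 2)) \<le> ?K * (fact k * (exp 2 * exp (- ?t\<^sup>2 / 4)))"
    by (intro mult_left_mono) auto
  then show ?thesis
    by (simp add: gauss_dens_eq mult_ac power_divide)
qed

lemma gauss_dens_poly_bound:
  obtains C where "C > 0" "\<And>x::'a::euclidean_space. (1 + norm x) ^ k * gauss_dens x \<le> C"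
proof -
  let ?K = "(1 / sqrt (2 * pi)) ^ DIM('a)"
  have "gauss_dens x \<le> ?K" for x :: 'a
    unfolding gauss_dens_eq by (intro mult_left_le) auto
  then have "(1 + norm x) ^ k * gauss_dens x \<le> fact k * exp 2 * ?K" for x :: 'a
    by (intro order.trans[OF gauss_dens_poly_le mult_left_mono]) auto
  then show thesis
    by (intro that[of "fact k * exp 2 * ?K"]) auto
qed

lemma integrable_gauss_dens: "integrable lborel (gauss_dens :: 'a::euclidean_space \<Rightarrow> real)"
proof -
  interpret prob_space "gauss :: 'a measure" by (rule prob_space_gauss)
  have "integrable (gauss :: 'a measure) (\<lambda>_. 1::real)" by simp
  then show ?thesis by (subst (asm) integrable_gauss) auto
qed

lemma integrable_poly_gauss: "integrable gauss (\<lambda>x::'a::euclidean_space. (1 + norm x) ^ k)"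
proof -
  have "integrable lborel (\<lambda>x::'a. gauss_dens (0 + (1 / sqrt 2) *\<^sub>R x))"
    by (subst integrable_lborel_affine) (auto simp: integrable_gauss_dens)
  then have "integrable lborel (\<lambda>x::'a. fact k * exp 2 * gauss_dens ((1 / sqrt 2) *\<^sub>R x))"
    by simp
  then have "integrable lborel (\<lambda>x::'a. (1 + norm x) ^ k * gauss_dens x)"
    by (rule Bochner_Integration.integrable_bound) (auto intro!: order.trans[OF gauss_dens_poly_le])
  then show ?thesis
    by (subst integrable_gauss) (auto simp: mult.commute)
qed

lemma integrable_gauss_poly_bound:
  fixes f :: "'a::euclidean_space \<Rightarrow> real"
  assumes [measurable]: "f \<in> borel_measurable borel" and "\<And>x. \<bar>f x\<bar> \<le> C * (1 + norm x) ^ k"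
  shows "integrable gauss f"
proof (rule Bochner_Integration.integrable_bound)
  show "integrable gauss (\<lambda>x::'a. C * (1 + norm x) ^ k)"
    using integrable_poly_gauss by (rule integrable_mult_right)
  show "AE x in gauss. norm (f x) \<le> norm (C * (1 + norm x) ^ k)"
    using order.trans[OF assms(2) abs_ge_self] by simp
qed auto

lemma integral_gauss_minus:
  fixes f :: "'a::euclidean_space \<Rightarrow> real"
  assumes [measurable]: "f \<in> borel_measurable borel"
  shows "(\<integral>x. f (- x) \<partial>gauss) = (\<integral>x. f x \<partial>gauss)"
proof -
  have eq: "(lborel :: 'a measure) = distr lborel borel uminus"
    using lborel_affine[of "-1" "0::'a"] by (simp add: density_1)
  have "(\<integral>x. gauss_dens x * f x \<partial>lborel) = (\<integral>x. gauss_dens x * f x \<partial>(distr lborel borel uminus))"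
    unfolding eq[symmetric] ..
  also have "\<dots> = (\<integral>x. gauss_dens (- x) * f (- x) \<partial>lborel)"
    by (rule integral_distr) auto
  finally show ?thesis
    by (simp add: integral_gauss)
qed

lemma integral_gauss_odd:
  fixes f :: "'a::euclidean_space \<Rightarrow> real"
  assumes "f \<in> borel_measurable borel" "\<And>x. f (- x) = - f x"
  shows "(\<integral>x. f x \<partial>gauss) = 0"
  using integral_gauss_minus[OF assms(1)] by (simp add: assms(2))

lemma gauss_moment_prod:
  "(\<integral>x. (\<Prod>b\<in>Basis. (x \<bullet> b) ^ k b) \<partial>(gauss :: 'a::euclidean_space measure))
   = (\<Prod>b\<in>Basis. \<integral>t. std_normal_density t * t ^ k b \<partial>lborel)"
  unfolding integral_lborel_prod[OF integrable_std_normal_moment, of k, symmetric]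
  by (subst integral_gauss) (simp_all add: gauss_dens_def prod.distrib[symmetric])

lemma gauss_second_moment_Basis:
  assumes "b \<in> Basis" "c \<in> (Basis :: 'a::euclidean_space set)"
  shows "(\<integral>x. (x \<bullet> b) * (x \<bullet> c) \<partial>gauss) = b \<bullet> c"
proof -
  define k where "k d = (if d = b then 1 else 0) + (if d = c then 1 else 0 :: nat)" for d
  have 0: "(\<integral>t. std_normal_density t * t ^ 0 \<partial>lborel) = 1"
    and 1: "(\<integral>t. std_normal_density t * t ^ 1 \<partial>lborel) = 0"
    and 2: "(\<integral>t. std_normal_density t * t ^ 2 \<partial>lborel) = 1"
    using integral_std_normal_moment_even[of 0] integral_std_normal_moment_odd[of 0]
      integral_std_normal_moment_even[of 1] by simp_all
  have pw: "(\<Prod>d\<in>Basis. (x \<bullet> d) ^ k d) = (x \<bullet> b) * (x \<bullet> c)" for x :: 'a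
    using assms by (simp add: k_def power_add prod.distrib if_distrib[of "\<lambda>n. _ ^ n"] cong: if_cong)
  have "(\<integral>x. (x \<bullet> b) * (x \<bullet> c) \<partial>gauss) = (\<Prod>d\<in>Basis. \<integral>t. std_normal_density t * t ^ k d \<partial>lborel)"
    using gauss_moment_prod[of k] by (simp add: pw)
  also have "\<dots> = b \<bullet> c"
  proof (cases "b = c")
    case True
    then have "(\<integral>t. std_normal_density t * t ^ k d \<partial>lborel) = 1" for d
      using 0 2 by (simp add: k_def numeral_2_eq_2)
    then show ?thesis using True assms by (simp add: inner_Basis)
  next
    case False
    then have "(\<integral>t. std_normal_density t * t ^ k b \<partial>lborel) = 0"
      using 1 by (simp add: k_def)
    then show ?thesis using False assms by (auto simp: inner_Basis intro!: prod_zero)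
  qed
  finally show ?thesis .
qed

text \<open>Linear functionals are combinations of the coordinates, whose covariance matrix under
  \<open>gauss\<close> is the identity.\<close>

lemma gauss_second_moment_bilinear:
  fixes u v :: "'a::euclidean_space \<Rightarrow> real"
  assumes u: "linear u" and v: "linear v"
  shows "(\<integral>x. u x * v x \<partial>gauss) = (\<Sum>b\<in>Basis. u b * v b)"
proof -
  have rep: "w x = (\<Sum>b\<in>Basis. (x \<bullet> b) * w b)" if "linear w" for w :: "'a \<Rightarrow> real" and x
    using linear_sum[OF that, of "\<lambda>b. (x \<bullet> b) *\<^sub>R b" Basis]
    by (simp add: euclidean_representation linear_scale[OF that])
  have int: "integrable gauss (\<lambda>x::'a. (x \<bullet> b) * (x \<bullet> c))" if "b \<in> Basis" "c \<in> Basis" for b c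
  proof (rule integrable_gauss_poly_bound[where C=1 and k=2])
    fix x :: 'a
    have "\<bar>(x \<bullet> b) * (x \<bullet> c)\<bar> \<le> norm x * norm x"
      using that by (auto simp: abs_mult intro!: mult_mono Basis_le_norm)
    then show "\<bar>(x \<bullet> b) * (x \<bullet> c)\<bar> \<le> 1 * (1 + norm x) ^ 2"
      by (simp add: power2_eq_square algebra_simps) (smt (verit) norm_ge_zero)
  qed auto
  have "(\<integral>x. u x * v x \<partial>gauss) = (\<integral>x. (\<Sum>b\<in>Basis. \<Sum>c\<in>Basis. u b * v c * ((x \<bullet> b) * (x \<bullet> c))) \<partial>gauss)"
    by (subst rep[OF u], subst rep[OF v]) (simp add: sum_product mult_ac)
  also have "\<dots> = (\<Sum>b\<in>Basis. \<Sum>c\<in>Basis. u b * v c * (b \<bullet> c))"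
    using int by (simp add: gauss_second_moment_Basis)
  also have "\<dots> = (\<Sum>b\<in>Basis. u b * v b)"
    by (simp add: inner_Basis if_distrib sum.delta cong: if_cong sum.cong)
  finally show ?thesis .
qed

section \<open>Polynomial growth and Gaussian tails\<close>

lemma one_plus_norm_add: "1 + norm (a + b :: 'a::real_normed_vector) \<le> (1 + norm a) * (1 + norm b)"
proof -
  have "0 \<le> norm a * norm b" by simp
  then show ?thesis
    using norm_triangle_ineq[of a b] by (simp add: algebra_simps del: mult_nonneg_nonneg)
qed

text \<open>Measurability is included so that membership alone yields Gaussian integrability;
  closure under sums and products then makes most integrability goals a matter of syntax.\<close>

definition poly_bounded :: "('a::euclidean_space \<Rightarrow> real) \<Rightarrow> bool" where
  "poly_bounded f \<longleftrightarrow> f \<in> borel_measurable borel \<and> (\<exists>C k. \<forall>x. \<bar>f x\<bar> \<le> C * (1 + norm x) ^ k)"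

lemma poly_boundedI:
  "f \<in> borel_measurable borel \<Longrightarrow> (\<And>x. \<bar>f x\<bar> \<le> C * (1 + norm x) ^ k) \<Longrightarrow> poly_bounded f"
  unfolding poly_bounded_def by blast

lemma poly_bounded_integrable: "poly_bounded f \<Longrightarrow> integrable gauss f"
  unfolding poly_bounded_def using integrable_gauss_poly_bound by blast

lemma poly_boundedE:
  assumes "poly_bounded f"
  obtains C k where "C \<ge> 0" "\<And>x. \<bar>f x\<bar> \<le> C * (1 + norm x) ^ k"
proof -
  from assms obtain C k where Ck: "\<And>x. \<bar>f x\<bar> \<le> C * (1 + norm x) ^ k"
    unfolding poly_bounded_def by blast
  have "C \<ge> 0" using Ck[of 0] by simp
  with Ck that show thesis by blast
qed

lemma poly_bounded_const: "poly_bounded (\<lambda>_. c)"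
  by (rule poly_boundedI[of _ "\<bar>c\<bar>" 0]) auto

lemma poly_bounded_linear:
  assumes "linear f"
  shows "poly_bounded f"
proof -
  obtain K where K: "K > 0" "\<And>x. norm (f x) \<le> K * norm x"
    using linear_bounded_pos[OF assms] by blast
  have "\<bar>f x\<bar> \<le> K * (1 + norm x) ^ 1" for x
    using K(2)[of x] K(1) by (simp add: algebra_simps)
  then show ?thesis
    using assms
    by (intro poly_boundedI[of _ K 1] borel_measurable_continuous_onI linear_continuous_on)
      (auto simp: linear_conv_bounded_linear)
qed

lemma poly_bounded_add:
  assumes "poly_bounded f" "poly_bounded g"
  shows "poly_bounded (\<lambda>x. f x + g x)"
proof -
  obtain C k where f: "C \<ge> 0" "\<And>x. \<bar>f x\<bar> \<le> C * (1 + norm x) ^ k"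
    using poly_boundedE[OF assms(1)] by blast
  obtain D l where g: "D \<ge> 0" "\<And>x. \<bar>g x\<bar> \<le> D * (1 + norm x) ^ l"
    using poly_boundedE[OF assms(2)] by blast
  have "\<bar>f x + g x\<bar> \<le> (C + D) * (1 + norm x) ^ (k + l)" for x
  proof -
    have "\<bar>f x + g x\<bar> \<le> C * (1 + norm x) ^ k + D * (1 + norm x) ^ l"
      using f(2)[of x] g(2)[of x] by linarith
    also have "\<dots> \<le> C * (1 + norm x) ^ (k + l) + D * (1 + norm x) ^ (k + l)"
      using f(1) g(1) by (intro add_mono mult_left_mono power_increasing) auto
    finally show ?thesis by (simp add: algebra_simps)
  qed
  with assms show ?thesis
    by (intro poly_boundedI) (auto simp: poly_bounded_def)
qed

lemma poly_bounded_mult: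
  assumes "poly_bounded f" "poly_bounded g"
  shows "poly_bounded (\<lambda>x. f x * g x)"
proof -
  obtain C k where f: "C \<ge> 0" "\<And>x. \<bar>f x\<bar> \<le> C * (1 + norm x) ^ k"
    using poly_boundedE[OF assms(1)] by blast
  obtain D l where g: "D \<ge> 0" "\<And>x. \<bar>g x\<bar> \<le> D * (1 + norm x) ^ l"
    using poly_boundedE[OF assms(2)] by blast
  have "\<bar>f x * g x\<bar> \<le> (C * D) * (1 + norm x) ^ (k + l)" for x
  proof -
    have "\<bar>f x * g x\<bar> \<le> (C * (1 + norm x) ^ k) * (D * (1 + norm x) ^ l)"
      unfolding abs_mult using f g by (intro mult_mono) auto
    then show ?thesis by (simp add: power_add mult_ac)
  qed
  with assms show ?thesis
    by (intro poly_boundedI) (auto simp: poly_bounded_def)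
qed

lemma poly_bounded_diff:
  "poly_bounded f \<Longrightarrow> poly_bounded g \<Longrightarrow> poly_bounded (\<lambda>x. f x - g x)"
  using poly_bounded_add[OF _ poly_bounded_mult[OF poly_bounded_const[of "-1"]], of f g] by simp

lemma poly_bounded_sum:
  "(\<And>i. i \<in> I \<Longrightarrow> poly_bounded (f i)) \<Longrightarrow> poly_bounded (\<lambda>x. \<Sum>i\<in>I. f i x)"
  by (induction I rule: infinite_finite_induct)
     (auto intro: poly_bounded_add poly_bounded_const[of 0])

lemma linear_bilinear:
  assumes "bilinear B" shows "linear (B z)" "linear (\<lambda>x. B x z)"
  using assms by (auto simp: bilinear_def)

lemma bilinear_diag_expand:
  fixes w :: "'a::euclidean_space"
  assumes "bilinear B"
  shows "B w w = (\<Sum>b\<in>Basis. (w \<bullet> b) *\<^sub>R B b w)"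
  using linear_sum[OF linear_bilinear(2)[OF assms, of w], of "\<lambda>b. (w \<bullet> b) *\<^sub>R b" Basis]
    linear_scale[OF linear_bilinear(2)[OF assms, of w]]
  by (simp add: euclidean_representation)

lemmas poly_bounded_intros = poly_bounded_const poly_bounded_linear poly_bounded_add
  poly_bounded_mult poly_bounded_diff

lemma
  fixes B :: "'a::euclidean_space \<Rightarrow> 'a \<Rightarrow> real"
  assumes "bilinear B"
  shows poly_bounded_bilinear_diag: "poly_bounded (\<lambda>w. B w w)"
    and gauss_bilinear_diag: "(\<integral>w. B w w \<partial>gauss) = (\<Sum>b\<in>Basis. B b b)"
proof -
  have eq: "B w w = (\<Sum>b\<in>Basis. (w \<bullet> b) * B b w)" for w
    using bilinear_diag_expand[OF assms, of w] by simp
  have lin: "linear (B b)" "linear (\<lambda>w::'a. w \<bullet> b)" for b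
    using linear_bilinear[OF assms] bounded_linear.linear[OF bounded_linear_inner_left] by auto
  have pb: "poly_bounded (\<lambda>w. (w \<bullet> b) * B b w)" for b
    using lin by (intro poly_bounded_intros)
  then show "poly_bounded (\<lambda>w. B w w)"
    unfolding eq by (rule poly_bounded_sum)
  have "(\<integral>w. B w w \<partial>gauss) = (\<Sum>b\<in>Basis. \<integral>w. (w \<bullet> b) * B b w \<partial>gauss)"
    unfolding eq using poly_bounded_integrable[OF pb] by simp
  also have "\<dots> = (\<Sum>b\<in>Basis. \<Sum>d\<in>Basis. (d \<bullet> b) * B b d)"
    using lin by (simp add: gauss_second_moment_bilinear)
  also have "\<dots> = (\<Sum>b\<in>Basis. B b b)"
    by (simp add: inner_Basis if_distrib[of "\<lambda>t. t * _"] sum.delta' cong: if_cong sum.cong)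
  finally show "(\<integral>w. B w w \<partial>gauss) = (\<Sum>b\<in>Basis. B b b)" .
qed

text \<open>In the variable \<open>h = s (z + w)\<close> the weighted Gaussian density becomes
  \<open>F\<close>. Since \<open>1 + norm h / s \<le> (1 + norm w) * (1 + norm z)\<close> and the
  Gaussian absorbs any power of \<open>1 + norm w\<close>, \<open>F\<close> decays like any chosen
  power of \<open>1 + norm h / s\<close>, at the price of the same power of
  \<open>1 + norm z\<close>. On the tail, \<open>norm h \<ge> \<epsilon>\<close> converts this decay
  into powers of \<open>s\<close>.\<close>

lemma
  fixes \<rho> :: "'a::euclidean_space \<Rightarrow> real"
  assumes [measurable]: "\<rho> \<in> borel_measurable borel" and nn: "\<And>h. 0 \<le> \<rho> h"
    and int: "integrable lborel (\<lambda>h. \<rho> h / (1 + norm h) ^ L)"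
  shows gauss_integrable_rescaled: "\<And>s z. 0 < s \<Longrightarrow> s \<le> 1 \<Longrightarrow>
      integrable gauss (\<lambda>w. (1 + norm w) * \<rho> (s *\<^sub>R (z + w)))"
    and gauss_rescaled_tail: "\<And>\<epsilon>. 0 < \<epsilon> \<Longrightarrow> \<exists>C\<ge>0. \<forall>s z. 0 < s \<longrightarrow> s \<le> 1 \<longrightarrow>
      (\<integral>w. (1 + norm w) * (\<rho> (s *\<^sub>R (z + w)) * indicator {h. \<epsilon> \<le> norm h} (s *\<^sub>R (z + w))) \<partial>gauss)
        \<le> C * s ^ 3 * (1 + norm z) ^ (L + DIM('a) + 3)"
proof -
  \<comment> \<open>Exponent budget: \<open>L\<close> matches the weight in the integrability
    hypothesis, \<open>DIM('a)\<close> pays for the Jacobian of the substitution, and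
    \<open>3\<close> leaves the rate \<open>s ^ 3\<close>. The extra \<open>1\<close> in
    \<open>K + 1\<close> is for the factor \<open>1 + norm w\<close>.\<close>
  define K where "K = L + DIM('a) + 3"
  obtain C where C: "C > 0" "\<And>x::'a. (1 + norm x) ^ (K + 1) * gauss_dens x \<le> C"
    using gauss_dens_poly_bound[of "K + 1"] by blast
  define F where "F s z h = gauss_dens ((1 / s) *\<^sub>R h - z) * (1 + norm ((1 / s) *\<^sub>R h - z))" for s and z h :: 'a
  have [measurable]: "F s z \<in> borel_measurable borel" for s z
    unfolding F_def[abs_def] by measurable
  have F_nonneg: "0 \<le> F s z h" for s z h by (simp add: F_def)
  have F_le: "F s z h \<le> C * (1 + norm z) ^ K / (1 + norm h / s) ^ K" if "0 < s" for s z h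
  proof -
    let ?w = "(1 / s) *\<^sub>R h - z"
    have "1 + norm h / s \<le> (1 + norm ?w) * (1 + norm z)"
      using one_plus_norm_add[of ?w z] that by simp
    then have "(1 + norm h / s) ^ K \<le> (1 + norm ?w) ^ K * (1 + norm z) ^ K"
      using that by (metis power_mono power_mult_distrib add_nonneg_nonneg zero_le_one norm_ge_zero divide_nonneg_pos)
    then have "F s z h * (1 + norm h / s) ^ K \<le> F s z h * ((1 + norm ?w) ^ K * (1 + norm z) ^ K)"
      by (intro mult_left_mono F_nonneg)
    also have "\<dots> = ((1 + norm ?w) ^ (K + 1) * gauss_dens ?w) * (1 + norm z) ^ K"
      by (simp add: F_def mult_ac)
    also have "\<dots> \<le> C * (1 + norm z) ^ K"
      by (intro mult_right_mono C) auto
    finally show ?thesis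
      using that by (subst pos_le_divide_eq) (auto intro!: zero_less_power add_pos_nonneg)
  qed
  have eqF: "F s z (s *\<^sub>R z + s *\<^sub>R w) = gauss_dens w * (1 + norm w)" if "0 < s" for s z w
    using that by (simp add: F_def scaleR_add_right)
  show "integrable gauss (\<lambda>w. (1 + norm w) * \<rho> (s *\<^sub>R (z + w)))" if s: "0 < s" "s \<le> 1" for s z
  proof -
    have "integrable lborel (\<lambda>h. F s z h * \<rho> h)"
    proof (rule Bochner_Integration.integrable_bound)
      show "integrable lborel (\<lambda>h. C * (1 + norm z) ^ K * (\<rho> h / (1 + norm h) ^ L))"
        by (intro integrable_mult_right int)
      have "F s z h * \<rho> h \<le> C * (1 + norm z) ^ K * (\<rho> h / (1 + norm h) ^ L)" for h
      proof -
        have "1 + norm h \<le> 1 + norm h / s"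
          using s by (simp add: field_simps mult_left_le_one_le)
        then have "(1 + norm h) ^ L \<le> (1 + norm h / s) ^ K"
          unfolding K_def
          using s by (intro order.trans[OF power_mono power_increasing]) auto
        then have "C * (1 + norm z) ^ K / (1 + norm h / s) ^ K \<le> C * (1 + norm z) ^ K / (1 + norm h) ^ L"
          using C(1) s by (intro divide_left_mono) (auto intro!: mult_pos_pos zero_less_power add_pos_nonneg)
        with F_le[OF s(1), of z h] have "F s z h \<le> C * (1 + norm z) ^ K / (1 + norm h) ^ L"
          by linarith
        from mult_right_mono[OF this nn[of h]] show ?thesis by simp
      qed
      then show "AE h in lborel. norm (F s z h * \<rho> h) \<le> norm (C * (1 + norm z) ^ K * (\<rho> h / (1 + norm h) ^ L))"
        using C(1) by (intro AE_I2) (auto simp: nn F_nonneg)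
    qed auto
    then have "integrable lborel (\<lambda>w. F s z (s *\<^sub>R z + s *\<^sub>R w) * \<rho> (s *\<^sub>R z + s *\<^sub>R w))"
      by (subst integrable_lborel_affine[where f="\<lambda>h. F s z h * \<rho> h"]) (use s in auto)
    then show ?thesis
      unfolding eqF[OF s(1)] by (subst integrable_gauss) (auto simp: scaleR_add_right mult_ac)
  qed
  fix \<epsilon> :: real assume \<epsilon>: "0 < \<epsilon>"
  let ?T = "\<lambda>s z. \<integral>w. (1 + norm w) * (\<rho> (s *\<^sub>R (z + w)) * indicator {h. \<epsilon> \<le> norm h} (s *\<^sub>R (z + w))) \<partial>gauss"
  define J where "J = (\<integral>h. \<rho> h / (1 + norm h) ^ L \<partial>lborel)"
  have J: "0 \<le> J" unfolding J_def by (intro integral_nonneg_AE AE_I2) (auto simp: nn)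
  define A where "A = (1 + 1 / \<epsilon>) ^ K"
  have A: "0 \<le> A" using \<epsilon> by (simp add: A_def)
  have "?T s z
      \<le> C * A * J * s ^ 3 * (1 + norm z) ^ K" if s: "0 < s" "s \<le> 1" for s z
  proof -
    let ?G = "\<lambda>h. F s z h * (\<rho> h * indicator {h. \<epsilon> \<le> norm h} h)"
    have G_le: "?G h \<le> C * A * s ^ (DIM('a) + 3) * (1 + norm z) ^ K * (\<rho> h / (1 + norm h) ^ L)" for h
    proof (cases "\<epsilon> \<le> norm h")
      case True
      have "1 + norm h \<le> (1 + 1 / \<epsilon>) * norm h"
        using True \<epsilon> by (simp add: field_simps)
      also have "\<dots> = s * (1 + 1 / \<epsilon>) * (norm h / s)"
        using s by simp
      also have "\<dots> \<le> s * (1 + 1 / \<epsilon>) * (1 + norm h / s)"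
        using s \<epsilon> by (intro mult_left_mono) auto
      finally have "(1 + norm h) ^ K \<le> (s * (1 + 1 / \<epsilon>) * (1 + norm h / s)) ^ K"
        by (intro power_mono) auto
      then have 1: "(1 + norm h) ^ K \<le> s ^ K * A * (1 + norm h / s) ^ K"
        by (simp add: A_def power_mult_distrib)
      have "(1 + norm h) ^ L * 1 \<le> (1 + norm h) ^ L * (1 + norm h) ^ (DIM('a) + 3)"
        by (intro mult_left_mono one_le_power) auto
      then have 2: "(1 + norm h) ^ L \<le> (1 + norm h) ^ K"
        by (simp add: K_def power_add mult_ac)
      have 3: "s ^ K \<le> s ^ (DIM('a) + 3)"
        using s by (intro power_decreasing) (auto simp: K_def)
      have pos: "0 < (1 + norm h / s) ^ K" "0 < (1 + norm h) ^ L"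
        using s by (auto intro!: zero_less_power add_pos_nonneg)
      have "(1 + norm h) ^ L \<le> s ^ (DIM('a) + 3) * A * (1 + norm h / s) ^ K"
        using 1 2 mult_right_mono[OF 3, of "A * (1 + norm h / s) ^ K"] A pos(1) by (simp add: mult_ac)
      then have "1 / (1 + norm h / s) ^ K \<le> A * s ^ (DIM('a) + 3) / (1 + norm h) ^ L"
        using pos by (simp add: field_simps)
      from mult_left_mono[OF this, of "C * (1 + norm z) ^ K"]
      have "C * (1 + norm z) ^ K / (1 + norm h / s) ^ K
          \<le> C * (1 + norm z) ^ K * (A * s ^ (DIM('a) + 3) / (1 + norm h) ^ L)"
        using C(1) by simp
      with F_le[OF s(1), of z h]
      have "F s z h \<le> C * (1 + norm z) ^ K * (A * s ^ (DIM('a) + 3) / (1 + norm h) ^ L)"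
        by linarith
      from mult_right_mono[OF this nn[of h]] True show ?thesis
        by (simp add: mult_ac)
    next
      case False
      then show ?thesis using C(1) A s nn by simp
    qed
    have intb: "integrable lborel (\<lambda>h. C * A * s ^ (DIM('a) + 3) * (1 + norm z) ^ K * (\<rho> h / (1 + norm h) ^ L))"
      by (intro integrable_mult_right int)
    have "integrable lborel ?G"
      using G_le C(1) A s
      by (intro Bochner_Integration.integrable_bound[OF intb])
         (auto simp: nn F_nonneg intro!: AE_I2 order.trans[OF _ abs_ge_self])
    then have "(\<integral>h. ?G h \<partial>lborel) \<le> C * A * s ^ (DIM('a) + 3) * (1 + norm z) ^ K * J"
      using integral_mono[OF _ intb G_le] unfolding integral_mult_right_zero J_def[symmetric] by blast
    moreover have "(\<integral>h. ?G h \<partial>lborel) = s ^ DIM('a) * (\<integral>w. ?G (s *\<^sub>R z + s *\<^sub>R w) \<partial>lborel)"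
      using s by (intro integral_lborel_affine) auto
    moreover have "(\<integral>w. ?G (s *\<^sub>R z + s *\<^sub>R w) \<partial>lborel) = ?T s z"
      unfolding eqF[OF s(1)] by (subst integral_gauss) (auto simp: scaleR_add_right mult_ac)
    ultimately have "s ^ DIM('a) * ?T s z
       \<le> s ^ DIM('a) * (C * A * J * s ^ 3 * (1 + norm z) ^ K)"
      by (simp add: power_add mult_ac)
    then show ?thesis
      by (rule mult_left_le_imp_le) (use s in auto)
  qed
  then show "\<exists>C\<ge>0. \<forall>s z. 0 < s \<longrightarrow> s \<le> 1 \<longrightarrow>
      ?T s z
        \<le> C * s ^ 3 * (1 + norm z) ^ (L + DIM('a) + 3)"
    using C(1) A J by (intro exI[of _ "C * A * J"]) (auto simp: K_def)
qed

section \<open>Posterior means under a locally smooth prior\<close>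

text \<open>A Peano expansion at the single point \<open>x\<close>, with \<open>v\<close> as
  gradient and \<open>B\<close> as Hessian. The remainder estimates use no more than this, and it
  composes without any derivatives at nearby points.\<close>

definition has_taylor2 :: "('a::euclidean_space \<Rightarrow> real) \<Rightarrow> 'a \<Rightarrow> 'a \<Rightarrow> ('a \<Rightarrow> 'a \<Rightarrow> real) \<Rightarrow> bool" where
  "has_taylor2 f x v B \<longleftrightarrow> bilinear B \<and> (\<forall>h k. B h k = B k h) \<and>
     (\<forall>\<eta>>0. \<exists>\<epsilon>>0. \<forall>h. norm h < \<epsilon> \<longrightarrow>
        \<bar>f (x + h) - f x - v \<bullet> h - B h h / 2\<bar> \<le> \<eta> * (norm h)\<^sup>2)"

text \<open>The lower bound keeps the denominator of the posterior mean above an inverse polynomial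
  in the noise; weighted integrability controls the prior far from \<open>x\<close> and at its
  singularities. Neither boundedness nor finite total mass is assumed.\<close>

locale regular_prior =
  fixes \<pi> :: "'a::euclidean_space \<Rightarrow> real" and x v :: 'a and B :: "'a \<Rightarrow> 'a \<Rightarrow> real"
    and c\<^sub>0 :: real and k L :: nat
  assumes prior_measurable [measurable]: "\<pi> \<in> borel_measurable borel"
    and prior_nonneg: "\<And>\<theta>. 0 \<le> \<pi> \<theta>"
    and prior_pos: "0 < \<pi> x"
    and prior_lower: "0 < c\<^sub>0" "AE \<theta> in lborel. c\<^sub>0 / (1 + norm \<theta>) ^ k \<le> \<pi> \<theta>"
    and prior_integrable: "integrable lborel (\<lambda>\<theta>. \<pi> \<theta> / (1 + norm \<theta>) ^ L)"
    and prior_taylor: "has_taylor2 \<pi> x v B"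
begin

lemma B_bilinear: "bilinear B" and B_sym: "B h h' = B h' h"
  using prior_taylor by (auto simp: has_taylor2_def)

lemma B_linear: "linear (B h)"
  using linear_bilinear[OF B_bilinear] by blast

definition remainder :: "'a \<Rightarrow> real" where
  "remainder h = \<pi> (x + h) - \<pi> x - v \<bullet> h - B h h / 2"

lemma B_measurable [measurable]: "(\<lambda>h. B h h) \<in> borel_measurable borel"
  using poly_bounded_bilinear_diag[OF B_bilinear] by (simp add: poly_bounded_def)

lemma remainder_measurable [measurable]: "remainder \<in> borel_measurable borel"
  unfolding remainder_def[abs_def] by measurable

lemma shifted_prior_integrable: "integrable lborel (\<lambda>h. \<pi> (x + h) / (1 + norm h) ^ L)"
proof -
  have "integrable lborel (\<lambda>h. \<pi> (x + 1 *\<^sub>R h) / (1 + norm (x + 1 *\<^sub>R h)) ^ L)"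
    by (subst integrable_lborel_affine[where f="\<lambda>\<theta>. \<pi> \<theta> / (1 + norm \<theta>) ^ L"])
       (auto simp: prior_integrable)
  from integrable_mult_right[OF this, of "(1 + norm x) ^ L"]
  have "integrable lborel (\<lambda>h. (1 + norm x) ^ L * (\<pi> (x + h) / (1 + norm (x + h)) ^ L))"
    by (simp only: scaleR_one)
  then show ?thesis
  proof (rule Bochner_Integration.integrable_bound)
    have "\<pi> (x + h) / (1 + norm h) ^ L \<le> (1 + norm x) ^ L * (\<pi> (x + h) / (1 + norm (x + h)) ^ L)" for h
    proof -
      have "(1 + norm (x + h)) ^ L \<le> (1 + norm x) ^ L * (1 + norm h) ^ L"
        unfolding power_mult_distrib[symmetric] by (intro power_mono one_plus_norm_add) auto
      then have "1 / (1 + norm h) ^ L \<le> (1 + norm x) ^ L / (1 + norm (x + h)) ^ L"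
        by (simp add: divide_simps add_pos_nonneg zero_less_power less_imp_neq[symmetric])
      from mult_left_mono[OF this prior_nonneg[of "x + h"]] show ?thesis
        by (simp add: mult_ac)
    qed
    then show "AE h in lborel. norm (\<pi> (x + h) / (1 + norm h) ^ L)
        \<le> norm ((1 + norm x) ^ L * (\<pi> (x + h) / (1 + norm (x + h)) ^ L))"
      by (intro AE_I2) (simp add: prior_nonneg)
  qed auto
qed

lemma prior_gauss_integrable:
  assumes "0 < s" "s \<le> 1"
  shows "integrable gauss (\<lambda>w. (1 + norm w) * \<pi> (x + s *\<^sub>R (z + w)))"
  using gauss_integrable_rescaled[where \<rho>="\<lambda>h. \<pi> (x + h)", OF _ _ shifted_prior_integrable assms]
    prior_nonneg by simp

lemma prior_gauss_integrable_weighted: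
  assumes s: "0 < s" "s \<le> 1" and [measurable]: "f \<in> borel_measurable borel"
    and f: "\<And>w. \<bar>f w\<bar> \<le> C * (1 + norm w)"
  shows "integrable gauss (\<lambda>w. f w * \<pi> (x + s *\<^sub>R (z + w)))"
proof (rule Bochner_Integration.integrable_bound)
  show "integrable gauss (\<lambda>w. C * ((1 + norm w) * \<pi> (x + s *\<^sub>R (z + w))))"
    using prior_gauss_integrable[OF s] by (rule integrable_mult_right)
  have "\<bar>f w * \<pi> (x + s *\<^sub>R (z + w))\<bar> \<le> C * ((1 + norm w) * \<pi> (x + s *\<^sub>R (z + w)))" for w
    using mult_right_mono[OF f[of w] prior_nonneg[of "x + s *\<^sub>R (z + w)"]]
    by (simp add: abs_mult prior_nonneg mult_ac)
  then show "AE w in gauss. norm (f w * \<pi> (x + s *\<^sub>R (z + w)))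
      \<le> norm (C * ((1 + norm w) * \<pi> (x + s *\<^sub>R (z + w))))"
    by (intro AE_I2) (auto intro: order.trans[OF _ abs_ge_self])
qed auto

lemma abs_inner_le_one_plus:
  assumes "e \<in> (Basis::'a set)"
  shows "\<bar>w \<bullet> e\<bar> \<le> 1 * (1 + norm w)"
  using Basis_le_norm[OF assms, of w] by simp

text \<open>Inside the Taylor radius the first term suffices. Outside it
  \<open>norm h / \<epsilon> \<ge> 1\<close>, so the subtracted second-order polynomial is absorbed
  by a cubic; the prior itself may be unbounded there and is left over for
  \<open>gauss_rescaled_tail\<close>.\<close>

lemma remainder_local_bound:
  assumes "\<eta> > 0"
  obtains \<epsilon> C where "\<epsilon> > 0" "C \<ge> 0"
    "\<And>h. \<bar>remainder h\<bar> \<le> \<eta> * (norm h)\<^sup>2 + C * norm h ^ 3 + \<pi> (x + h) * indicator {h. \<epsilon> \<le> norm h} h"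
proof -
  obtain \<epsilon> where \<epsilon>: "\<epsilon> > 0" "\<And>h. norm h < \<epsilon> \<Longrightarrow> \<bar>remainder h\<bar> \<le> \<eta> * (norm h)\<^sup>2"
    using prior_taylor assms unfolding has_taylor2_def remainder_def by metis
  obtain K where K: "K > 0" "\<And>h h'. \<bar>B h h'\<bar> \<le> K * norm h * norm h'"
    using bilinear_bounded_pos[OF B_bilinear] by auto
  define C where "C = (\<pi> x / \<epsilon> ^ 3 + norm v / \<epsilon> ^ 2 + K / \<epsilon>)"
  have C: "C \<ge> 0" using \<epsilon>(1) K(1) prior_pos by (simp add: C_def)
  have "\<bar>remainder h\<bar> \<le> \<eta> * (norm h)\<^sup>2 + C * norm h ^ 3 + \<pi> (x + h) * indicator {h. \<epsilon> \<le> norm h} h" for h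
  proof (cases "norm h < \<epsilon>")
    case True
    have "0 \<le> C * norm h ^ 3" using C by simp
    with True show ?thesis using \<epsilon>(2)[OF True] by (simp del: mult_nonneg_nonneg)
  next
    case False
    have t: "1 \<le> norm h / \<epsilon>" using False \<epsilon>(1) by simp
    have "\<bar>remainder h\<bar> \<le> \<pi> (x + h) + \<pi> x + \<bar>v \<bullet> h\<bar> + \<bar>B h h\<bar> / 2"
      unfolding remainder_def using prior_nonneg[of x] prior_nonneg[of "x + h"] by linarith
    also have "\<bar>v \<bullet> h\<bar> \<le> norm v * norm h" by (rule Cauchy_Schwarz_ineq2)
    also have "\<bar>B h h\<bar> / 2 \<le> K * norm h * norm h" using K(2)[of h h] by linarith
    finally have "\<bar>remainder h\<bar> \<le> \<pi> (x + h) + (\<pi> x * 1 + norm v * norm h * 1 + K * norm h * norm h * 1)"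
      by simp
    also have "\<dots> \<le> \<pi> (x + h) + (\<pi> x * (norm h / \<epsilon>) ^ 3 + norm v * norm h * (norm h / \<epsilon>)\<^sup>2
        + K * norm h * norm h * (norm h / \<epsilon>))"
      using t K(1) prior_nonneg by (intro add_mono mult_left_mono one_le_power) auto
    also have "\<dots> = \<pi> (x + h) + C * norm h ^ 3"
      by (simp add: C_def algebra_simps power2_eq_square power3_eq_cube power_divide)
    finally have "\<bar>remainder h\<bar> \<le> \<pi> (x + h) + C * norm h ^ 3" .
    moreover have "0 \<le> \<eta> * (norm h)\<^sup>2" using assms by simp
    ultimately show ?thesis using False by (simp del: mult_nonneg_nonneg zero_le_mult_iff)
  qed
  with \<epsilon>(1) C show thesis by (rule that)
qed

text \<open>The power of \<open>1 + norm z\<close> produced by \<open>gauss_rescaled_tail\<close>;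
  the other terms are raised to it so that all estimates share one factor.\<close>

definition deg :: nat where "deg = L + DIM('a) + 3"

lemma norm_scaled_power:
  assumes "0 < s" "m \<le> deg"
  shows "norm (s *\<^sub>R (z + w)) ^ m \<le> s ^ m * ((1 + norm z) ^ deg * (1 + norm w) ^ m)"
proof -
  have "norm (z + w) \<le> (1 + norm z) * (1 + norm w)"
    using one_plus_norm_add[of z w] by simp
  then have "norm (z + w) ^ m \<le> (1 + norm z) ^ m * (1 + norm w) ^ m"
    unfolding power_mult_distrib[symmetric] by (intro power_mono) auto
  also have "\<dots> \<le> (1 + norm z) ^ deg * (1 + norm w) ^ m"
    using assms by (intro mult_right_mono power_increasing) auto
  finally show ?thesis
    using assms(1) by (simp add: power_mult_distrib)
qed

text \<open>The coefficient of \<open>s\<^sup>2\<close> can be made arbitrarily small while that of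
  \<open>s ^ 3\<close> is merely finite: this is how a remainder \<open>o(s\<^sup>2)\<close>,
  uniform in \<open>z\<close> up to a polynomial factor, is expressed.\<close>

lemma remainder_gauss_bound:
  assumes "\<eta> > 0"
  obtains C where "C \<ge> 0" "\<And>s z. 0 < s \<Longrightarrow> s \<le> 1 \<Longrightarrow>
    integrable gauss (\<lambda>w. (1 + norm w) * \<bar>remainder (s *\<^sub>R (z + w))\<bar>) \<and>
    (\<integral>w. (1 + norm w) * \<bar>remainder (s *\<^sub>R (z + w))\<bar> \<partial>gauss) \<le> (\<eta> * s\<^sup>2 + C * s ^ 3) * (1 + norm z) ^ deg"
proof -
  let ?R = "\<lambda>s z w. (1 + norm w) * \<bar>remainder (s *\<^sub>R (z + w))\<bar>"
  define m where "m j = (\<integral>w. (1 + norm w) ^ j \<partial>(gauss :: 'a measure))" for j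
  have mint: "integrable gauss (\<lambda>w::'a. (1 + norm w) ^ j)" for j
    by (rule integrable_poly_gauss)
  have m0: "0 \<le> m j" for j unfolding m_def by (intro integral_nonneg_AE AE_I2) auto
  \<comment> \<open>The quadratic term integrates to a multiple of \<open>m 3\<close>: two powers
    come from \<open>norm h\<close> and one from the weight \<open>1 + norm w\<close>. Adding
    \<open>1\<close> keeps the denominator positive when only \<open>0 \<le> m 3\<close> is
    known.\<close>
  define \<eta>' where "\<eta>' = \<eta> / (m 3 + 1)"
  have \<eta>': "\<eta>' > 0" "\<eta>' * m 3 \<le> \<eta>"
    using assms m0[of 3] by (auto simp: \<eta>'_def field_simps add_nonneg_pos)
  obtain \<epsilon> C1 where \<epsilon>: "\<epsilon> > 0" and C1: "C1 \<ge> 0" and loc: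
    "\<And>h. \<bar>remainder h\<bar> \<le> \<eta>' * (norm h)\<^sup>2 + C1 * norm h ^ 3 + \<pi> (x + h) * indicator {h. \<epsilon> \<le> norm h} h"
    using remainder_local_bound[OF \<eta>'(1)] by blast
  obtain C2 where C2: "C2 \<ge> 0" "\<And>s z. 0 < s \<Longrightarrow> s \<le> 1 \<Longrightarrow>
      (\<integral>w. (1 + norm w) * (\<pi> (x + s *\<^sub>R (z + w)) * indicator {h. \<epsilon> \<le> norm h} (s *\<^sub>R (z + w))) \<partial>gauss)
        \<le> C2 * s ^ 3 * (1 + norm z) ^ deg"
    using gauss_rescaled_tail[where \<rho>="\<lambda>h. \<pi> (x + h)", OF _ _ shifted_prior_integrable \<epsilon>] prior_nonneg
    unfolding deg_def by auto
  show thesis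
  proof (rule that[of "C1 * m 4 + C2"])
    show "C1 * m 4 + C2 \<ge> 0" using C1 C2(1) m0 by simp
    fix s :: real and z :: 'a assume s: "0 < s" "s \<le> 1"
    let ?Z = "(1 + norm z) ^ deg"
    let ?T = "\<lambda>w. (1 + norm w) * (\<pi> (x + s *\<^sub>R (z + w)) * indicator {h. \<epsilon> \<le> norm h} (s *\<^sub>R (z + w)))"
    let ?U = "\<lambda>w. \<eta>' * s\<^sup>2 * ?Z * (1 + norm w) ^ 3 + C1 * s ^ 3 * ?Z * (1 + norm w) ^ 4 + ?T w"
    have le: "?R s z w \<le> ?U w" for w
    proof -
      let ?h = "s *\<^sub>R (z + w)"
      have "\<eta>' * (norm ?h)\<^sup>2 \<le> \<eta>' * (s\<^sup>2 * (?Z * (1 + norm w)\<^sup>2))"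
        using \<eta>'(1) s norm_scaled_power[of s 2] by (intro mult_left_mono) (auto simp: deg_def)
      moreover have "C1 * norm ?h ^ 3 \<le> C1 * (s ^ 3 * (?Z * (1 + norm w) ^ 3))"
        using C1 s norm_scaled_power[of s 3] by (intro mult_left_mono) (auto simp: deg_def)
      ultimately have "\<bar>remainder ?h\<bar> \<le> \<eta>' * (s\<^sup>2 * (?Z * (1 + norm w)\<^sup>2)) + C1 * (s ^ 3 * (?Z * (1 + norm w) ^ 3))
         + \<pi> (x + ?h) * indicator {h. \<epsilon> \<le> norm h} ?h"
        using loc[of ?h] by linarith
      from mult_left_mono[OF this, of "1 + norm w"] show ?thesis
        by (simp only: distrib_left[of "1 + norm w"] norm_ge_zero add_nonneg_nonneg zero_le_one simp_thms)
           (simp only: power2_eq_square power3_eq_cube power4_eq_xxxx mult_ac)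
    qed
    have intT: "integrable gauss ?T"
    proof (rule Bochner_Integration.integrable_bound[OF prior_gauss_integrable[OF s, of z]])
      show "AE w in gauss. norm (?T w) \<le> norm ((1 + norm w) * \<pi> (x + s *\<^sub>R (z + w)))"
        by (intro AE_I2) (auto simp: prior_nonneg abs_mult indicator_def)
    qed auto
    have intU: "integrable gauss ?U"
      using intT mint by auto
    show "integrable gauss (?R s z) \<and>
      (integral\<^sup>L gauss (?R s z)) \<le> (\<eta> * s\<^sup>2 + (C1 * m 4 + C2) * s ^ 3) * (1 + norm z) ^ deg"
    proof
      show intr: "integrable gauss (?R s z)"
        using le by (intro Bochner_Integration.integrable_bound[OF intU])
          (auto intro!: AE_I2 intro: order.trans[OF _ abs_ge_self])
      have "(integral\<^sup>L gauss (?R s z)) \<le> (\<integral>w. ?U w \<partial>gauss)"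
        using intr intU le by (intro integral_mono)
      also have "\<dots> = \<eta>' * s\<^sup>2 * ?Z * m 3 + C1 * s ^ 3 * ?Z * m 4 + (\<integral>w. ?T w \<partial>gauss)"
        using intT mint by (simp add: m_def)
      also have "\<dots> \<le> (\<eta>' * m 3) * (s\<^sup>2 * ?Z) + C1 * s ^ 3 * ?Z * m 4 + C2 * s ^ 3 * ?Z"
        using C2(2)[OF s, of z] by (simp add: mult_ac)
      also have "\<dots> \<le> \<eta> * (s\<^sup>2 * ?Z) + C1 * s ^ 3 * ?Z * m 4 + C2 * s ^ 3 * ?Z"
        using \<eta>'(2) s by (intro add_right_mono mult_right_mono) auto
      finally show "(integral\<^sup>L gauss (?R s z)) \<le> (\<eta> * s\<^sup>2 + (C1 * m 4 + C2) * s ^ 3) * (1 + norm z) ^ deg"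
        by (simp add: algebra_simps)
    qed
  qed
qed


section \<open>Normalising constant and centred first moment of the posterior\<close>

definition mass :: "real \<Rightarrow> 'a \<Rightarrow> real" where
  "mass s z = (\<integral>w. \<pi> (x + s *\<^sub>R (z + w)) \<partial>gauss)"

definition slope :: "'a \<Rightarrow> real" where
  "slope e = (v \<bullet> e) / \<pi> x"

text \<open>The unnormalised first moment of \<open>w \<bullet> e\<close> with its leading part
  \<open>s * slope e * mass s z\<close> already removed. What is left is of order
  \<open>s\<^sup>2\<close>, so that division by \<open>s\<^sup>2 * mass s z\<close> has a finite
  limit.\<close>

definition centred :: "real \<Rightarrow> 'a \<Rightarrow> 'a \<Rightarrow> real" where
  "centred s e z = (\<integral>w. (w \<bullet> e - s * slope e) * \<pi> (x + s *\<^sub>R (z + w)) \<partial>gauss)"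

lemma mass_measurable [measurable]: "mass s \<in> borel_measurable borel"
proof -
  interpret prob_space "gauss :: 'a measure" by (rule prob_space_gauss)
  show ?thesis unfolding mass_def[abs_def] by measurable
qed

lemma centred_measurable [measurable]: "centred s e \<in> borel_measurable borel"
proof -
  interpret prob_space "gauss :: 'a measure" by (rule prob_space_gauss)
  show ?thesis unfolding centred_def[abs_def] by measurable
qed

text \<open>Submultiplicativity of \<open>1 + norm\<close> separates \<open>x\<close>,
  \<open>z\<close> and \<open>w\<close> in the lower bound on the prior, and the remaining Gaussian
  integral over \<open>w\<close> is a positive constant. The bound covers every \<open>z\<close>, as
  dominated convergence will require.\<close>

lemma mass_lower:
  obtains C where "C > 0" "\<And>s z. 0 < s \<Longrightarrow> s \<le> 1 \<Longrightarrow> C / (1 + norm z) ^ k \<le> mass s z"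
proof -
  interpret prob_space "gauss :: 'a measure" by (rule prob_space_gauss)
  define I where "I = (\<integral>w. 1 / (1 + norm w) ^ k \<partial>(gauss :: 'a measure))"
  have le1: "1 / (1 + norm w) ^ k \<le> 1" for w :: 'a
    by (simp add: field_simps one_le_power add_pos_nonneg)
  have intI: "integrable gauss (\<lambda>w::'a. 1 / (1 + norm w) ^ k)"
    using le1 by (intro integrable_gauss_poly_bound[where C=1 and k=0]) auto
  have pos: "0 < 1 / (1 + norm w) ^ k" for w :: 'a
    by (simp add: add_pos_nonneg)
  have I: "I > 0"
  proof -
    have "(\<integral>w. 0 \<partial>(gauss :: 'a measure)) < I"
      unfolding I_def using pos intI emeasure_space_1 by (intro integral_less_AE_space) auto
    then show ?thesis by simp
  qed
  define C where "C = c\<^sub>0 / (1 + norm x) ^ k * I"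
  have "C > 0" using I prior_lower(1) by (simp add: C_def add_pos_nonneg)
  moreover have "C / (1 + norm z) ^ k \<le> mass s z" if s: "0 < s" "s \<le> 1" for s z
  proof -
    have "AE w in lborel. c\<^sub>0 / (1 + norm (x + s *\<^sub>R (z + w))) ^ k \<le> \<pi> (x + s *\<^sub>R (z + w))"
      using AE_lborel_affine[OF _ s(1) prior_lower(2), of "x + s *\<^sub>R z"]
      by (simp add: scaleR_add_right add.assoc)
    then have AE: "AE w in gauss. c\<^sub>0 / (1 + norm (x + s *\<^sub>R (z + w))) ^ k \<le> \<pi> (x + s *\<^sub>R (z + w))"
      unfolding gauss_def by (subst AE_density) auto
    have ptw: "C / I / (1 + norm z) ^ k * (1 / (1 + norm w) ^ k) \<le> c\<^sub>0 / (1 + norm (x + s *\<^sub>R (z + w))) ^ k" for w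
    proof -
      have "norm (s *\<^sub>R (z + w)) \<le> norm (z + w)"
        using s by (simp add: mult_left_le_one_le)
      then have "1 + norm (x + s *\<^sub>R (z + w)) \<le> (1 + norm x) * (1 + norm (z + w))"
        by (intro order.trans[OF one_plus_norm_add] mult_left_mono) auto
      also have "\<dots> \<le> (1 + norm x) * ((1 + norm z) * (1 + norm w))"
        by (intro mult_left_mono one_plus_norm_add) auto
      finally have "(1 + norm (x + s *\<^sub>R (z + w))) ^ k \<le> (1 + norm x) ^ k * ((1 + norm z) ^ k * (1 + norm w) ^ k)"
        unfolding power_mult_distrib[symmetric] by (intro power_mono) auto
      then have "c\<^sub>0 / ((1 + norm x) ^ k * ((1 + norm z) ^ k * (1 + norm w) ^ k))
          \<le> c\<^sub>0 / (1 + norm (x + s *\<^sub>R (z + w))) ^ k"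
        using prior_lower(1) by (intro divide_left_mono) (auto intro!: mult_pos_pos zero_less_power add_pos_nonneg)
      then show ?thesis using I by (simp add: C_def mult_ac)
    qed
    have "C / (1 + norm z) ^ k = (\<integral>w. C / I / (1 + norm z) ^ k * (1 / (1 + norm w) ^ k) \<partial>(gauss::'a measure))"
      using I unfolding integral_mult_right_zero by (simp add: I_def)
    also have "\<dots> \<le> mass s z"
      unfolding mass_def
    proof (rule integral_mono_AE)
      show "integrable gauss (\<lambda>w. \<pi> (x + s *\<^sub>R (z + w)))"
        using prior_gauss_integrable_weighted[OF s, of "\<lambda>_. 1" 1] by simp
      show "AE w in gauss. C / I / (1 + norm z) ^ k * (1 / (1 + norm w) ^ k) \<le> \<pi> (x + s *\<^sub>R (z + w))"
        using AE by eventually_elim (rule order.trans[OF ptw])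
    qed (intro integrable_mult_right intI)
    finally show ?thesis .
  qed
  ultimately show thesis by (rule that)
qed

lemma remainder_gauss_integrable:
  assumes "0 < s" "s \<le> 1"
  shows "integrable gauss (\<lambda>w. (1 + norm w) * \<bar>remainder (s *\<^sub>R (z + w))\<bar>)"
  by (rule remainder_gauss_bound[OF zero_less_one]) (use assms in blast)

lemma remainder_gauss_le:
  assumes "\<eta> > 0"
  shows "\<exists>C\<ge>0. \<forall>s z. 0 < s \<longrightarrow> s \<le> 1 \<longrightarrow>
    (\<integral>w. (1 + norm w) * \<bar>remainder (s *\<^sub>R (z + w))\<bar> \<partial>gauss) \<le> (\<eta> * s\<^sup>2 + C * s ^ 3) * (1 + norm z) ^ deg"
  by (rule remainder_gauss_bound[OF assms]) blast

lemma integrable_remainder_weighted: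
  assumes s: "0 < s" "s \<le> 1" and [measurable]: "f \<in> borel_measurable borel"
    and f: "\<And>w. \<bar>f w\<bar> \<le> C * (1 + norm w)"
  shows "integrable gauss (\<lambda>w. f w * remainder (s *\<^sub>R (z + w)))"
    and "\<bar>\<integral>w. f w * remainder (s *\<^sub>R (z + w)) \<partial>gauss\<bar>
          \<le> C * (\<integral>w. (1 + norm w) * \<bar>remainder (s *\<^sub>R (z + w))\<bar> \<partial>gauss)"
proof -
  let ?R = "\<lambda>w. (1 + norm w) * \<bar>remainder (s *\<^sub>R (z + w))\<bar>"
  from remainder_gauss_integrable[OF s] have int: "integrable gauss (\<lambda>w. C * ?R w)"
    by (rule integrable_mult_right)
  have le: "\<bar>f w * remainder (s *\<^sub>R (z + w))\<bar> \<le> C * ?R w" for w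
    using mult_right_mono[OF f[of w] abs_ge_zero[of "remainder (s *\<^sub>R (z + w))"]]
    by (simp add: abs_mult mult_ac)
  show i: "integrable gauss (\<lambda>w. f w * remainder (s *\<^sub>R (z + w)))"
    using le by (intro Bochner_Integration.integrable_bound[OF int])
      (auto intro!: AE_I2 intro: order.trans[OF _ abs_ge_self])
  have "\<bar>\<integral>w. f w * remainder (s *\<^sub>R (z + w)) \<partial>gauss\<bar> \<le> (\<integral>w. \<bar>f w * remainder (s *\<^sub>R (z + w))\<bar> \<partial>gauss)"
    using integral_norm_bound[of gauss "\<lambda>w. f w * remainder (s *\<^sub>R (z + w))"] by simp
  also have "\<dots> \<le> (\<integral>w. C * ?R w \<partial>gauss)"
    using i int le by (intro integral_mono) auto
  finally show "\<bar>\<integral>w. f w * remainder (s *\<^sub>R (z + w)) \<partial>gauss\<bar> \<le> C * (\<integral>w. ?R w \<partial>gauss)"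
    by simp
qed

lemma B_expand: "B (s *\<^sub>R (z + w)) (s *\<^sub>R (z + w)) = s\<^sup>2 * (B z z + 2 * B z w + B w w)"
  using B_bilinear B_sym[of w z]
  by (simp add: bilinear_lmul bilinear_rmul bilinear_ladd bilinear_radd power2_eq_square algebra_simps)

lemma B_trace: "(\<integral>w. B w w \<partial>gauss) = (\<Sum>b\<in>Basis. B b b)"
  by (rule gauss_bilinear_diag[OF B_bilinear])

lemma prior_decomp:
  "\<pi> (x + s *\<^sub>R (z + w)) = (\<pi> x + s * (v \<bullet> z) + s\<^sup>2 / 2 * B z z) + (s * (v \<bullet> w) + s\<^sup>2 * B z w)
     + s\<^sup>2 / 2 * B w w + remainder (s *\<^sub>R (z + w))"
  unfolding remainder_def B_expand by (simp add: inner_add_right algebra_simps)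

lemma linear_inner: "linear (\<lambda>w. w \<bullet> (e::'a))" "linear (\<lambda>w. (e::'a) \<bullet> w)"
  by (auto intro: bounded_linear.linear bounded_linear_inner_left bounded_linear_inner_right)

lemma linear_lin_part: "linear (\<lambda>w. s * (v \<bullet> w) + t * B z w)"
  using B_linear[of z] by (auto simp: linear_iff inner_add_right algebra_simps)

lemma centred_eq:
  assumes s: "0 < s" "s \<le> 1" and e: "e \<in> Basis"
  shows "centred s e z = s\<^sup>2 * (B z e - slope e * (v \<bullet> z)) - s ^ 3 * (slope e / 2) * (B z z + (\<Sum>b\<in>Basis. B b b))
    + (\<integral>w. (w \<bullet> e - s * slope e) * remainder (s *\<^sub>R (z + w)) \<partial>gauss)"
proof -
  interpret prob_space "gauss :: 'a measure" by (rule prob_space_gauss)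
  have prob1: "prob UNIV = 1" using prob_space by simp
  let ?a = "\<pi> x + s * (v \<bullet> z) + s\<^sup>2 / 2 * B z z" and ?c = "s * slope e"
  let ?l = "\<lambda>w. s * (v \<bullet> w) + s\<^sup>2 * B z w"
  \<comment> \<open>Without the remainder the integrand is a polynomial in \<open>w\<close>, split
    here by parity: \<open>?O\<close> is odd and integrates to zero.\<close>
  let ?E = "\<lambda>w. (w \<bullet> e) * ?l w - ?c * ?a - ?c * (s\<^sup>2 / 2) * B w w"
  let ?O = "\<lambda>w. (w \<bullet> e) * (?a + s\<^sup>2 / 2 * B w w) - ?c * ?l w"
  let ?R = "\<lambda>w. (w \<bullet> e - ?c) * remainder (s *\<^sub>R (z + w))"
  have pB: "poly_bounded (\<lambda>w. B w w)"
    by (rule poly_bounded_bilinear_diag[OF B_bilinear])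
  have pE1: "poly_bounded (\<lambda>w. (w \<bullet> e) * ?l w)"
    by (intro poly_bounded_intros linear_inner linear_lin_part)
  have pO: "poly_bounded ?O"
    by (intro poly_bounded_mult poly_bounded_diff poly_bounded_add poly_bounded_const pB
        poly_bounded_linear[OF linear_inner(1)] poly_bounded_linear[OF linear_lin_part])
  have iE1: "integrable gauss (\<lambda>w. (w \<bullet> e) * ?l w)" and iB: "integrable gauss (\<lambda>w. B w w)"
    and iO: "integrable gauss ?O"
    using poly_bounded_integrable[OF pE1] poly_bounded_integrable[OF pB] poly_bounded_integrable[OF pO] by auto
  have iE: "integrable gauss ?E"
    using iE1 iB by simp
  have le: "\<bar>w \<bullet> e - ?c\<bar> \<le> (1 + \<bar>?c\<bar>) * (1 + norm w)" for w
  proof -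
    have "\<bar>w \<bullet> e - ?c\<bar> \<le> norm w + \<bar>?c\<bar>" using Basis_le_norm[OF e, of w] by linarith
    also have "\<dots> \<le> (1 + \<bar>?c\<bar>) * (1 + norm w)"
      by (simp add: algebra_simps)
    finally show ?thesis .
  qed
  have iR: "integrable gauss ?R"
    using le by (intro integrable_remainder_weighted[OF s]) auto
  have "centred s e z = (\<integral>w. ?E w + ?O w + ?R w \<partial>gauss)"
    unfolding centred_def
    by (intro Bochner_Integration.integral_cong refl, subst prior_decomp) (simp add: field_simps)
  also have "\<dots> = (\<integral>w. ?E w \<partial>gauss) + (\<integral>w. ?O w \<partial>gauss) + (\<integral>w. ?R w \<partial>gauss)"
    using iE iO iR by simp
  also have "(\<integral>w. ?O w \<partial>gauss) = 0"
    using pO B_bilinear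
    by (intro integral_gauss_odd) (auto simp: poly_bounded_def bilinear_lneg bilinear_rneg algebra_simps)
  also have "(\<integral>w. ?E w \<partial>gauss) = (\<integral>w. (w \<bullet> e) * ?l w \<partial>gauss) - ?c * ?a - ?c * (s\<^sup>2 / 2) * (\<integral>w. B w w \<partial>gauss)"
    using iE1 iB by (simp add: prob1)
  also have "(\<integral>w. (w \<bullet> e) * ?l w \<partial>gauss) = ?l e"
    using e by (subst gauss_second_moment_bilinear[OF linear_inner(1) linear_lin_part])
      (simp add: inner_Basis if_distrib[of "\<lambda>t. t * _"] cong: if_cong sum.cong)
  \<comment> \<open>The part \<open>s * slope e * \<pi> x\<close> of order \<open>s\<close> cancels
    against the constant part of \<open>?c * ?a\<close>; this is the purpose of the
    centring.\<close>
  also have "?l e = s * slope e * \<pi> x + s\<^sup>2 * B z e"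
    using prior_pos by (simp add: slope_def)
  finally show ?thesis
    by (simp add: B_trace field_simps power2_eq_square power3_eq_cube)
qed

lemma centred_expansion:
  assumes e: "e \<in> Basis" and \<eta>: "\<eta> > 0"
  obtains C where "C \<ge> 0" "\<And>s z. 0 < s \<Longrightarrow> s \<le> 1 \<Longrightarrow>
    \<bar>centred s e z / s\<^sup>2 - (B z e - slope e * (v \<bullet> z))\<bar> \<le> (\<eta> + C * s) * (1 + norm z) ^ deg"
proof -
  \<comment> \<open>\<open>A\<close> bounds the weight: \<open>\<bar>w \<bullet> e - s * slope
    e\<bar> \<le> A * (1 + norm w)\<close> for \<open>s \<le> 1\<close>. The remainder estimate is
    therefore invoked with \<open>\<eta> / A\<close>.\<close>
  define A where "A = 1 + \<bar>slope e\<bar>"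
  have A: "A > 0" by (simp add: A_def)
  obtain C where C: "C \<ge> 0" "\<And>s z. 0 < s \<Longrightarrow> s \<le> 1 \<Longrightarrow>
    (\<integral>w. (1 + norm w) * \<bar>remainder (s *\<^sub>R (z + w))\<bar> \<partial>gauss) \<le> (\<eta> / A * s\<^sup>2 + C * s ^ 3) * (1 + norm z) ^ deg"
    using remainder_gauss_le[OF divide_pos_pos[OF \<eta> A]] by blast
  obtain K where K: "K > 0" "\<And>h h'. \<bar>B h h'\<bar> \<le> K * norm h * norm h'"
    using bilinear_bounded_pos[OF B_bilinear] by auto
  define D where "D = \<bar>slope e\<bar> / 2 * (K + \<bar>\<Sum>b\<in>Basis. B b b\<bar>)"
  have D: "D \<ge> 0" using K(1) by (simp add: D_def)
  have "\<bar>centred s e z / s\<^sup>2 - (B z e - slope e * (v \<bullet> z))\<bar> \<le> (\<eta> + (A * C + D) * s) * (1 + norm z) ^ deg"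
    if s: "0 < s" "s \<le> 1" for s z
  proof -
    let ?Z = "(1 + norm z) ^ deg"
    let ?R = "\<integral>w. (w \<bullet> e - s * slope e) * remainder (s *\<^sub>R (z + w)) \<partial>gauss"
    let ?T = "(slope e / 2) * (B z z + (\<Sum>b\<in>Basis. B b b))"
    have le: "\<bar>w \<bullet> e - s * slope e\<bar> \<le> A * (1 + norm w)" for w
    proof -
      have "\<bar>s * slope e\<bar> \<le> \<bar>slope e\<bar>"
        using s by (simp add: abs_mult mult_left_le_one_le)
      then have "\<bar>w \<bullet> e - s * slope e\<bar> \<le> norm w + \<bar>slope e\<bar>" using Basis_le_norm[OF e, of w] by linarith
      also have "\<dots> \<le> A * (1 + norm w)"
        by (simp add: A_def algebra_simps)
      finally show ?thesis .
    qed
    have "\<bar>?R\<bar> \<le> A * (\<integral>w. (1 + norm w) * \<bar>remainder (s *\<^sub>R (z + w))\<bar> \<partial>gauss)"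
      using le by (intro integrable_remainder_weighted(2)[OF s]) auto
    also have "\<dots> \<le> A * ((\<eta> / A * s\<^sup>2 + C * s ^ 3) * ?Z)"
      using A by (intro mult_left_mono C(2)[OF s]) auto
    also have "\<dots> = s\<^sup>2 * ((\<eta> + A * C * s) * ?Z)"
      using A by (simp add: field_simps power2_eq_square power3_eq_cube)
    finally have R: "\<bar>?R / s\<^sup>2\<bar> \<le> (\<eta> + A * C * s) * ?Z"
      using s by (simp add: field_simps)
    have sq: "(norm z)\<^sup>2 \<le> ?Z"
      by (intro order.trans[OF power_mono power_increasing]) (auto simp: deg_def)
    have Z1: "1 \<le> ?Z" by (intro one_le_power) auto
    have "\<bar>B z z + (\<Sum>b\<in>Basis. B b b)\<bar> \<le> K * (norm z)\<^sup>2 + \<bar>\<Sum>b\<in>Basis. B b b\<bar> * 1"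
      using K(2)[of z z] by (simp add: power2_eq_square mult.assoc)
    also have "\<dots> \<le> K * ?Z + \<bar>\<Sum>b\<in>Basis. B b b\<bar> * ?Z"
      using sq Z1 K(1) by (intro add_mono mult_left_mono) auto
    finally have "\<bar>B z z + (\<Sum>b\<in>Basis. B b b)\<bar> \<le> K * ?Z + \<bar>\<Sum>b\<in>Basis. B b b\<bar> * ?Z" .
    then have "\<bar>slope e\<bar> / 2 * \<bar>B z z + (\<Sum>b\<in>Basis. B b b)\<bar> \<le> \<bar>slope e\<bar> / 2 * (K * ?Z + \<bar>\<Sum>b\<in>Basis. B b b\<bar> * ?Z)"
      by (intro mult_left_mono) auto
    also have "\<dots> = D * ?Z"
      by (simp add: D_def algebra_simps)
    finally have "\<bar>?T\<bar> \<le> D * ?Z"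
      by (simp add: abs_mult)
    then have T: "\<bar>s * ?T\<bar> \<le> D * s * ?Z"
      using s mult_left_mono[of "\<bar>?T\<bar>" "D * ?Z" s] by (simp add: abs_mult mult_ac)
    have "centred s e z / s\<^sup>2 - (B z e - slope e * (v \<bullet> z)) = ?R / s\<^sup>2 - s * ?T"
      using s by (simp add: centred_eq[OF s e] add_divide_distrib diff_divide_distrib power2_eq_square power3_eq_cube)
    with R T have "\<bar>centred s e z / s\<^sup>2 - (B z e - slope e * (v \<bullet> z))\<bar> \<le> (\<eta> + A * C * s) * ?Z + D * s * ?Z"
      by linarith
    then show ?thesis by (simp add: algebra_simps)
  qed
  with A C(1) D show thesis by (intro that[of "A * C + D"]) auto
qed

text \<open>Pointwise convergence in \<open>z\<close> is enough for the denominator, since uniform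
  control of the quotient comes from \<open>mass_lower\<close>.\<close>

lemma mass_tendsto: "((\<lambda>s. mass s z) \<longlongrightarrow> \<pi> x) (at_right 0)"
proof -
  interpret prob_space "gauss :: 'a measure" by (rule prob_space_gauss)
  obtain C where C: "C \<ge> 0" "\<And>s z. 0 < s \<Longrightarrow> s \<le> 1 \<Longrightarrow>
    (\<integral>w. (1 + norm w) * \<bar>remainder (s *\<^sub>R (z + w))\<bar> \<partial>gauss) \<le> (1 * s\<^sup>2 + C * s ^ 3) * (1 + norm z) ^ deg"
    using remainder_gauss_le[OF zero_less_one] by blast
  define p where "p s = s * (v \<bullet> z) + s\<^sup>2 / 2 * (B z z + (\<Sum>b\<in>Basis. B b b))" for s
  have bd: "\<bar>mass s z - \<pi> x - p s\<bar> \<le> (1 * s\<^sup>2 + C * s ^ 3) * (1 + norm z) ^ deg" if s: "0 < s" "s \<le> 1" for s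
  proof -
    let ?a = "\<pi> x + s * (v \<bullet> z) + s\<^sup>2 / 2 * B z z"
    define l where "l w = s * (v \<bullet> w) + s\<^sup>2 * B z w" for w
    let ?R = "\<lambda>w. remainder (s *\<^sub>R (z + w))"
    have R: "integrable gauss ?R" "\<bar>integral\<^sup>L gauss ?R\<bar> \<le> (\<integral>w. (1 + norm w) * \<bar>?R w\<bar> \<partial>gauss)"
      using integrable_remainder_weighted[OF s, of "\<lambda>_. 1" 1 z] by auto
    have lin: "linear l" unfolding l_def by (rule linear_lin_part)
    have l: "integrable gauss l" and B: "integrable gauss (\<lambda>w. B w w)"
      using poly_bounded_integrable[OF poly_bounded_linear[OF lin]]
        poly_bounded_integrable[OF poly_bounded_bilinear_diag[OF B_bilinear]] by auto
    have l0: "integral\<^sup>L gauss l = 0"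
      using poly_bounded_linear[OF lin] linear_neg[OF lin]
      by (intro integral_gauss_odd) (auto simp: poly_bounded_def)
    have "mass s z = (\<integral>w. ?a + l w + s\<^sup>2 / 2 * B w w + ?R w \<partial>gauss)"
      unfolding mass_def l_def prior_decomp ..
    also have "\<dots> = ?a + integral\<^sup>L gauss l + s\<^sup>2 / 2 * (\<Sum>b\<in>Basis. B b b) + integral\<^sup>L gauss ?R"
      unfolding B_trace[symmetric] using R(1) l B prob_space by simp
    finally have "mass s z - \<pi> x - p s = integral\<^sup>L gauss ?R"
      by (simp add: l0 p_def algebra_simps)
    with R(2) C(2)[OF s, of z] show ?thesis by linarith
  qed
  have "((\<lambda>s. (1 * s\<^sup>2 + C * s ^ 3) * (1 + norm z) ^ deg) \<longlongrightarrow> (1 * 0\<^sup>2 + C * 0 ^ 3) * (1 + norm z) ^ deg) (at_right 0)"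
    by (intro tendsto_intros)
  then have lim: "((\<lambda>s. (1 * s\<^sup>2 + C * s ^ 3) * (1 + norm z) ^ deg) \<longlongrightarrow> 0) (at_right 0)" by simp
  have ev: "\<forall>\<^sub>F s in at_right 0. 0 < s \<and> s \<le> (1::real)"
    by (auto simp: eventually_at_right_field intro!: exI[of _ 1])
  have "((\<lambda>s. mass s z - \<pi> x - p s) \<longlongrightarrow> 0) (at_right 0)"
    by (rule Lim_null_comparison[OF _ lim]) (use ev in eventually_elim, use bd in auto)
  moreover have "(p \<longlongrightarrow> 0 * (v \<bullet> z) + 0\<^sup>2 / 2 * (B z z + (\<Sum>b\<in>Basis. B b b))) (at_right 0)"
    unfolding p_def by (intro tendsto_intros) auto
  ultimately have "((\<lambda>s. (mass s z - \<pi> x - p s) + p s + \<pi> x) \<longlongrightarrow> 0 + 0 + \<pi> x) (at_right 0)"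
    by (intro tendsto_add tendsto_const) auto
  then show ?thesis by simp
qed


section \<open>Expansion of the error of the posterior mean in powers of \<open>s\<close>\<close>

definition deviation :: "real \<Rightarrow> 'a \<Rightarrow> 'a \<Rightarrow> real" where
  "deviation s e z = centred s e z / (s\<^sup>2 * mass s z)"

text \<open>The error of the posterior mean along \<open>e\<close> when the observation is
  \<open>x + s z\<close>; the identification with \<open>gen_bayes\<close> is made in
  \<open>gen_bayes_error\<close>.\<close>

definition scaled_error :: "real \<Rightarrow> 'a \<Rightarrow> 'a \<Rightarrow> real" where
  "scaled_error s e z = s * (z \<bullet> e) + s * ((\<integral>w. (w \<bullet> e) * \<pi> (x + s *\<^sub>R (z + w)) \<partial>gauss) / mass s z)"

lemma mass_pos:
  assumes "0 < s" "s \<le> 1"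
  shows "0 < mass s z"
proof (rule mass_lower)
  fix C assume "C > 0" and "\<And>s z. 0 < s \<Longrightarrow> s \<le> 1 \<Longrightarrow> C / (1 + norm z) ^ k \<le> mass s z"
  then have "C / (1 + norm z) ^ k \<le> mass s z" using assms by blast
  moreover have "0 < C / (1 + norm z) ^ k" using \<open>C > 0\<close> by (simp add: add_pos_nonneg)
  ultimately show ?thesis by linarith
qed

lemma deviation_measurable [measurable]: "deviation s e \<in> borel_measurable borel"
  unfolding deviation_def[abs_def] by measurable

lemma scaled_error_eq:
  assumes s: "0 < s" "s \<le> 1" and e: "e \<in> Basis"
  shows "scaled_error s e z = s * (z \<bullet> e) + s\<^sup>2 * slope e + s ^ 3 * deviation s e z"
proof -
  let ?p = "\<lambda>w. \<pi> (x + s *\<^sub>R (z + w))"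
  have i1: "integrable gauss (\<lambda>w. (w \<bullet> e) * ?p w)"
    by (rule prior_gauss_integrable_weighted[OF s _ abs_inner_le_one_plus[OF e]]) auto
  have i2: "integrable gauss ?p"
    using prior_gauss_integrable_weighted[OF s, of "\<lambda>_. 1" 1] by simp
  have "centred s e z = (\<integral>w. (w \<bullet> e) * ?p w - s * slope e * ?p w \<partial>gauss)"
    unfolding centred_def by (simp add: left_diff_distrib)
  also have "\<dots> = (\<integral>w. (w \<bullet> e) * ?p w \<partial>gauss) - s * slope e * mass s z"
    using i1 i2 by (simp add: mass_def)
  finally have "(\<integral>w. (w \<bullet> e) * ?p w \<partial>gauss) = centred s e z + s * slope e * mass s z"
    by simp
  then show ?thesis
    using mass_pos[OF s, of z] s
    by (simp add: scaled_error_def deviation_def field_simps power2_eq_square power3_eq_cube)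
qed

lemma centred_tendsto:
  assumes e: "e \<in> Basis"
  shows "((\<lambda>s. centred s e z / s\<^sup>2) \<longlongrightarrow> B z e - slope e * (v \<bullet> z)) (at_right 0)"
proof (rule tendstoI)
  fix \<epsilon> :: real assume \<epsilon>: "\<epsilon> > 0"
  let ?Z = "(1 + norm z) ^ deg"
  have Z: "?Z > 0" by (simp add: add_pos_nonneg)
  define \<eta> where "\<eta> = \<epsilon> / 2 / ?Z"
  have \<eta>: "\<eta> > 0" using \<epsilon> Z by (simp add: \<eta>_def)
  obtain C where C: "C \<ge> 0" "\<And>s z. 0 < s \<Longrightarrow> s \<le> 1 \<Longrightarrow>
    \<bar>centred s e z / s\<^sup>2 - (B z e - slope e * (v \<bullet> z))\<bar> \<le> (\<eta> + C * s) * (1 + norm z) ^ deg"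
    using centred_expansion[OF e \<eta>] by blast
  have "((\<lambda>s. (\<eta> + C * s) * ?Z) \<longlongrightarrow> (\<eta> + C * 0) * ?Z) (at_right 0)"
    by (intro tendsto_intros)
  moreover have "(\<eta> + C * 0) * ?Z < \<epsilon>"
    using \<epsilon> Z by (simp add: \<eta>_def)
  ultimately have "\<forall>\<^sub>F s in at_right 0. (\<eta> + C * s) * ?Z < \<epsilon>"
    by (rule order_tendstoD)
  moreover have "\<forall>\<^sub>F s in at_right 0. 0 < s \<and> s \<le> (1::real)"
    by (auto simp: eventually_at_right_field intro!: exI[of _ 1])
  ultimately show "\<forall>\<^sub>F s in at_right 0. dist (centred s e z / s\<^sup>2) (B z e - slope e * (v \<bullet> z)) < \<epsilon>"
  proof eventually_elim
    case (elim s)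
    then show ?case using C(2)[of s z] by (simp add: dist_real_def)
  qed
qed

lemma deviation_tendsto:
  assumes e: "e \<in> Basis"
  shows "((\<lambda>s. deviation s e z) \<longlongrightarrow> (B z e - slope e * (v \<bullet> z)) / \<pi> x) (at_right 0)"
  using tendsto_divide[OF centred_tendsto[OF e, of z] mass_tendsto[of z]] prior_pos
  by (simp add: deviation_def)

text \<open>This supplies the dominating function. The numerator grows like
  \<open>(1 + norm z) ^ deg\<close>, by \<open>centred_expansion\<close> at the fixed tolerance
  \<open>1\<close>, and division by \<open>mass\<close> adds the exponent \<open>k\<close> of its
  lower bound.\<close>

lemma deviation_bound:
  assumes e: "e \<in> Basis"
  obtains C m where "C \<ge> 0" "\<And>s z. 0 < s \<Longrightarrow> s \<le> 1 \<Longrightarrow> \<bar>deviation s e z\<bar> \<le> C * (1 + norm z) ^ m"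
proof -
  obtain C where C: "C \<ge> 0" "\<And>s z. 0 < s \<Longrightarrow> s \<le> 1 \<Longrightarrow>
    \<bar>centred s e z / s\<^sup>2 - (B z e - slope e * (v \<bullet> z))\<bar> \<le> (1 + C * s) * (1 + norm z) ^ deg"
    using centred_expansion[OF e zero_less_one] by blast
  have "linear (\<lambda>z. B z e - slope e * (v \<bullet> z))"
    using linear_bilinear(2)[OF B_bilinear, of e] by (auto simp: linear_iff inner_add_right algebra_simps)
  then obtain A where A: "A > 0" "\<And>z. norm (B z e - slope e * (v \<bullet> z)) \<le> A * norm z"
    using linear_bounded_pos by blast
  obtain D where D: "D > 0" "\<And>s z. 0 < s \<Longrightarrow> s \<le> 1 \<Longrightarrow> D / (1 + norm z) ^ k \<le> mass s z"
    using mass_lower by blast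
  have "\<bar>deviation s e z\<bar> \<le> (1 + C + A) / D * (1 + norm z) ^ (deg + k)" if s: "0 < s" "s \<le> 1" for s z
  proof -
    let ?Z = "(1 + norm z) ^ deg"
    have "norm z \<le> ?Z"
      using self_le_power[of "1 + norm z" deg] by (simp add: deg_def)
    then have "A * norm z \<le> A * ?Z" using A by simp
    moreover have "(1 + C * s) * ?Z \<le> (1 + C) * ?Z"
      using C(1) s by (intro mult_right_mono) (auto simp: mult_left_le)
    ultimately have "\<bar>centred s e z / s\<^sup>2\<bar> \<le> (1 + C) * ?Z + A * ?Z"
      using C(2)[OF s, of z] A(2)[of z] unfolding real_norm_def by linarith
    then have "\<bar>centred s e z / s\<^sup>2\<bar> \<le> (1 + C + A) * ?Z"
      by (simp add: algebra_simps)
    moreover have "1 / mass s z \<le> (1 + norm z) ^ k / D"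
      using D(1) D(2)[OF s, of z] mass_pos[OF s, of z] by (simp add: field_simps add_pos_nonneg)
    ultimately have "\<bar>centred s e z / s\<^sup>2\<bar> * (1 / mass s z) \<le> ((1 + C + A) * ?Z) * ((1 + norm z) ^ k / D)"
      using mass_pos[OF s, of z] C(1) A(1) by (intro mult_mono) auto
    then show ?thesis
      using mass_pos[OF s, of z] by (simp add: deviation_def abs_mult power_add mult_ac)
  qed
  with C(1) A(1) D(1) show thesis by (intro that[of "(1 + C + A) / D"]) auto
qed

lemma poly_bounded_deviation:
  assumes "0 < s" "s \<le> 1" "e \<in> Basis"
  shows "poly_bounded (deviation s e)"
proof (rule deviation_bound[OF assms(3)])
  fix C m assume "\<And>s z. 0 < s \<Longrightarrow> s \<le> 1 \<Longrightarrow> \<bar>deviation s e z\<bar> \<le> C * (1 + norm z) ^ m"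
  with assms show ?thesis by (intro poly_boundedI[of _ C m]) auto
qed

lemma integrable_scaled_error_mult:
  assumes "0 < s" "s \<le> 1" "e \<in> Basis" "f \<in> Basis"
  shows "integrable gauss (\<lambda>z. scaled_error s e z * scaled_error s f z)"
  unfolding scaled_error_eq[OF assms(1,2,3)] scaled_error_eq[OF assms(1,2,4)]
  using assms
  by (intro poly_bounded_integrable poly_bounded_mult poly_bounded_add poly_bounded_const
      poly_bounded_linear[OF linear_inner(1)] poly_bounded_deviation)

theorem scaled_error_second_moment_expansion:
  assumes e: "e \<in> Basis" and f: "f \<in> Basis"
  shows "((\<lambda>N. N\<^sup>2 * (\<integral>z. scaled_error (1 / sqrt N) e z * scaled_error (1 / sqrt N) f z \<partial>gauss) - N * (e \<bullet> f))
           \<longlongrightarrow> 2 * B e f / \<pi> x - slope e * slope f) at_top"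
proof -
  interpret prob_space "gauss :: 'a measure" by (rule prob_space_gauss)
  \<comment> \<open>\<open>H\<close> collects everything of order \<open>s ^ 4\<close> and higher in
    the product of two errors, divided by \<open>s ^ 4 = 1 / N\<^sup>2\<close>. The
    \<open>s\<^sup>2\<close> term accounts for the subtracted \<open>N * (e \<bullet> f)\<close>,
    and the \<open>s ^ 3\<close> term is odd in \<open>z\<close>.\<close>
  define H where "H s z = (z \<bullet> e) * deviation s f z + deviation s e z * (z \<bullet> f)
      + (slope e + s * deviation s e z) * (slope f + s * deviation s f z)" for s z
  define D where "D e z = (B z e - slope e * (v \<bullet> z)) / \<pi> x" for e z
  define H0 where "H0 z = (z \<bullet> e) * D f z + D e z * (z \<bullet> f) + slope e * slope f" for z
  have linD: "linear (D e)" for e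
    using linear_bilinear(2)[OF B_bilinear, of e]
    by (auto simp: D_def linear_iff inner_add_right algebra_simps add_divide_distrib diff_divide_distrib)
  have H_eq: "N\<^sup>2 * (\<integral>z. scaled_error (1 / sqrt N) e z * scaled_error (1 / sqrt N) f z \<partial>gauss) - N * (e \<bullet> f)
      = (\<integral>z. H (1 / sqrt N) z \<partial>gauss)" if N: "N \<ge> 1" for N
  proof -
    define s where "s = 1 / sqrt N"
    have s: "0 < s" "s \<le> 1" and Ns: "N * s\<^sup>2 = 1"
      using N by (auto simp: s_def power_divide)
    have pH: "poly_bounded (H s)"
      unfolding H_def using s e f
      by (intro poly_bounded_mult poly_bounded_add poly_bounded_const
        poly_bounded_linear[OF linear_inner(1)] poly_bounded_deviation)
    have pl: "poly_bounded (\<lambda>z. (z \<bullet> e) * slope f + slope e * (z \<bullet> f))"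
      by (intro poly_bounded_mult poly_bounded_add poly_bounded_const poly_bounded_linear[OF linear_inner(1)])
    have pq: "poly_bounded (\<lambda>z. (z \<bullet> e) * (z \<bullet> f))"
      by (intro poly_bounded_mult poly_bounded_linear[OF linear_inner(1)])
    have "scaled_error s e z * scaled_error s f z
        = s\<^sup>2 * ((z \<bullet> e) * (z \<bullet> f)) + s ^ 3 * ((z \<bullet> e) * slope f + slope e * (z \<bullet> f)) + s ^ 4 * H s z" for z
      unfolding scaled_error_eq[OF s e] scaled_error_eq[OF s f] H_def
      by (simp add: algebra_simps power2_eq_square power3_eq_cube power4_eq_xxxx)
    then have "(\<integral>z. scaled_error s e z * scaled_error s f z \<partial>gauss)
        = s\<^sup>2 * (\<integral>z. (z \<bullet> e) * (z \<bullet> f) \<partial>gauss) + s ^ 3 * (\<integral>z. (z \<bullet> e) * slope f + slope e * (z \<bullet> f) \<partial>gauss)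
          + s ^ 4 * (\<integral>z. H s z \<partial>gauss)"
      using poly_bounded_integrable[OF pH] poly_bounded_integrable[OF pl] poly_bounded_integrable[OF pq]
      by (simp only: Bochner_Integration.integral_add integrable_mult_right Bochner_Integration.integrable_add
          integral_mult_right_zero)
    also have "(\<integral>z. (z \<bullet> e) * slope f + slope e * (z \<bullet> f) \<partial>gauss) = 0"
      using pl by (intro integral_gauss_odd) (auto simp: poly_bounded_def)
    also have "(\<integral>z. (z \<bullet> e) * (z \<bullet> f) \<partial>gauss) = e \<bullet> f"
      using gauss_second_moment_Basis[OF e f] .
    finally have "N\<^sup>2 * (\<integral>z. scaled_error s e z * scaled_error s f z \<partial>gauss)
        = N * (N * s\<^sup>2) * (e \<bullet> f) + (N * s\<^sup>2)\<^sup>2 * (\<integral>z. H s z \<partial>gauss)"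
      by (simp add: algebra_simps power2_eq_square power4_eq_xxxx)
    then show ?thesis
      unfolding Ns by (simp add: s_def)
  qed
  obtain C m where C: "C \<ge> 0" "\<And>s z. 0 < s \<Longrightarrow> s \<le> 1 \<Longrightarrow> \<bar>deviation s e z\<bar> \<le> C * (1 + norm z) ^ m"
    using deviation_bound[OF e] by blast
  obtain C' m' where C': "C' \<ge> 0" "\<And>s z. 0 < s \<Longrightarrow> s \<le> 1 \<Longrightarrow> \<bar>deviation s f z\<bar> \<le> C' * (1 + norm z) ^ m'"
    using deviation_bound[OF f] by blast
  define W where "W z = (1 + norm z) * (C' * (1 + norm z) ^ m') + (C * (1 + norm z) ^ m) * (1 + norm z)
      + (\<bar>slope e\<bar> + C * (1 + norm z) ^ m) * (\<bar>slope f\<bar> + C' * (1 + norm z) ^ m')" for z :: 'a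
  have p1: "poly_bounded (\<lambda>z::'a. (1 + norm z) ^ j)" for j
    by (rule poly_boundedI[of _ 1 j]) auto
  have pn: "poly_bounded (norm :: 'a \<Rightarrow> real)"
    by (rule poly_boundedI[of _ 1 1]) auto
  have pW: "poly_bounded W"
    unfolding W_def
    by (intro poly_bounded_add poly_bounded_mult poly_bounded_const p1 pn)
  have H_le: "\<bar>H s z\<bar> \<le> W z" if s: "0 < s" "s \<le> 1" for s z
  proof -
    have e1: "\<bar>z \<bullet> e\<bar> \<le> 1 + norm z" and f1: "\<bar>z \<bullet> f\<bar> \<le> 1 + norm z"
      using abs_inner_le_one_plus[OF e, of z] abs_inner_le_one_plus[OF f, of z] by auto
    have "\<bar>s * deviation s e z\<bar> \<le> \<bar>deviation s e z\<bar>" "\<bar>s * deviation s f z\<bar> \<le> \<bar>deviation s f z\<bar>"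
      using s by (auto simp: abs_mult mult_left_le_one_le)
    then have e2: "\<bar>slope e + s * deviation s e z\<bar> \<le> \<bar>slope e\<bar> + C * (1 + norm z) ^ m"
      and f2: "\<bar>slope f + s * deviation s f z\<bar> \<le> \<bar>slope f\<bar> + C' * (1 + norm z) ^ m'"
      using C(2)[OF s, of z] C'(2)[OF s, of z] by linarith+
    have "\<bar>H s z\<bar> \<le> \<bar>z \<bullet> e\<bar> * \<bar>deviation s f z\<bar> + \<bar>deviation s e z\<bar> * \<bar>z \<bullet> f\<bar>
        + \<bar>slope e + s * deviation s e z\<bar> * \<bar>slope f + s * deviation s f z\<bar>"
      unfolding H_def abs_mult[symmetric] by linarith
    also have "\<dots> \<le> W z"
      unfolding W_def using e1 e2 f1 f2 C(2)[OF s, of z] C'(2)[OF s, of z]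
      by (intro add_mono mult_mono) auto
    finally show ?thesis .
  qed
  have lim_s: "filterlim (\<lambda>N. 1 / sqrt N) (at_right 0) at_top"
    unfolding filterlim_at
    by (auto intro!: tendsto_divide_0[OF tendsto_const] filterlim_at_top_imp_at_infinity sqrt_at_top
      eventually_mono[OF eventually_gt_at_top[of 0]])
  have H_lim: "((\<lambda>N. H (1 / sqrt N) z) \<longlongrightarrow> H0 z) at_top" for z
  proof -
    have "((\<lambda>s. H s z) \<longlongrightarrow> (z \<bullet> e) * D f z + D e z * (z \<bullet> f) + (slope e + 0 * D e z) * (slope f + 0 * D f z)) (at_right 0)"
      unfolding H_def D_def
      by (intro tendsto_intros deviation_tendsto e f)
    then have "((\<lambda>s. H s z) \<longlongrightarrow> H0 z) (at_right 0)"
      by (simp add: H0_def)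
    from filterlim_compose[OF this lim_s] show ?thesis .
  qed
  have pD: "poly_bounded (\<lambda>z. (z \<bullet> a) * D b z)" for a b
    by (intro poly_bounded_mult poly_bounded_linear linear_inner linD)
  have "poly_bounded H0"
    unfolding H0_def
    by (intro poly_bounded_mult poly_bounded_add poly_bounded_const
        poly_bounded_linear[OF linear_inner(1)] poly_bounded_linear[OF linD])
  moreover have [measurable]: "H s \<in> borel_measurable borel" for s
    unfolding H_def by measurable
  ultimately have "((\<lambda>N. \<integral>z. H (1 / sqrt N) z \<partial>gauss) \<longlongrightarrow> (\<integral>z. H0 z \<partial>gauss)) at_top"
    using H_lim
    by (intro integral_dominated_convergence_at_top[where w=W] poly_bounded_integrable[OF pW])
       (auto simp: poly_bounded_def intro!: eventually_mono[OF eventually_ge_at_top[of 1]] H_le)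
  moreover have "(\<integral>z. H0 z \<partial>gauss) = 2 * B e f / \<pi> x - slope e * slope f"
  proof -
    have mom: "(\<integral>z. (z \<bullet> a) * D b z \<partial>gauss) = D b a" if "a \<in> Basis" for a b
      using that by (subst gauss_second_moment_bilinear[OF linear_inner(1) linD])
        (simp add: inner_Basis if_distrib[of "\<lambda>t. t * _"] cong: if_cong sum.cong)
    have "(\<integral>z. H0 z \<partial>gauss) = (\<integral>z. (z \<bullet> e) * D f z + (z \<bullet> f) * D e z + slope e * slope f \<partial>gauss)"
      by (simp add: H0_def mult.commute)
    also have "\<dots> = D f e + D e f + slope e * slope f"
      using poly_bounded_integrable[OF pD] prob_space by (simp add: mom e f)
    \<comment> \<open>\<open>D f e + D e f\<close> carries \<open>- 2 * slope e * slope f\<close>,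
      of which the last summand restores one.\<close>
    also have "\<dots> = 2 * B e f / \<pi> x - slope e * slope f"
      using prior_pos B_sym[of e f] by (simp add: D_def slope_def field_simps)
    finally show ?thesis .
  qed
  ultimately have "((\<lambda>N. \<integral>z. H (1 / sqrt N) z \<partial>gauss) \<longlongrightarrow> 2 * B e f / \<pi> x - slope e * slope f) at_top"
    by simp
  then show ?thesis
    by (rule Lim_transform_eventually)
       (use H_eq in \<open>auto intro!: eventually_mono[OF eventually_ge_at_top[of 1]]\<close>)
qed

end

section \<open>Integrability of negative powers of Gram determinants\<close>

lemma nn_integral_lborel_translate:
  fixes g :: "'a::euclidean_space \<Rightarrow> ennreal"
  assumes [measurable]: "g \<in> borel_measurable borel"
  shows "(\<integral>\<^sup>+x. g (c + x) \<partial>lborel) = (\<integral>\<^sup>+x. g x \<partial>lborel)"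
proof -
  have "(\<integral>\<^sup>+x. g x \<partial>(distr lborel borel ((+) c))) = (\<integral>\<^sup>+x. g (c + x) \<partial>lborel)"
    by (rule nn_integral_distr) auto
  then show ?thesis by (simp add: lborel_distr_plus)
qed

lemma nn_integral_lborel_reflect:
  fixes g :: "'a::euclidean_space \<Rightarrow> ennreal"
  assumes [measurable]: "g \<in> borel_measurable borel"
  shows "(\<integral>\<^sup>+x. g (c - x) \<partial>lborel) = (\<integral>\<^sup>+x. g x \<partial>lborel)"
proof -
  have eq: "lborel = distr lborel borel (\<lambda>x::'a. c - x)"
    using lborel_affine[of "-1" c] by (simp add: density_1)
  have "(\<integral>\<^sup>+x. g x \<partial>lborel) = (\<integral>\<^sup>+x. g x \<partial>(distr lborel borel (\<lambda>x::'a. c - x)))"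
    unfolding eq[symmetric] ..
  also have "\<dots> = (\<integral>\<^sup>+x. g (c - x) \<partial>lborel)"
    by (rule nn_integral_distr) auto
  finally show ?thesis by simp
qed

text \<open>The image of Lebesgue measure under \<^term>\<open>f\<close> is translation invariant, hence proportional to
  Lebesgue measure by Tonelli; the unit ball fixes the constant.\<close>

lemma nn_integral_orthogonal_transformation:
  fixes f :: "'a::euclidean_space \<Rightarrow> 'a"
  assumes f: "orthogonal_transformation f" and [measurable]: "g \<in> borel_measurable borel"
  shows "(\<integral>\<^sup>+x. g (f x) \<partial>lborel) = (\<integral>\<^sup>+x. g x \<partial>lborel)"
proof -
  have lin: "linear f" using f by (rule orthogonal_transformation_linear)
  have [measurable]: "f \<in> borel_measurable borel"
    using lin by (intro borel_measurable_continuous_onI linear_continuous_on) (simp add: linear_conv_bounded_linear)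
  define h :: "'a \<Rightarrow> ennreal" where "h = indicator (ball 0 1)"
  have [measurable]: "h \<in> borel_measurable borel" by (simp add: h_def borel_measurable_indicator)
  define H where "H = (\<integral>\<^sup>+x. h x \<partial>lborel)"
  have hf: "h (f x) = h x" for x
    using orthogonal_transformation_norm[OF f] by (simp add: h_def indicator_def)
  have H: "H \<noteq> 0" "H \<noteq> \<infinity>"
  proof -
    have H_eq: "H = emeasure lborel (ball (0::'a) 1)" by (simp add: H_def h_def)
    show "H \<noteq> \<infinity>" using emeasure_lborel_ball_finite[of "0::'a" 1] by (simp add: H_eq)
    show "H \<noteq> 0" using content_ball_pos[of 1 "0::'a"] by (auto simp: H_eq measure_def)
  qed
  have shift: "(\<integral>\<^sup>+x. k (f x + y) \<partial>lborel) = (\<integral>\<^sup>+x. k (f x) \<partial>lborel)"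
    if [measurable]: "k \<in> borel_measurable borel" for k :: "'a \<Rightarrow> ennreal" and y
  proof -
    obtain a where a: "y = f a" using orthogonal_transformation_surj[OF f] by blast
    have "(\<integral>\<^sup>+x. k (f x + y) \<partial>lborel) = (\<integral>\<^sup>+x. k (f (a + x)) \<partial>lborel)"
      by (simp add: a linear_add[OF lin] add.commute)
    also have "\<dots> = (\<integral>\<^sup>+x. k (f x) \<partial>lborel)"
      by (rule nn_integral_lborel_translate[where g="\<lambda>x. k (f x)"]) measurable
    finally show ?thesis .
  qed
  have "(\<integral>\<^sup>+x. g (f x) \<partial>lborel) * H = (\<integral>\<^sup>+x. g (f x) * H \<partial>lborel)"
    by (simp add: nn_integral_multc)
  also have "\<dots> = (\<integral>\<^sup>+x. (\<integral>\<^sup>+y. g (f x) * h (f x + y) \<partial>lborel) \<partial>lborel)"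
    by (simp add: nn_integral_cmult nn_integral_lborel_translate H_def)
  also have "\<dots> = (\<integral>\<^sup>+y. (\<integral>\<^sup>+x. g (f x) * h (f x + y) \<partial>lborel) \<partial>lborel)"
    by (rule lborel_pair.Fubini'[symmetric]) measurable
  \<comment> \<open>Translating \<open>f x\<close> by \<open>- y\<close> moves \<open>y\<close> from
    \<open>h\<close> to \<open>g\<close>. After the integrals are swapped back, the one over
    \<open>y\<close> no longer depends on \<open>x\<close>.\<close>
  also have "\<dots> = (\<integral>\<^sup>+y. (\<integral>\<^sup>+x. g (f x - y) * h (f x) \<partial>lborel) \<partial>lborel)"
    using shift[of "\<lambda>z. g (z - y) * h z" y for y] by (simp add: algebra_simps)
  also have "\<dots> = (\<integral>\<^sup>+x. (\<integral>\<^sup>+y. g (f x - y) * h (f x) \<partial>lborel) \<partial>lborel)"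
    by (rule lborel_pair.Fubini') measurable
  also have "\<dots> = (\<integral>\<^sup>+x. g x \<partial>lborel) * H"
    by (simp add: nn_integral_multc nn_integral_lborel_reflect hf nn_integral_cmult H_def)
  finally show ?thesis
    using H by (simp add: mult.commute[of _ H] ennreal_mult_cancel_left)
qed

text \<open>The orthogonal complement of \<open>S\<close> has room for \<open>card J\<close>
  orthonormal vectors. Together with an orthonormal basis of the complement of their span they form
  a full frame, onto which the standard basis is mapped so that \<open>J\<close> lands in the
  complement of \<open>S\<close>.\<close>

lemma orthogonal_transformation_into_complement:
  fixes S :: "'a::euclidean_space set"
  assumes S: "subspace S" and J: "J \<subseteq> Basis" "card J + dim S \<le> DIM('a)"
  obtains f :: "'a \<Rightarrow> 'a" where "orthogonal_transformation f"
    "\<And>b s. b \<in> J \<Longrightarrow> s \<in> S \<Longrightarrow> f b \<bullet> s = 0"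
proof -
  let ?T = "{y. \<forall>s\<in>S. orthogonal s y}"
  have subT: "subspace {y. \<forall>s\<in>A. orthogonal s y}" for A :: "'a set"
    by (simp add: subspace_def orthogonal_def inner_add_right)
  have dimT: "dim {y. \<forall>s\<in>A. orthogonal s y} + dim A = DIM('a)" if "subspace A" for A :: "'a set"
    using dim_subspace_orthogonal_to_vectors[OF that subspace_UNIV] by simp
  obtain C where C: "C \<subseteq> ?T" "pairwise orthogonal C" "\<And>x. x \<in> C \<Longrightarrow> norm x = 1"
    "independent C" "card C = dim ?T"
    by (rule orthonormal_basis_subspace[OF subT[of S]], rule that)
  have "card J \<le> card C"
    using dimT[OF S] J(2) C(5) by simp
  then obtain E where E: "E \<subseteq> C" "card E = card J"
    using ex_card by metis
  have finE: "finite E" using E(1) C(4) by (meson finite_subset independent_imp_finite)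
  have indE: "independent E" using E(1) C(4) independent_mono by blast
  let ?U = "{y. \<forall>s\<in>span E. orthogonal s y}"
  obtain F where F: "F \<subseteq> ?U" "pairwise orthogonal F" "\<And>x. x \<in> F \<Longrightarrow> norm x = 1"
    "independent F" "card F = dim ?U"
    by (rule orthonormal_basis_subspace[OF subT[of "span E"]], rule that)
  have finF: "finite F" using F(4) by (rule independent_imp_finite)
  have "card F + card J = DIM('a)"
    using dimT[OF subspace_span[of E]] F(5) E(2) indE by (simp add: dim_span dim_eq_card_independent)
  moreover have "card (Basis - J) + card J = DIM('a)"
    using J(1) by (metis card_Diff_subset card_mono finite_Basis finite_subset le_add_diff_inverse2)
  ultimately have cF: "card (Basis - J) = card F" by simp
  obtain \<phi>1 where p1: "bij_betw \<phi>1 J E"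
    using E(2) finE J(1) finite_same_card_bij[of J E] finite_subset[OF J(1)] by auto
  obtain \<phi>2 where p2: "bij_betw \<phi>2 (Basis - J) F"
    using cF finF finite_same_card_bij[of "Basis - J" F] by auto
  define \<phi> where "\<phi> b = (if b \<in> J then \<phi>1 b else \<phi>2 b)" for b
  have EF: "e \<bullet> y = 0" if "e \<in> E" "y \<in> F" for e y
    using F(1) that span_base[of e E] by (auto simp: orthogonal_def)
  have \<phi>E: "\<phi> b \<in> E" if "b \<in> J" for b using that p1 by (auto simp: \<phi>_def bij_betw_def)
  have \<phi>F: "\<phi> b \<in> F" if "b \<in> Basis" "b \<notin> J" for b using that p2 by (auto simp: \<phi>_def bij_betw_def)
  have \<phi>: "\<phi> b \<bullet> \<phi> d = (if b = d then 1 else 0)" if "b \<in> Basis" "d \<in> Basis" for b d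
  proof -
    have norm1: "\<phi> b \<bullet> \<phi> b = 1"
      using \<phi>E[of b] \<phi>F[of b] that(1) E(1) C(3) F(3) by (cases "b \<in> J") (auto simp: norm_eq_1)
    show ?thesis
    proof (cases "b = d")
      case False
      then have "\<phi> b \<bullet> \<phi> d = 0"
      proof (cases "b \<in> J \<longleftrightarrow> d \<in> J")
        case True
        show ?thesis
        proof (cases "b \<in> J")
          case bJ: True
          then have "\<phi> b \<noteq> \<phi> d"
            using False True p1 by (auto simp: \<phi>_def bij_betw_def dest: inj_onD)
          then show ?thesis
            using bJ True \<phi>E[of b] \<phi>E[of d] E(1) C(2) by (auto simp: pairwise_def orthogonal_def)
        next
          case bJ: False
          then have "\<phi> b \<noteq> \<phi> d"
            using False True p2 that by (auto simp: \<phi>_def bij_betw_def dest: inj_onD)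
          then show ?thesis
            using bJ True that \<phi>F[of b] \<phi>F[of d] F(2) by (auto simp: pairwise_def orthogonal_def)
        qed
      next
        case False
        then show ?thesis
          using that \<phi>E[of b] \<phi>F[of b] \<phi>E[of d] \<phi>F[of d] EF by (metis inner_commute)
      qed
      with False show ?thesis by simp
    qed (use norm1 in simp)
  qed
  define f where "f x = (\<Sum>b\<in>Basis. (x \<bullet> b) *\<^sub>R \<phi> b)" for x
  have "linear f"
    unfolding f_def by (intro linear_compose_sum linear_compose_scale_right ballI)
      (auto simp: linear_iff inner_add_left algebra_simps)
  moreover have "f x \<bullet> f y = x \<bullet> y" for x y
  proof -
    have "f x \<bullet> f y = (\<Sum>b\<in>Basis. (x \<bullet> b) * (\<phi> b \<bullet> f y))"
      by (simp add: f_def[of x] inner_sum_left)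
    also have "\<dots> = (\<Sum>b\<in>Basis. (x \<bullet> b) * (y \<bullet> b))"
      by (simp add: f_def inner_sum_right \<phi> if_distrib cong: if_cong sum.cong)
    finally show ?thesis by (simp add: euclidean_inner[of x y])
  qed
  ultimately have "orthogonal_transformation f"
    by (simp add: orthogonal_transformation_def)
  moreover have "f b \<bullet> s = 0" if "b \<in> J" "s \<in> S" for b s
  proof -
    have "f b = \<phi> b"
      using that(1) J(1) by (auto simp: f_def inner_Basis if_distrib[of "\<lambda>t. t *\<^sub>R _"] cong: if_cong sum.cong)
    then show ?thesis
      using \<phi>E[OF that(1)] E(1) C(1) that(2) by (auto simp: orthogonal_def inner_commute)
  qed
  ultimately show thesis by (rule that)
qed

text \<open>Powers with the value \<^term>\<open>\<infinity>\<close> at \<^term>\<open>0\<close>, so that finiteness of an integral also shows that the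
  base is almost everywhere nonzero; note that \<^term>\<open>(0::real) powr a = 0\<close>.\<close>

definition ipow :: "real \<Rightarrow> real \<Rightarrow> ennreal" where
  "ipow a t = (if t = 0 then \<infinity> else ennreal (t powr (- a)))"

lemma ipow_measurable [measurable]: "ipow a \<in> borel_measurable borel"
  unfolding ipow_def[abs_def] by measurable

lemma ipow_mult: "0 \<le> t \<Longrightarrow> 0 \<le> u \<Longrightarrow> ipow a (t * u) = ipow a t * ipow a u"
  by (auto simp: ipow_def powr_mult ennreal_mult ennreal_top_mult ennreal_mult_top)

lemma ipow_antimono: "0 \<le> a \<Longrightarrow> 0 \<le> t \<Longrightarrow> t \<le> u \<Longrightarrow> ipow a u \<le> ipow a t"
  by (auto simp: ipow_def powr_minus intro!: ennreal_leI le_imp_inverse_le powr_mono2)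

lemma ipow_square: "0 \<le> t \<Longrightarrow> ipow a (t\<^sup>2) = ipow (2 * a) t"
  using powr_powr[of t 2 "- a"] by (auto simp: ipow_def powr_numeral)

text \<open>Divides a singularity of order \<open>a\<close> into \<open>d\<close> factors of order
  \<open>a / d\<close>, one for each transverse direction in
  \<open>nn_integral_ipow_distance_bound\<close>.\<close>

lemma ipow_power_split: "0 \<le> t \<Longrightarrow> 0 < d \<Longrightarrow> ipow a t = ipow (a / real d) t ^ d"
proof -
  assume t: "0 \<le> t" "0 < d"
  have "t powr (- a) = (t powr (- (a / real d))) ^ d" if "t > 0"
    using that t by (simp add: powr_realpow[symmetric] powr_powr)
  with t show ?thesis
    by (auto simp: ipow_def ennreal_power top_power_ennreal)
qed

lemma nn_integral_ipow_Icc: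
  assumes "0 \<le> a" "a < 1"
  shows "(\<integral>\<^sup>+t. indicator {-1..1} t * ipow a \<bar>t\<bar> \<partial>lborel) < \<infinity>"
proof -
  let ?p = "\<lambda>t. ennreal (indicator {0..1} t * t powr (- a))"
  have I: "(\<integral>\<^sup>+t. ?p t \<partial>lborel) < \<infinity>"
  proof -
    have "((\<lambda>t. t powr (- a)) has_integral (1 powr (- a + 1) / (- a + 1))) {0..1}"
      using assms by (intro has_integral_powr_from_0) auto
    then have "(\<integral>\<^sup>+t. ?p t \<partial>lborel) = ennreal (1 powr (- a + 1) / (- a + 1))"
      by (intro nn_integral_has_integral_lebesgue) auto
    then show ?thesis by simp
  qed
  have "(\<integral>\<^sup>+t. indicator {-1..1} t * ipow a \<bar>t\<bar> \<partial>lborel) \<le> (\<integral>\<^sup>+t. ?p t + ?p (0 - t) \<partial>lborel)"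
  proof (rule nn_integral_mono_AE)
    \<comment> \<open>The infinite value of \<open>ipow\<close> at \<open>0\<close> sits on a null
      set; the negative half-interval is the mirror image of the positive one.\<close>
    have "AE t in lborel. t \<noteq> (0::real)" by (rule AE_lborel_singleton)
    then show "AE t in lborel. indicator {-1..1} t * ipow a \<bar>t\<bar> \<le> ?p t + ?p (0 - t)"
      by eventually_elim (auto simp: ipow_def indicator_def abs_if)
  qed
  also have "\<dots> = (\<integral>\<^sup>+t. ?p t \<partial>lborel) + (\<integral>\<^sup>+t. ?p (0 - t) \<partial>lborel)"
    by (rule nn_integral_add) measurable
  also have "(\<integral>\<^sup>+t. ?p (0 - t) \<partial>lborel) = (\<integral>\<^sup>+t. ?p t \<partial>lborel)"
    by (rule nn_integral_lborel_reflect) measurable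
  finally have "(\<integral>\<^sup>+t. indicator {-1..1} t * ipow a \<bar>t\<bar> \<partial>lborel)
      \<le> (\<integral>\<^sup>+t. ?p t \<partial>lborel) + (\<integral>\<^sup>+t. ?p t \<partial>lborel)" .
  then show ?thesis using I by (auto intro: le_less_trans)
qed

text \<open>The distance from \<open>y\<close> to a point of \<open>S\<close> is at least each of
  \<open>d\<close> orthonormal coordinates transverse to \<open>S\<close>, so its negative power is
  at most a product of one-dimensional singularities of order \<open>a / d < 1\<close>. Rotation
  invariance makes the bound uniform in \<open>S\<close>. A measurable majorant \<open>g\<close> is
  asserted because the point \<open>s\<close> will later depend on \<open>y\<close> through a
  choice.\<close>

lemma nn_integral_ipow_distance_bound:
  assumes a: "0 \<le> a" "a < real d" and d: "d \<le> DIM('a::euclidean_space)"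
  obtains C :: ennreal where "C < \<infinity>"
    "\<And>S. subspace (S :: 'a set) \<Longrightarrow> d + dim S \<le> DIM('a) \<Longrightarrow> \<exists>g\<in>borel_measurable borel.
       (\<forall>y. \<forall>s\<in>S. indicator {y. norm y \<le> 1} y * ipow a (norm (y - s)) \<le> g y) \<and> (\<integral>\<^sup>+y. g y \<partial>lborel) \<le> C"
proof -
  have d0: "0 < d" using a by simp
  obtain J :: "'a set" where J: "J \<subseteq> Basis" "card J = d"
    using ex_card[OF d] by blast
  define \<beta> where "\<beta> = a / real d"
  have \<beta>: "0 \<le> \<beta>" "\<beta> < 1" using a d0 by (auto simp: \<beta>_def)
  \<comment> \<open>The unit ball lies in the cube with sides \<open>{-1..1}\<close>, so the
    integral factors; directions outside \<open>J\<close> carry no singularity.\<close>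
  define q :: "'a \<Rightarrow> real \<Rightarrow> ennreal" where
    "q b t = indicator {-1..1} t * (if b \<in> J then ipow \<beta> \<bar>t\<bar> else 1)" for b t
  have [measurable]: "q b \<in> borel_measurable borel" for b
    unfolding q_def[abs_def] by measurable
  define C where "C = (\<Prod>b\<in>Basis. \<integral>\<^sup>+t. q b t \<partial>lborel)"
  have "(\<integral>\<^sup>+t. q b t \<partial>lborel) < \<infinity>" for b
    using nn_integral_ipow_Icc[OF \<beta>] by (cases "b \<in> J") (simp_all add: q_def)
  then have "C < \<infinity>"
    unfolding C_def by (auto simp: less_top[symmetric] ennreal_prod_eq_top)
  moreover have "\<exists>g\<in>borel_measurable borel.
       (\<forall>y. \<forall>s\<in>S. indicator {y. norm y \<le> 1} y * ipow a (norm (y - s)) \<le> g y) \<and> (\<integral>\<^sup>+y. g y \<partial>lborel) \<le> C"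
    if S: "subspace (S :: 'a set)" "d + dim S \<le> DIM('a)" for S
  proof -
    obtain f :: "'a \<Rightarrow> 'a" where f: "orthogonal_transformation f" "\<And>b s. b \<in> J \<Longrightarrow> s \<in> S \<Longrightarrow> f b \<bullet> s = 0"
      using orthogonal_transformation_into_complement[OF S(1) J(1)] S(2) J(2) by metis
    have nf: "norm (f b) = norm b" for b using f(1) by (simp add: orthogonal_transformation)
    let ?g = "\<lambda>y. indicator {y. norm y \<le> 1} y * (\<Prod>b\<in>J. ipow \<beta> \<bar>f b \<bullet> y\<bar>)"
    have bound: "indicator {y. norm y \<le> 1} y * ipow a (norm (y - s)) \<le> ?g y" if s: "s \<in> S" for y s
    proof (intro mult_left_mono)
      have "ipow a (norm (y - s)) = (\<Prod>b\<in>J. ipow \<beta> (norm (y - s)))"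
        using ipow_power_split[of "norm (y - s)" d a] d0 J(2) by (simp add: \<beta>_def)
      also have "\<dots> \<le> (\<Prod>b\<in>J. ipow \<beta> \<bar>f b \<bullet> y\<bar>)"
      proof (intro prod_mono_ennreal ipow_antimono \<beta>)
        fix b assume b: "b \<in> J"
        have "\<bar>f b \<bullet> y\<bar> = \<bar>f b \<bullet> (y - s)\<bar>"
          using f(2)[OF b s] by (simp add: inner_diff_right)
        also have "\<dots> \<le> norm (f b) * norm (y - s)"
          by (rule Cauchy_Schwarz_ineq2)
        also have "norm (f b) = 1" using b J(1) by (auto simp: nf)
        finally show "\<bar>f b \<bullet> y\<bar> \<le> norm (y - s)" by simp
      qed auto
      finally show "ipow a (norm (y - s)) \<le> (\<Prod>b\<in>J. ipow \<beta> \<bar>f b \<bullet> y\<bar>)" .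
    qed auto
    have "(\<integral>\<^sup>+y. ?g y \<partial>lborel) = (\<integral>\<^sup>+x. ?g (f x) \<partial>lborel)"
      by (rule nn_integral_orthogonal_transformation[OF f(1), symmetric]) measurable
    also have "\<dots> \<le> (\<integral>\<^sup>+x. (\<Prod>b\<in>Basis. q b (x \<bullet> b)) \<partial>lborel)"
    proof (rule nn_integral_mono)
      fix x :: 'a
      have "f b \<bullet> f x = x \<bullet> b" for b
        using f(1) by (simp add: orthogonal_transformation_def inner_commute)
      then have "?g (f x) = indicator {y. norm y \<le> 1} x * (\<Prod>b\<in>J. ipow \<beta> \<bar>x \<bullet> b\<bar>)"
        by (simp add: indicator_def nf)
      also have "(\<Prod>b\<in>J. ipow \<beta> \<bar>x \<bullet> b\<bar>) = (\<Prod>b\<in>Basis. if b \<in> J then ipow \<beta> \<bar>x \<bullet> b\<bar> else 1)"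
        using J(1) by (simp add: prod.If_cases Int_absorb1)
      also have "indicator {y. norm y \<le> 1} x \<le> (\<Prod>b\<in>Basis. indicator {-1..1} (x \<bullet> b) :: ennreal)"
      proof (cases "norm x \<le> 1")
        case True
        then have "x \<bullet> b \<in> {-1..1}" if "b \<in> Basis" for b
          using Basis_le_norm[OF that, of x] by (auto simp: abs_le_iff)
        then show ?thesis by (simp add: indicator_def)
      qed (simp add: indicator_def)
      finally show "?g (f x) \<le> (\<Prod>b\<in>Basis. q b (x \<bullet> b))"
        unfolding q_def prod.distrib by (simp add: mult_right_mono)
    qed
    also have "\<dots> = C"
      unfolding C_def by (rule nn_integral_lborel_prod) auto
    finally show ?thesis
      using bound by (intro bexI[of _ ?g]) auto
  qed
  ultimately show thesis by (rule that)
qed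

text \<open>The coefficients are indexed by \<open>S\<close> and not by the vectors, because
  different columns may coincide while the row operation in \<open>gram_insert\<close> acts on
  indices.\<close>

lemma in_span_image_sum:
  fixes m :: "'i \<Rightarrow> 'a::real_vector"
  assumes "finite S" "s \<in> span (m ` S)"
  shows "\<exists>c. s = (\<Sum>i\<in>S. c i *\<^sub>R m i)"
  using assms
proof (induction S arbitrary: s)
  case (insert j S)
  then obtain k where "s - k *\<^sub>R m j \<in> span (m ` S)"
    by (auto simp: span_insert)
  from insert.IH[OF this] obtain c where c: "s - k *\<^sub>R m j = (\<Sum>i\<in>S. c i *\<^sub>R m i)"
    by blast
  have "s = (\<Sum>i\<in>insert j S. (c(j := k)) i *\<^sub>R m i)"
  proof -
    have "(\<Sum>i\<in>S. (c(j := k)) i *\<^sub>R m i) = (\<Sum>i\<in>S. c i *\<^sub>R m i)"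
      using insert.hyps(2) by (intro sum.cong) auto
    then show ?thesis using insert.hyps c by (simp add: algebra_simps)
  qed
  then show ?case by blast
qed simp

text \<open>Padding with an identity block keeps the matrix type fixed, which allows induction on \<^term>\<open>S\<close>.\<close>

definition gram_matrix :: "'p::finite set \<Rightarrow> ('p \<Rightarrow> 'a::euclidean_space) \<Rightarrow> real^'p^'p" where
  "gram_matrix S m = (\<chi> i j. if i \<in> S \<and> j \<in> S then m i \<bullet> m j else if i = j then 1 else 0)"

text \<open>Write \<open>m j = s + t\<close> with \<open>s\<close> the projection onto the span.
  Subtracting the rows of \<open>S\<close> with the coefficients of \<open>s\<close> turns row
  \<open>j\<close> into \<open>(norm t)\<^sup>2\<close> times a unit row. In the Leibniz sum only
  permutations fixing \<open>j\<close> then survive, and these avoid column \<open>j\<close> in all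
  other rows, where the two matrices agree.\<close>

lemma gram_insert:
  fixes m :: "'p::finite \<Rightarrow> 'a::euclidean_space"
  assumes j: "j \<notin> S"
  shows "\<exists>s\<in>span (m ` S). det (gram_matrix (insert j S) m) = (norm (m j - s))\<^sup>2 * det (gram_matrix S m)"
proof -
  obtain s t where s: "s \<in> span (m ` S)" and t: "\<And>w. w \<in> span (m ` S) \<Longrightarrow> orthogonal t w" and mj: "m j = s + t"
    using orthogonal_subspace_decomp_exists[of "m ` S" "m j"] by blast
  obtain c where c: "s = (\<Sum>i\<in>S. c i *\<^sub>R m i)"
    using in_span_image_sum[OF _ s] by auto
  have tm: "t \<bullet> m i = 0" if "i \<in> S" for i
    using t[of "m i"] that by (simp add: span_base orthogonal_def)
  have tj: "t \<bullet> m j = (norm t)\<^sup>2"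
    using t[OF s] by (simp add: mj inner_add_right orthogonal_def power2_norm_eq_inner)
  let ?A = "gram_matrix (insert j S) m" and ?G = "gram_matrix S m"
  let ?x = "- (\<Sum>i\<in>S. c i *s row i ?A)"
  define A1 where "A1 = (\<chi> k. if k = j then row j ?A + ?x else row k ?A)"
  have "?x \<in> vec.span {row k ?A |k. k \<noteq> j}"
    using j by (intro vec.span_neg vec.span_sum vec.span_scale vec.span_base) auto
  then have det_A1: "det A1 = det ?A"
    unfolding A1_def by (rule det_row_span)
  have A1j: "A1 $ j $ l = (if l = j then (norm t)\<^sup>2 else 0)" for l
  proof -
    have "A1 $ j $ l = ?A $ j $ l - (\<Sum>i\<in>S. c i * ?A $ i $ l)"
      by (simp add: A1_def row_def)
    also have "(\<Sum>i\<in>S. c i * ?A $ i $ l) = (if l \<in> insert j S then s \<bullet> m l else 0)"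
    proof (cases "l \<in> insert j S")
      case True
      then have "(\<Sum>i\<in>S. c i * ?A $ i $ l) = (\<Sum>i\<in>S. c i * (m i \<bullet> m l))"
        by (intro sum.cong) (auto simp: gram_matrix_def)
      with True show ?thesis by (simp add: c inner_sum_left)
    qed (auto simp: gram_matrix_def intro!: sum.neutral)
    also have "?A $ j $ l - \<dots> = (if l = j then (norm t)\<^sup>2 else 0)"
    proof (cases "l \<in> insert j S")
      case True
      then have "?A $ j $ l = m j \<bullet> m l" by (simp add: gram_matrix_def)
      also have "\<dots> = s \<bullet> m l + t \<bullet> m l" by (simp add: mj inner_add_left)
      finally show ?thesis using True tm[of l] tj by auto
    qed (auto simp: gram_matrix_def)
    finally show ?thesis .
  qed
  have A1i: "A1 $ i $ l = ?G $ i $ l" if "i \<noteq> j" "l \<noteq> j" for i l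
    using that by (auto simp: A1_def row_def gram_matrix_def)
  have Gj: "?G $ j $ l = (if l = j then 1 else 0)" for l
    using j by (auto simp: gram_matrix_def)
  have "(\<Prod>i\<in>UNIV. A1 $ i $ p i) = (norm t)\<^sup>2 * (\<Prod>i\<in>UNIV. ?G $ i $ p i)" if "p permutes UNIV" for p
  proof -
    have split: "(\<Prod>i\<in>UNIV. f i) = f j * (\<Prod>i\<in>UNIV - {j}. f i)" for f :: "'p \<Rightarrow> real"
      by (rule prod.remove) auto
    show ?thesis
    proof (cases "p j = j")
      case True
      have "(\<Prod>i\<in>UNIV - {j}. A1 $ i $ p i) = (\<Prod>i\<in>UNIV - {j}. ?G $ i $ p i)"
      proof (intro prod.cong refl A1i)
        fix i assume i: "i \<in> UNIV - {j}"
        then show "p i \<noteq> j"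
          using True inj_eq[OF permutes_inj[OF that], of i j] by auto
      qed auto
      then show ?thesis unfolding split by (simp add: A1j Gj True)
    next
      case False
      then show ?thesis unfolding split by (simp add: A1j Gj)
    qed
  qed
  then have "det A1 = (norm t)\<^sup>2 * det ?G"
    unfolding det_def by (simp add: sum_distrib_left mult_ac)
  with s det_A1 show ?thesis
    by (intro bexI[of _ s]) (auto simp: mj)
qed

lemma det_gram_empty: "det (gram_matrix {} m) = 1"
proof -
  have "gram_matrix {} m = mat 1" by (simp add: gram_matrix_def mat_def)
  then show ?thesis by simp
qed

lemma det_gram_nonneg: "0 \<le> det (gram_matrix S (m :: 'p::finite \<Rightarrow> 'a::euclidean_space))"
proof -
  have "finite S" by simp
  then show ?thesis
  proof induction
    case (insert j S)
    with gram_insert[of j S m] show ?case by auto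
  qed (simp add: det_gram_empty)
qed

lemma det_gram_measurable [measurable]:
  "(\<lambda>m. det (gram_matrix S m)) \<in> borel_measurable (Pi\<^sub>M (S::'p::finite set) (\<lambda>_. lborel :: 'a::euclidean_space measure))"
proof -
  have [measurable]: "(\<lambda>m. gram_matrix S m $ i $ j) \<in> borel_measurable (Pi\<^sub>M S (\<lambda>_. lborel :: 'a measure))" for i j
    by (cases "i \<in> S \<and> j \<in> S") (auto simp: gram_matrix_def)
  show ?thesis unfolding det_def by measurable
qed

lemma nn_integral_ipow_gram_finite:
  fixes S :: "'p::finite set"
  assumes a: "0 \<le> a" "2 * a + real CARD('p) \<le> real DIM('a::euclidean_space)"
  shows "(\<integral>\<^sup>+m. (\<Prod>i\<in>S. indicator {y. norm y \<le> 1} (m i)) * ipow a (det (gram_matrix S m))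
      \<partial>(Pi\<^sub>M S (\<lambda>_. lborel :: 'a measure))) < \<infinity>"
proof -
  interpret product_sigma_finite "\<lambda>_::'p. lborel :: 'a measure"
    by standard
  \<comment> \<open>A column is measured against the span of at most \<open>CARD('p) - 1\<close>
    others, so \<open>d\<close> bounds the codimension of that span from below. The determinant
    contains squared distances, whence \<open>2 * a\<close>; the hypothesis reads
    \<open>2 * a \<le> d - 1\<close>, safely below the critical exponent \<open>d\<close>.\<close>
  define d where "d = DIM('a) - (CARD('p) - 1)"
  have p: "CARD('p) \<ge> 1" by (simp add: Suc_leI)
  have le: "CARD('p) \<le> DIM('a)" using a by linarith
  have d: "2 * a < real d" "d \<le> DIM('a)"
    using a p le unfolding d_def by linarith+
  obtain C :: ennreal where C: "C < \<infinity>"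
    "\<And>S. subspace (S :: 'a set) \<Longrightarrow> d + dim S \<le> DIM('a) \<Longrightarrow> \<exists>g\<in>borel_measurable borel.
       (\<forall>y. \<forall>s\<in>S. indicator {y. norm y \<le> 1} y * ipow (2 * a) (norm (y - s)) \<le> g y) \<and> (\<integral>\<^sup>+y. g y \<partial>lborel) \<le> C"
    by (rule nn_integral_ipow_distance_bound[OF _ d], use a in simp, rule that)
  have "finite S" by simp
  then show ?thesis
  proof induction
    case empty
    then show ?case by (simp add: det_gram_empty ipow_def space_PiM)
  next
    case (insert j S)
    have Sp: "card S \<le> CARD('p) - 1"
      using insert.hyps card_mono[of UNIV "insert j S"] by simp
    let ?I = "\<lambda>S m. \<Prod>i\<in>S. indicator {y. norm y \<le> 1} (m i :: 'a) :: ennreal"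
    have upd: "(\<integral>\<^sup>+y. ?I (insert j S) (m(j := y)) * ipow a (det (gram_matrix (insert j S) (m(j := y)))) \<partial>lborel)
        \<le> C * (?I S m * ipow a (det (gram_matrix S m)))" for m
    proof -
      have G: "gram_matrix S (m(j := y)) = gram_matrix S m" for y
        using insert.hyps by (auto simp: gram_matrix_def vec_eq_iff)
      have im: "(m(j := y)) ` S = m ` S" for y
        using insert.hyps by auto
      have "\<exists>s. \<forall>y. s y \<in> span (m ` S) \<and>
          det (gram_matrix (insert j S) (m(j := y))) = (norm (y - s y))\<^sup>2 * det (gram_matrix S m)"
        using gram_insert[OF insert.hyps(2), of "m(j := y)" for y]
        unfolding im G fun_upd_same by metis
      then obtain s where s: "\<And>y. s y \<in> span (m ` S)"
        "\<And>y. det (gram_matrix (insert j S) (m(j := y))) = (norm (y - s y))\<^sup>2 * det (gram_matrix S m)"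
        by blast
      have I: "?I (insert j S) (m(j := y)) = indicator {y. norm y \<le> 1} y * ?I S m" for y
      proof -
        have "?I S (m(j := y)) = ?I S m" using insert.hyps by (intro prod.cong) auto
        then show ?thesis using insert.hyps by simp
      qed
      have "(\<integral>\<^sup>+y. ?I (insert j S) (m(j := y)) * ipow a (det (gram_matrix (insert j S) (m(j := y)))) \<partial>lborel)
          = (\<integral>\<^sup>+y. (indicator {y. norm y \<le> 1} y * ipow (2 * a) (norm (y - s y)))
               * (?I S m * ipow a (det (gram_matrix S m))) \<partial>lborel)"
        unfolding s(2) I by (simp add: ipow_mult det_gram_nonneg ipow_square mult_ac)
      also have "\<dots> \<le> C * (?I S m * ipow a (det (gram_matrix S m)))"
      proof -
        have "dim (span (m ` S)) \<le> card S"
          using dim_le_card'[of "m ` S"] card_image_le[of S m] by (simp add: dim_span)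
        then have "d + dim (span (m ` S)) \<le> DIM('a)"
          using Sp p le unfolding d_def by linarith
        from C(2)[OF subspace_span this] obtain g where [measurable]: "g \<in> borel_measurable borel"
          and g: "\<And>y s. s \<in> span (m ` S) \<Longrightarrow> indicator {y. norm y \<le> 1} y * ipow (2 * a) (norm (y - s)) \<le> g y"
            "(\<integral>\<^sup>+y. g y \<partial>lborel) \<le> C" by auto
        have "(\<integral>\<^sup>+y. (indicator {y. norm y \<le> 1} y * ipow (2 * a) (norm (y - s y)))
               * (?I S m * ipow a (det (gram_matrix S m))) \<partial>lborel)
           \<le> (\<integral>\<^sup>+y. g y * (?I S m * ipow a (det (gram_matrix S m))) \<partial>lborel)"
          using g(1) s(1) by (intro nn_integral_mono mult_right_mono) auto
        also have "\<dots> = (\<integral>\<^sup>+y. g y \<partial>lborel) * (?I S m * ipow a (det (gram_matrix S m)))"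
          by (rule nn_integral_multc) measurable
        also have "\<dots> \<le> C * (?I S m * ipow a (det (gram_matrix S m)))"
          by (intro mult_right_mono g(2)) auto
        finally show ?thesis .
      qed
      finally show ?thesis .
    qed
    have "(\<integral>\<^sup>+m. ?I (insert j S) m * ipow a (det (gram_matrix (insert j S) m)) \<partial>(Pi\<^sub>M (insert j S) (\<lambda>_. lborel)))
      = (\<integral>\<^sup>+m. (\<integral>\<^sup>+y. ?I (insert j S) (m(j := y)) * ipow a (det (gram_matrix (insert j S) (m(j := y)))) \<partial>lborel)
          \<partial>(Pi\<^sub>M S (\<lambda>_. lborel)))"
      using insert.hyps by (intro product_nn_integral_insert) measurable
    also have "\<dots> \<le> (\<integral>\<^sup>+m. C * (?I S m * ipow a (det (gram_matrix S m))) \<partial>(Pi\<^sub>M S (\<lambda>_. lborel)))"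
      by (intro nn_integral_mono upd)
    also have "\<dots> = C * (\<integral>\<^sup>+m. ?I S m * ipow a (det (gram_matrix S m)) \<partial>(Pi\<^sub>M S (\<lambda>_. lborel)))"
      by (rule nn_integral_cmult) measurable
    also have "\<dots> < \<infinity>"
      using C(1) insert.IH by (auto simp: ennreal_mult_less_top)
    finally show ?case .
  qed
qed

section \<open>The priors\<close>

lemma Basis_matrix:
  "(Basis :: (real^'p^'n) set) = (\<lambda>(a, i). axis a (axis i 1)) ` UNIV"
  by (auto simp: Basis_vec_def image_iff)

lemma axis_axis_in_Basis [simp]: "axis a (axis i 1) \<in> (Basis :: (real^'p^'n) set)"
  by (auto simp: Basis_vec_def)

lemma inj_axis_axis: "inj (\<lambda>(a, i). axis a (axis i (1::real)))"
  by (auto simp: inj_def axis_eq_axis)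

lemma prod_Basis_matrix:
  "(\<Prod>b\<in>(Basis :: (real^'p^'n) set). f b) = (\<Prod>a\<in>UNIV. \<Prod>i\<in>UNIV. f (axis a (axis i 1)))"
  unfolding Basis_matrix
  by (subst prod.reindex[OF inj_axis_axis])
     (simp add: prod.cartesian_product UNIV_Times_UNIV[symmetric] case_prod_unfold comp_def del: UNIV_Times_UNIV)

lemma inner_axis_axis_matrix [simp]: "(M :: real^'p^'n) \<bullet> axis a (axis i 1) = M $ a $ i"
  by (simp add: inner_axis)

lemma norm_column_le: "norm (column i (M :: real^'p^'n)) \<le> norm M"
  unfolding norm_vec_def[of "column i M"] norm_vec_def[of M]
  by (rule L2_set_mono) (auto simp: column_def intro: component_le_norm_cart)

lemma det_transpose_mult_self:
  "det (transpose M ** M) = det (gram_matrix UNIV (\<lambda>i. column i (M :: real^'p^'n)))"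
proof -
  have "transpose M ** M = gram_matrix UNIV (\<lambda>i. column i M)"
    by (simp add: vec_eq_iff gram_matrix_def matrix_matrix_mult_def transpose_def column_def inner_vec_def)
  then show ?thesis by simp
qed

lemma det_transpose_mult_self_nonneg: "0 \<le> det (transpose M ** (M :: real^'p^'n))"
  unfolding det_transpose_mult_self by (rule det_gram_nonneg)

definition of_columns :: "('p \<Rightarrow> real^'n) \<Rightarrow> real^'p^'n" where
  "of_columns m = (\<chi> a i. m i $ a)"

lemma column_of_columns [simp]: "column i (of_columns m) = m i"
  by (simp add: column_def of_columns_def vec_eq_iff)

lemma of_columns_measurable [measurable]:
  "of_columns \<in> (Pi\<^sub>M UNIV (\<lambda>_. lborel)) \<rightarrow>\<^sub>M (borel :: (real^'p^'n) measure)"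
proof (subst borel_measurable_euclidean_space, rule ballI)
  fix b :: "real^'p^'n" assume "b \<in> Basis"
  then obtain a i where b: "b = axis a (axis i 1)" by (auto simp: Basis_matrix)
  have "(\<lambda>m. m i \<bullet> axis a 1) \<in> borel_measurable (Pi\<^sub>M UNIV (\<lambda>_::'p. lborel :: (real^'n) measure))"
    by measurable
  then show "(\<lambda>m. of_columns m \<bullet> b) \<in> borel_measurable (Pi\<^sub>M UNIV (\<lambda>_::'p. lborel :: (real^'n) measure))"
    by (simp add: b of_columns_def inner_axis)
qed

text \<open>Both measures agree on boxes, where the volume is one double product taken in either
  order. This turns integrals over matrices, which are stored by rows, into iterated integrals over
  columns.\<close>

lemma lborel_eq_columns:
  "(lborel :: (real^'p^'n) measure) = distr (Pi\<^sub>M UNIV (\<lambda>_. lborel)) borel of_columns"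
proof (rule lborel_eqI)
  interpret product_sigma_finite "\<lambda>_::'p. lborel :: (real^'n) measure"
    by standard
  fix l u :: "real^'p^'n" assume lu: "\<And>b. b \<in> Basis \<Longrightarrow> l \<bullet> b \<le> u \<bullet> b"
  have lu': "l $ a $ i \<le> u $ a $ i" for a i
    using lu[of "axis a (axis i 1)"] by simp
  have pre: "of_columns -` box l u \<inter> space (Pi\<^sub>M UNIV (\<lambda>_::'p. lborel :: (real^'n) measure))
      = (\<Pi>\<^sub>E i\<in>UNIV. box (column i l) (column i u))"
    by (auto simp: mem_box Basis_matrix of_columns_def space_PiM PiE_iff column_def Basis_vec_def inner_axis)
  have "emeasure (distr (Pi\<^sub>M UNIV (\<lambda>_. lborel)) borel of_columns) (box l u)
      = (\<Prod>i\<in>UNIV. emeasure lborel (box (column i l) (column i u)))"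
    by (subst emeasure_distr) (auto simp: pre emeasure_PiM)
  also have "\<dots> = (\<Prod>i\<in>UNIV. ennreal (\<Prod>a\<in>UNIV. u $ a $ i - l $ a $ i))"
  proof (intro prod.cong refl)
    fix i :: 'p
    have "emeasure lborel (box (column i l) (column i u)) = ennreal (\<Prod>b\<in>Basis. (column i u - column i l) \<bullet> b)"
      using lu' by (intro emeasure_lborel_box) (auto simp: Basis_vec_def inner_axis column_def)
    also have "(\<Prod>b\<in>Basis. (column i u - column i l) \<bullet> b) = (\<Prod>a\<in>UNIV. u $ a $ i - l $ a $ i)"
    proof -
      have B: "(Basis :: (real^'n) set) = (\<lambda>a. axis a 1) ` UNIV"
        by (auto simp: Basis_vec_def)
      have "inj (\<lambda>a::'n. axis a (1::real))" by (auto simp: inj_def axis_eq_axis)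
      then show ?thesis
        unfolding B by (subst prod.reindex) (auto simp: inner_axis column_def)
    qed
    finally show "emeasure lborel (box (column i l) (column i u)) = ennreal (\<Prod>a\<in>UNIV. u $ a $ i - l $ a $ i)" .
  qed
  also have "\<dots> = ennreal (\<Prod>i\<in>UNIV. \<Prod>a\<in>UNIV. u $ a $ i - l $ a $ i)"
    using lu' by (intro prod_ennreal prod_nonneg) auto
  also have "(\<Prod>i\<in>UNIV. \<Prod>a\<in>UNIV. u $ a $ i - l $ a $ i) = (\<Prod>b\<in>Basis. (u - l) \<bullet> b)"
    unfolding prod_Basis_matrix by (subst prod.swap) simp
  finally show "emeasure (distr (Pi\<^sub>M UNIV (\<lambda>_. lborel)) borel of_columns) (box l u) = ennreal (\<Prod>b\<in>Basis. (u - l) \<bullet> b)" .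
qed simp

lemma continuous_on_det_gram: "continuous_on UNIV (\<lambda>M::real^'p^'n. det (transpose M ** M))"
  unfolding det_def matrix_matrix_mult_def transpose_def
  by (intro continuous_intros)

lemma det_gram_borel [measurable]: "(\<lambda>M::real^'p^'n. det (transpose M ** M)) \<in> borel_measurable borel"
  using continuous_on_det_gram by (rule borel_measurable_continuous_onI)

lemma nn_integral_ipow_det_unit_ball:
  assumes a: "0 \<le> a" "2 * a + real CARD('p) \<le> real CARD('n)"
  shows "(\<integral>\<^sup>+M. indicator {M. norm M \<le> 1} M * ipow a (det (transpose M ** M)) \<partial>(lborel :: (real^'p^'n) measure)) < \<infinity>"
proof -
  let ?P = "Pi\<^sub>M UNIV (\<lambda>_::'p. lborel :: (real^'n) measure)"
  have "(\<integral>\<^sup>+M. indicator {M. norm M \<le> 1} M * ipow a (det (transpose M ** M)) \<partial>(lborel :: (real^'p^'n) measure))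
    = (\<integral>\<^sup>+m. indicator {M. norm M \<le> 1} (of_columns m) * ipow a (det (transpose (of_columns m) ** of_columns m)) \<partial>?P)"
    by (subst lborel_eq_columns, subst nn_integral_distr) measurable
  also have "\<dots> \<le> (\<integral>\<^sup>+m. (\<Prod>i\<in>UNIV. indicator {y. norm y \<le> 1} (m i)) * ipow a (det (gram_matrix UNIV m)) \<partial>?P)"
  proof (rule nn_integral_mono)
    fix m :: "'p \<Rightarrow> real^'n"
    have "indicator {M. norm M \<le> 1} (of_columns m) \<le> (\<Prod>i\<in>UNIV. indicator {y. norm y \<le> 1} (m i) :: ennreal)"
    proof (cases "norm (of_columns m) \<le> 1")
      case True
      then have "norm (m i) \<le> 1" for i
        using norm_column_le[of i "of_columns m"] by simp
      then show ?thesis by (simp add: indicator_def)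
    qed (simp add: indicator_def)
    then show "indicator {M. norm M \<le> 1} (of_columns m) * ipow a (det (transpose (of_columns m) ** of_columns m))
        \<le> (\<Prod>i\<in>UNIV. indicator {y. norm y \<le> 1} (m i)) * ipow a (det (gram_matrix UNIV m))"
      unfolding det_transpose_mult_self by (simp add: mult_right_mono)
  qed
  also have "\<dots> < \<infinity>"
    using nn_integral_ipow_gram_finite[OF a(1), where 'a="real^'n" and S="UNIV::'p set"] a(2) by simp
  finally show ?thesis .
qed

section \<open>Dilations and dyadic summation\<close>

lemma nn_integral_lborel_scale:
  fixes g :: "'a::euclidean_space \<Rightarrow> ennreal"
  assumes [measurable]: "g \<in> borel_measurable borel" and c: "c > 0"
  shows "(\<integral>\<^sup>+x. g x \<partial>lborel) = ennreal (c ^ DIM('a)) * (\<integral>\<^sup>+x. g (c *\<^sub>R x) \<partial>lborel)"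
proof -
  have eq: "lborel = density (distr lborel borel (\<lambda>x::'a. c *\<^sub>R x)) (\<lambda>_. ennreal (c ^ DIM('a)))"
    using lborel_affine[of c 0] c by (simp add: ennreal_power)
  show ?thesis
    by (subst eq, subst nn_integral_density) (auto simp: nn_integral_cmult nn_integral_distr)
qed

lemma det_gram_scaleR:
  "det (transpose (c *\<^sub>R M) ** (c *\<^sub>R M)) = c ^ (2 * CARD('p)) * det (transpose M ** (M :: real^'p^'n))"
proof -
  have "transpose (c *\<^sub>R M) ** (c *\<^sub>R M) = (\<chi> i. c\<^sup>2 *s (transpose M ** M) $ i)"
    by (simp add: vec_eq_iff matrix_matrix_mult_def transpose_def sum_distrib_left power2_eq_square mult_ac)
  then show ?thesis
    by (simp add: det_rows_mul power_mult)
qed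

text \<open>The homogeneity degree of the measure with density \<^const>\<open>pi_svs\<close> is
  \<^term>\<open>n * p - p * (n - p - 1)\<close>, i.e. \<^term>\<open>p * (p + 1)\<close>; this is the source of the bound on \<gamma>.\<close>

lemma nn_integral_ipow_det_ball:
  assumes r: "0 < r" and np: "CARD('n) > CARD('p) + 1"
  defines "a \<equiv> (real CARD('n) - real CARD('p) - 1) / 2"
  shows "(\<integral>\<^sup>+M. indicator {M. norm M \<le> r} M * ipow a (det (transpose M ** M)) \<partial>(lborel :: (real^'p^'n) measure))
    = ennreal (r ^ (CARD('p) * (CARD('p) + 1)))
      * (\<integral>\<^sup>+M. indicator {M. norm M \<le> 1} M * ipow a (det (transpose M ** M)) \<partial>(lborel :: (real^'p^'n) measure))"
    (is "?L = _ * ?R")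
proof -
  let ?p = "CARD('p)" and ?n = "CARD('n)"
  have "?L = ennreal (r ^ (?n * ?p)) * (\<integral>\<^sup>+M. indicator {M. norm M \<le> r} (r *\<^sub>R M)
      * ipow a (det (transpose (r *\<^sub>R M) ** (r *\<^sub>R M))) \<partial>(lborel :: (real^'p^'n) measure))"
    using nn_integral_lborel_scale[of "\<lambda>M::real^'p^'n. indicator {M. norm M \<le> r} M * ipow a (det (transpose M ** M))", OF _ r]
    by simp
  also have "(\<integral>\<^sup>+M. indicator {M. norm M \<le> r} (r *\<^sub>R M)
      * ipow a (det (transpose (r *\<^sub>R M) ** (r *\<^sub>R M))) \<partial>(lborel :: (real^'p^'n) measure))
    = (\<integral>\<^sup>+M. ipow a (r ^ (2 * ?p)) * (indicator {M. norm M \<le> 1} M * ipow a (det (transpose M ** M))) \<partial>(lborel :: (real^'p^'n) measure))"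
    using r by (intro nn_integral_cong) (auto simp: det_gram_scaleR ipow_mult det_transpose_mult_self_nonneg indicator_def mult_ac)
  also have "\<dots> = ipow a (r ^ (2 * ?p)) * ?R"
    by (rule nn_integral_cmult) measurable
  also have "ipow a (r ^ (2 * ?p)) = ennreal (r powr (- (real ?p * (real ?n - real ?p - 1))))"
    using r by (simp add: ipow_def a_def powr_realpow[symmetric] powr_powr)
  also have "ennreal (r ^ (?n * ?p)) * (\<dots> * ?R) = ennreal (r ^ (?p * (?p + 1))) * ?R"
  proof -
    have "r ^ (?n * ?p) * r powr (- (real ?p * (real ?n - real ?p - 1))) = r ^ (?p * (?p + 1))"
      using r np by (simp add: powr_realpow[symmetric] powr_add[symmetric] algebra_simps)
    then show ?thesis
      using r by (simp add: ennreal_mult[symmetric] mult.assoc[symmetric])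
  qed
  finally show ?thesis .
qed

text \<open>Stated for balls instead of annuli so that the scaling identity
  \<open>nn_integral_ipow_det_ball\<close> applies directly. For small \<open>t\<close> the
  denominator is at least \<open>1\<close> and the singular power governs; for large
  \<open>t\<close> the singular power is at most \<open>1\<close> and only the decay of order
  \<open>L\<close> counts.\<close>

lemma dyadic_weight_bound:
  fixes t \<gamma> :: real
  assumes t: "0 < t" and \<gamma>: "0 \<le> \<gamma>"
  shows "\<exists>k. (t \<le> (1 / 2) ^ k \<and> t powr (- \<gamma>) / (1 + t) ^ L \<le> (2 powr \<gamma>) ^ (k + 1))
    \<or> (t \<le> 2 ^ k \<and> t powr (- \<gamma>) / (1 + t) ^ L \<le> 2 ^ L * (1 / 2 ^ L) ^ k)"
proof (cases "t \<le> 1")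
  case True
  obtain k where k: "t \<le> (1 / 2) ^ k" "(1 / 2) ^ (k + 1) < t"
  proof -
    obtain m where m: "(1 / 2 :: real) ^ m < t"
      using real_arch_pow_inv[OF t, of "1/2"] by auto
    define K where "K = (LEAST m. (1 / 2 :: real) ^ m < t)"
    have K: "(1 / 2) ^ K < t" unfolding K_def using m by (rule LeastI)
    then have "K \<noteq> 0" using True by (auto intro: Nat.gr0I)
    then obtain k where k: "K = k + 1" by (metis Suc_eq_plus1 not0_implies_Suc)
    then have "\<not> (1 / 2 :: real) ^ k < t"
      using not_less_Least[of k "\<lambda>m. (1 / 2 :: real) ^ m < t"] by (simp add: K_def)
    with K k show thesis by (intro that[of k]) auto
  qed
  have "t powr (- \<gamma>) / (1 + t) ^ L \<le> t powr (- \<gamma>) / 1"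
    using t by (intro divide_left_mono one_le_power) auto
  also have "\<dots> \<le> ((1 / 2) ^ (k + 1)) powr (- \<gamma>)"
    using k(2) t \<gamma> by (simp add: powr_mono2')
  also have "\<dots> = (2 powr \<gamma>) ^ (k + 1)"
  proof -
    have "(1 / 2 :: real) ^ (k + 1) = 2 powr (- real (k + 1))"
      unfolding powr_minus by (subst powr_realpow) (auto simp: power_one_over inverse_eq_divide)
    then have "((1 / 2 :: real) ^ (k + 1)) powr (- \<gamma>) = 2 powr (\<gamma> * real (k + 1))"
      by (simp only: powr_powr) (simp add: algebra_simps)
    then show ?thesis
      by (simp only: powr_realpow[symmetric] powr_powr powr_gt_zero simp_thms)
  qed
  finally show ?thesis using k(1) by auto
next
  case False
  obtain k where k: "t \<le> 2 ^ (k + 1)" "2 ^ k < t"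
  proof -
    obtain m where m: "t \<le> (2 :: real) ^ m"
      using real_arch_pow[of 2 t] by (auto intro: less_imp_le)
    define K where "K = (LEAST m. t \<le> (2 :: real) ^ m)"
    have K: "t \<le> 2 ^ K" unfolding K_def using m by (rule LeastI)
    then have "K \<noteq> 0" using False by (auto intro: Nat.gr0I)
    then obtain k where k: "K = k + 1" by (metis Suc_eq_plus1 not0_implies_Suc)
    then have "\<not> t \<le> (2 :: real) ^ k"
      using not_less_Least[of k "\<lambda>m. t \<le> (2 :: real) ^ m"] by (simp add: K_def)
    with K k show thesis by (intro that[of k]) auto
  qed
  have "t powr (- \<gamma>) \<le> 1"
    using False \<gamma> powr_mono[of "- \<gamma>" 0 t] by simp
  then have "t powr (- \<gamma>) / (1 + t) ^ L \<le> 1 / (1 + t) ^ L"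
    using t by (intro divide_right_mono) auto
  also have "\<dots> \<le> 1 / (2 ^ k) ^ L"
    using k(2) t by (intro divide_left_mono power_mono mult_pos_pos zero_less_power) auto
  \<comment> \<open>The decay comes from the lower end \<open>2 ^ k\<close>, whereas the ball used
    has radius \<open>2 ^ (k + 1)\<close>; the factor \<open>2 ^ L\<close> makes up for this
    shift.\<close>
  also have "\<dots> = 2 ^ L * (1 / 2 ^ L) ^ (k + 1)"
    by (simp add: power_one_over power_mult[symmetric] mult.commute[of k])
  finally show ?thesis using k(1) by blast
qed

text \<open>A ball of radius \<open>r\<close> has mass proportional to \<open>r ^ D\<close>. The
  small balls thus contribute a geometric series of ratio
  \<open>q1 = 2 powr \<gamma> / 2 ^ D\<close>, which converges precisely for
  \<open>\<gamma> < D\<close>. The large balls contribute one of ratio \<open>q2 = 1 / 2\<close>,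
  which is the reason for \<open>L = D + 1\<close>.\<close>

lemma nn_integral_ipow_det_weighted:
  assumes np: "CARD('n) > CARD('p) + 1" and \<gamma>: "0 \<le> \<gamma>" "\<gamma> < real (CARD('p) * (CARD('p) + 1))"
  defines "a \<equiv> (real CARD('n) - real CARD('p) - 1) / 2" and "L \<equiv> CARD('p) * (CARD('p) + 1) + 1"
  shows "(\<integral>\<^sup>+M. ipow a (det (transpose M ** M)) * ennreal (norm M powr (- \<gamma>) / (1 + norm M) ^ L)
    \<partial>(lborel :: (real^'p^'n) measure)) < \<infinity>"
proof -
  define D where "D = CARD('p) * (CARD('p) + 1)"
  let ?W = "\<lambda>M::real^'p^'n. ipow a (det (transpose M ** M))"
  let ?B = "\<lambda>r::real. \<integral>\<^sup>+M. indicator {M. norm M \<le> r} M * ?W M \<partial>lborel"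
  have a: "0 \<le> a" "2 * a + real CARD('p) \<le> real CARD('n)"
    using np by (auto simp: a_def field_simps)
  have B1: "?B 1 < \<infinity>"
    by (rule nn_integral_ipow_det_unit_ball[OF a])
  have B: "?B r = ennreal (r ^ D) * ?B 1" if "0 < r" for r
    using nn_integral_ipow_det_ball[OF that np] unfolding a_def D_def .
  define u where "u k = (2 powr \<gamma>) ^ (k + 1)" for k :: nat
  define v where "v k = (2 ^ L * (1 / 2 ^ L) ^ k :: real)" for k :: nat
  let ?F = "\<lambda>k M. ennreal (u k) * (indicator {M. norm M \<le> (1/2) ^ k} M * ?W M)
      + ennreal (v k) * (indicator {M. norm M \<le> 2 ^ k} M * ?W M)"
  \<comment> \<open>At \<open>M = 0\<close> the weight is zero, since \<open>0 powr a = 0\<close>,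
    and it annihilates the infinite value of \<open>ipow\<close>.\<close>
  have le: "?W M * ennreal (norm M powr (- \<gamma>) / (1 + norm M) ^ L) \<le> (\<Sum>k. ?F k M)" for M
  proof (cases "M = 0")
    case False
    let ?w = "norm M powr (- \<gamma>) / (1 + norm M) ^ L"
    obtain k where k: "(norm M \<le> (1 / 2) ^ k \<and> ?w \<le> u k) \<or> (norm M \<le> 2 ^ k \<and> ?w \<le> v k)"
      using dyadic_weight_bound[of "norm M" \<gamma> L] \<gamma>(1) False unfolding u_def v_def by auto
    have "?W M * ennreal ?w \<le> ?F k M"
      using k
    proof
      assume k: "norm M \<le> (1 / 2) ^ k \<and> ?w \<le> u k"
      then have "?W M * ennreal ?w \<le> ?W M * ennreal (u k)"
        by (intro mult_left_mono ennreal_leI) auto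
      also have "\<dots> = ennreal (u k) * (indicator {M. norm M \<le> (1/2) ^ k} M * ?W M)"
        using k by (simp add: mult.commute)
      finally show ?thesis by (rule order.trans) simp
    next
      assume k: "norm M \<le> 2 ^ k \<and> ?w \<le> v k"
      then have "?W M * ennreal ?w \<le> ?W M * ennreal (v k)"
        by (intro mult_left_mono ennreal_leI) auto
      also have "\<dots> = ennreal (v k) * (indicator {M. norm M \<le> 2 ^ k} M * ?W M)"
        using k by (simp add: mult.commute)
      finally show ?thesis by (rule order.trans) simp
    qed
    also have "?F k M \<le> (\<Sum>k. ?F k M)"
      using sum_le_suminf[of "\<lambda>k. ?F k M" "{k}"] by simp
    finally show ?thesis .
  qed simp
  define q1 where "q1 = 2 powr \<gamma> / 2 ^ D"
  define q2 where "q2 = (2::real) ^ D / 2 ^ L"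
  have q1: "0 \<le> q1" "q1 < 1"
    using powr_less_mono[OF \<gamma>(2)[folded D_def], of 2] by (auto simp: q1_def powr_realpow)
  have q2: "0 \<le> q2" "q2 < 1"
    by (auto simp: q2_def L_def D_def)
  define t where "t k = 2 powr \<gamma> * q1 ^ k + 2 ^ L * q2 ^ k" for k
  have t0: "0 \<le> t k" for k using q1 q2 by (simp add: t_def)
  have "summable t"
    unfolding t_def using q1 q2 by (intro summable_add summable_mult summable_geometric) auto
  then have t_fin: "(\<Sum>k. ennreal (t k)) < \<infinity>"
    by (simp add: suminf_ennreal2 t0 ennreal_less_top)
  have "(\<integral>\<^sup>+M. ?W M * ennreal (norm M powr (- \<gamma>) / (1 + norm M) ^ L) \<partial>lborel) \<le> (\<integral>\<^sup>+M. (\<Sum>k. ?F k M) \<partial>lborel)"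
    by (intro nn_integral_mono le)
  also have "\<dots> = (\<Sum>k. \<integral>\<^sup>+M. ?F k M \<partial>lborel)"
    by (rule nn_integral_suminf) measurable
  also have "\<dots> = (\<Sum>k. ennreal (t k) * ?B 1)"
  proof (rule suminf_cong)
    fix k
    have "(\<integral>\<^sup>+M. ?F k M \<partial>lborel) = ennreal (u k) * ?B ((1/2) ^ k) + ennreal (v k) * ?B (2 ^ k)"
      by (subst nn_integral_add, measurable, subst nn_integral_cmult, measurable, subst nn_integral_cmult, measurable)
    also have "\<dots> = (ennreal (u k * ((1/2) ^ k) ^ D) + ennreal (v k * (2 ^ k) ^ D)) * ?B 1"
      by (subst (1 2) B) (auto simp: ennreal_mult distrib_right mult.assoc u_def v_def)
    also have "ennreal (u k * ((1/2) ^ k) ^ D) + ennreal (v k * (2 ^ k) ^ D) = ennreal (t k)"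
    proof -
      have "u k * ((1/2) ^ k) ^ D = 2 powr \<gamma> * q1 ^ k"
        by (simp add: u_def q1_def power_divide power_mult[symmetric] mult.commute)
      moreover have "v k * (2 ^ k) ^ D = 2 ^ L * q2 ^ k"
        by (simp add: v_def q2_def power_divide power_mult[symmetric] mult.commute)
      ultimately show ?thesis
        using q1 q2 by (simp add: t_def ennreal_plus)
    qed
    finally show "(\<integral>\<^sup>+M. ?F k M \<partial>lborel) = ennreal (t k) * ?B 1" .
  qed
  also have "\<dots> = (\<Sum>k. ennreal (t k)) * ?B 1"
    by (rule ennreal_suminf_multc)
  also have "\<dots> < \<infinity>"
    using t_fin B1 by (simp add: ennreal_mult_less_top)
  finally show ?thesis .
qed

section \<open>Integrability and lower bound for the priors\<close>

lemma pi_svs_eq: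
  "pi_svs M = det (transpose M ** (M :: real^'p^'n)) powr (- ((real CARD('n) - real CARD('p) - 1) / 2))"
  unfolding pi_svs_def by (simp only: minus_divide_left)

lemma pi_svs_measurable [measurable]: "(pi_svs :: real^'p^'n \<Rightarrow> real) \<in> borel_measurable borel"
  unfolding pi_svs_def[abs_def] by measurable

lemma pi_msvs1_measurable [measurable]: "(pi_msvs1 \<gamma> :: real^'p^'n \<Rightarrow> real) \<in> borel_measurable borel"
  unfolding pi_msvs1_def[abs_def] by measurable

lemma pi_msvs1_nonneg: "0 \<le> pi_msvs1 \<gamma> M"
  by (simp add: pi_msvs1_def pi_svs_def)

lemma integrable_pi_msvs1:
  assumes np: "CARD('n) > CARD('p) + 1" and \<gamma>: "0 \<le> \<gamma>" "\<gamma> < real (CARD('p) * (CARD('p) + 1))"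
  shows "integrable lborel (\<lambda>M::real^'p^'n. pi_msvs1 \<gamma> M / (1 + norm M) ^ (CARD('p) * (CARD('p) + 1) + 1))"
proof (rule integrableI_bounded)
  let ?L = "CARD('p) * (CARD('p) + 1) + 1" and ?a = "(real CARD('n) - real CARD('p) - 1) / 2"
  let ?w = "\<lambda>M::real^'p^'n. ennreal (norm M powr (- \<gamma>) / (1 + norm M) ^ ?L)"
  have "(\<integral>\<^sup>+M. ennreal (norm (pi_msvs1 \<gamma> M / (1 + norm M) ^ ?L)) \<partial>(lborel :: (real^'p^'n) measure))
    \<le> (\<integral>\<^sup>+M. ipow ?a (det (transpose M ** M)) * ?w M \<partial>(lborel :: (real^'p^'n) measure))"
  proof (rule nn_integral_mono)
    fix M :: "real^'p^'n"
    have "ennreal (pi_svs M) \<le> ipow ?a (det (transpose M ** M))"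
      by (auto simp: pi_svs_eq ipow_def)
    then have "ennreal (pi_svs M) * ?w M
        \<le> ipow ?a (det (transpose M ** M)) * ?w M"
      by (rule mult_right_mono) simp
    then show "ennreal (norm (pi_msvs1 \<gamma> M / (1 + norm M) ^ ?L))
        \<le> ipow ?a (det (transpose M ** M)) * ?w M"
      by (simp add: pi_msvs1_def pi_svs_def ennreal_mult[symmetric] abs_mult)
  qed
  also have "\<dots> < \<infinity>"
    by (rule nn_integral_ipow_det_weighted[OF np \<gamma>])
  finally show "(\<integral>\<^sup>+M. ennreal (norm (pi_msvs1 \<gamma> M / (1 + norm M) ^ ?L)) \<partial>(lborel :: (real^'p^'n) measure)) < \<infinity>" .
qed measurable

text \<open>A finite integral forces its integrand to be finite almost everywhere. With
  \<open>\<gamma> = 0\<close> the weight is positive off \<open>M = 0\<close>, so the infinite value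
  of \<open>ipow\<close> can occur only on a null set.\<close>

lemma AE_det_gram_nonzero:
  assumes np: "CARD('n) > CARD('p) + 1"
  shows "AE M in (lborel :: (real^'p^'n) measure). det (transpose M ** M) \<noteq> 0"
proof -
  let ?L = "CARD('p) * (CARD('p) + 1) + 1" and ?a = "(real CARD('n) - real CARD('p) - 1) / 2"
  have "AE M in (lborel :: (real^'p^'n) measure).
      ipow ?a (det (transpose M ** M)) * ennreal (norm M powr (- 0) / (1 + norm M) ^ ?L) \<noteq> \<infinity>"
  proof (intro nn_integral_PInf_AE)
    have "0 < real (CARD('p) * (CARD('p) + 1))" by (simp only: of_nat_0_less_iff) simp
    from nn_integral_ipow_det_weighted[OF np order.refl this]
    show "(\<integral>\<^sup>+M. ipow ?a (det (transpose M ** M)) * ennreal (norm M powr (- 0) / (1 + norm M) ^ ?L)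
      \<partial>(lborel :: (real^'p^'n) measure)) \<noteq> \<infinity>"
      by (rule less_imp_neq)
  qed measurable
  moreover have "AE M in (lborel :: (real^'p^'n) measure). M \<noteq> 0"
    by (rule AE_lborel_singleton)
  ultimately show ?thesis
  proof eventually_elim
    case (elim M)
    then have "ennreal (norm M powr (- 0) / (1 + norm M) ^ ?L) \<noteq> 0"
      by (simp add: add_pos_nonneg ennreal_eq_0_iff not_le)
    with elim show ?case by (auto simp: ipow_def ennreal_top_mult)
  qed
qed

text \<open>Each of the \<open>fact CARD('p)\<close> Leibniz terms is a product of
  \<open>CARD('p)\<close> inner products of columns. A crude constant is enough: the bound serves to
  make the prior polynomially bounded below and to see that the determinant vanishes at
  \<open>M = 0\<close>.\<close>

lemma det_gram_le: "det (transpose M ** M) \<le> fact CARD('p) * norm (M :: real^'p^'n) ^ (2 * CARD('p))"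
proof -
  let ?K = "transpose M ** M"
  have K: "\<bar>?K $ i $ j\<bar> \<le> (norm M)\<^sup>2" for i j
  proof -
    have "?K $ i $ j = column i M \<bullet> column j M"
      by (simp add: matrix_matrix_mult_def transpose_def column_def inner_vec_def)
    then have "\<bar>?K $ i $ j\<bar> \<le> norm (column i M) * norm (column j M)"
      using Cauchy_Schwarz_ineq2 by simp
    also have "\<dots> \<le> norm M * norm M"
      by (intro mult_mono norm_column_le) auto
    finally show ?thesis by (simp add: power2_eq_square)
  qed
  have "det ?K \<le> (\<Sum>p | p permutes (UNIV :: 'p set). (norm M)\<^sup>2 ^ CARD('p))"
    unfolding det_def
  proof (rule sum_mono)
    fix p :: "'p \<Rightarrow> 'p"
    have "of_int (sign p) * (\<Prod>i\<in>UNIV. ?K $ i $ p i) \<le> \<bar>of_int (sign p) * (\<Prod>i\<in>UNIV. ?K $ i $ p i)\<bar>"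
      by (rule abs_ge_self)
    also have "\<dots> = (\<Prod>i\<in>UNIV. \<bar>?K $ i $ p i\<bar>)"
      by (simp add: abs_mult abs_prod sign_def)
    also have "\<dots> \<le> (\<Prod>i\<in>(UNIV :: 'p set). (norm M)\<^sup>2)"
      using K by (intro prod_mono) auto
    finally show "of_int (sign p) * (\<Prod>i\<in>UNIV. ?K $ i $ p i) \<le> (norm M)\<^sup>2 ^ CARD('p)" by simp
  qed
  also have "\<dots> = fact CARD('p) * norm M ^ (2 * CARD('p))"
    by (simp add: card_permutations power_mult)
  finally show ?thesis .
qed

text \<open>Negative powers reverse the polynomial upper bounds on the determinant and on the norm.
  Where the determinant is zero the prior takes the value \<open>0\<close> by the convention for
  \<open>powr\<close>, so that null set has to be excluded.\<close>

lemma pi_msvs1_lower_bound: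
  assumes np: "CARD('n) > CARD('p) + 1" and \<gamma>: "0 \<le> \<gamma>"
  obtains c k where "0 < c" "AE M in (lborel :: (real^'p^'n) measure). c / (1 + norm M) ^ k \<le> pi_msvs1 \<gamma> M"
proof -
  let ?a = "(real CARD('n) - real CARD('p) - 1) / 2" and ?F = "fact CARD('p) :: real"
  define k where "k = nat \<lceil>2 * real CARD('p) * ?a + \<gamma>\<rceil>"
  have "AE M in (lborel :: (real^'p^'n) measure). ?F powr (- ?a) / (1 + norm M) ^ k \<le> pi_msvs1 \<gamma> M"
    using AE_det_gram_nonzero[OF np] AE_lborel_singleton[of 0]
  proof eventually_elim
    case (elim M)
    let ?d = "det (transpose M ** M)" and ?t = "1 + norm M"
    have a: "0 \<le> ?a" using np by simp
    have d: "0 < ?d" using elim(1) det_transpose_mult_self_nonneg[of M] by linarith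
    have M: "0 < norm M" using elim(2) by simp
    have "?d \<le> ?F * ?t ^ (2 * CARD('p))"
      by (rule order.trans[OF det_gram_le]) (auto intro!: mult_left_mono power_mono)
    then have "(?F * ?t ^ (2 * CARD('p))) powr (- ?a) \<le> ?d powr (- ?a)"
      using d a by (intro powr_mono2') auto
    moreover have "?t powr (- \<gamma>) \<le> norm M powr (- \<gamma>)"
      using M \<gamma> by (intro powr_mono2') auto
    ultimately have "(?F * ?t ^ (2 * CARD('p))) powr (- ?a) * ?t powr (- \<gamma>) \<le> ?d powr (- ?a) * norm M powr (- \<gamma>)"
      by (intro mult_mono) auto
    moreover have "(?F * ?t ^ (2 * CARD('p))) powr (- ?a) * ?t powr (- \<gamma>)
        = ?F powr (- ?a) * ?t powr (- (2 * real CARD('p) * ?a + \<gamma>))"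
    proof -
      have t: "0 < ?t" by (simp add: add_pos_nonneg)
      have "(?t ^ (2 * CARD('p))) powr (- ?a) = ?t powr (- (2 * real CARD('p) * ?a))"
        using t by (subst powr_realpow[symmetric]) (auto simp: powr_powr)
      then show ?thesis
        using t by (simp add: powr_mult powr_add[symmetric] del: minus_divide_left)
    qed
    moreover have "?t powr (- real k) \<le> ?t powr (- (2 * real CARD('p) * ?a + \<gamma>))"
      using M by (intro powr_mono) (auto simp: k_def, linarith)
    moreover have "?t powr (- real k) = 1 / ?t ^ k"
      by (simp add: powr_minus powr_realpow add_pos_nonneg divide_inverse)
    ultimately have "?F powr (- ?a) * (1 / ?t ^ k) \<le> ?d powr (- ?a) * norm M powr (- \<gamma>)"
      by (smt (verit, best) mult_left_mono powr_ge_zero)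
    then show ?case
      by (simp add: pi_msvs1_def pi_svs_eq)
  qed
  then show thesis by (intro that[of "?F powr (- ?a)" k]) auto
qed

section \<open>Second-order Taylor expansions\<close>

text \<open>Differentiability of \<open>g'\<close> at \<open>a\<close> bounds the derivative of the
  error, \<open>g' (a + s) - g' a - g2 * s\<close>, by \<open>\<eta> * \<bar>s\<bar>\<close> near
  \<open>0\<close>. The mean value bound on the interval of radius \<open>\<bar>t\<bar>\<close>
  supplies the second factor \<open>\<bar>t\<bar>\<close>.\<close>

lemma taylor2_peano:
  fixes g g' :: "real \<Rightarrow> real"
  assumes \<delta>: "\<delta> > 0" "\<And>t. \<bar>t - a\<bar> < \<delta> \<Longrightarrow> (g has_real_derivative g' t) (at t)"
    and g': "(g' has_real_derivative g2) (at a)"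
  shows "(\<lambda>t. g (a + t) - g a - g' a * t - g2 * t\<^sup>2 / 2) \<in> o[nhds 0](\<lambda>t. t\<^sup>2)"
proof -
  have "\<exists>d>0. \<forall>t. \<bar>t\<bar> < d \<longrightarrow> \<bar>g (a + t) - g a - g' a * t - g2 * t\<^sup>2 / 2\<bar> \<le> \<eta> * t\<^sup>2" if \<eta>: "\<eta> > 0" for \<eta>
  proof -
    have "(\<lambda>h. (g' (a + h) - g' a) / h) \<midarrow>0\<rightarrow> g2"
      using g' by (simp add: DERIV_def)
    then obtain d where d: "d > 0" "\<And>h. h \<noteq> 0 \<Longrightarrow> \<bar>h\<bar> < d \<Longrightarrow> \<bar>(g' (a + h) - g' a) / h - g2\<bar> < \<eta>"
      using \<eta> by (auto simp: LIM_def dist_real_def)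
    have bd: "\<bar>g' (a + h) - g' a - g2 * h\<bar> \<le> \<eta> * \<bar>h\<bar>" if "\<bar>h\<bar> < d" for h
    proof (cases "h = 0")
      case False
      then have "g' (a + h) - g' a - g2 * h = ((g' (a + h) - g' a) / h - g2) * h"
        by (simp add: field_simps)
      then show ?thesis
        using mult_right_mono[OF less_imp_le[OF d(2)[OF False that]], of "\<bar>h\<bar>"] by (simp add: abs_mult)
    qed simp
    let ?\<phi> = "\<lambda>s. g (a + s) - g a - g' a * s - g2 * s\<^sup>2 / 2"
    have "\<bar>?\<phi> t\<bar> \<le> \<eta> * t\<^sup>2" if t: "\<bar>t\<bar> < min d \<delta>" for t
    proof -
      have "norm (?\<phi> t - ?\<phi> 0) \<le> (\<eta> * \<bar>t\<bar>) * norm (t - 0)"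
      proof (rule field_differentiable_bound[of "cball 0 \<bar>t\<bar>" ?\<phi> "\<lambda>s. g' (a + s) - g' a - g2 * s"])
        fix s :: real assume s: "s \<in> cball 0 \<bar>t\<bar>"
        have "(g has_real_derivative g' (s + a)) (at (s + a))"
          using \<delta>(2)[of "s + a"] s t by simp
        then have "((\<lambda>s. g (a + s)) has_real_derivative g' (a + s)) (at s)"
          unfolding DERIV_shift by (simp add: add.commute)
        then have "(?\<phi> has_real_derivative g' (a + s) - g' a - g2 * s) (at s)"
          by (auto intro!: derivative_eq_intros)
        then show "(?\<phi> has_real_derivative g' (a + s) - g' a - g2 * s) (at s within cball 0 \<bar>t\<bar>)"
          by (rule has_field_derivative_at_within)
        have "\<bar>g' (a + s) - g' a - g2 * s\<bar> \<le> \<eta> * \<bar>s\<bar>" using bd[of s] s t by simp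
        also have "\<dots> \<le> \<eta> * \<bar>t\<bar>" using s \<eta> by simp
        finally show "norm (g' (a + s) - g' a - g2 * s) \<le> \<eta> * \<bar>t\<bar>" by simp
      qed auto
      then show ?thesis by (simp add: power2_eq_square abs_mult mult.assoc)
    qed
    then show ?thesis using d(1) \<delta>(1) by (intro exI[of _ "min d \<delta>"]) auto
  qed
  then show ?thesis
    unfolding smallo_def eventually_nhds_metric by (simp add: dist_real_def)
qed

lemma powr_taylor2:
  fixes a p :: real
  assumes a: "a > 0"
  shows "(\<lambda>t. (a + t) powr p - a powr p - (p * a powr (p - 1)) * t - (p * (p - 1) * a powr (p - 2)) * t\<^sup>2 / 2)
     \<in> o[nhds 0](\<lambda>t. t\<^sup>2)"
proof (rule taylor2_peano[where g'="\<lambda>t. p * t powr (p - 1)", OF a])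
  show "((\<lambda>t. t powr p) has_real_derivative p * t powr (p - 1)) (at t)" if "\<bar>t - a\<bar> < a" for t
    using that by (intro has_real_derivative_powr) auto
  have "((\<lambda>t. t powr (p - 1)) has_real_derivative (p - 1) * a powr (p - 1 - 1)) (at a)"
    using a by (rule has_real_derivative_powr)
  from DERIV_cmult[OF this, of p]
  show "((\<lambda>t. p * t powr (p - 1)) has_real_derivative p * (p - 1) * a powr (p - 2)) (at a)"
    by (simp add: mult.assoc)
qed

lemma has_taylor2_iff_smallo:
  "has_taylor2 f x v B \<longleftrightarrow> bilinear B \<and> (\<forall>h k. B h k = B k h) \<and>
     (\<lambda>h. f (x + h) - f x - v \<bullet> h - B h h / 2) \<in> o[nhds 0](\<lambda>h. (norm h)\<^sup>2)"
  unfolding has_taylor2_def smallo_def eventually_nhds_metric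
  by (simp add: dist_norm)

lemma has_taylor2_compose:
  fixes f :: "'a::euclidean_space \<Rightarrow> real"
  assumes f: "has_taylor2 f x v B"
    and g: "(\<lambda>t. g (f x + t) - g (f x) - g1 * t - g2 * t\<^sup>2 / 2) \<in> o[nhds 0](\<lambda>t. t\<^sup>2)"
  shows "has_taylor2 (\<lambda>y. g (f y)) x (g1 *\<^sub>R v) (\<lambda>h k. g1 * B h k + g2 * (v \<bullet> h) * (v \<bullet> k))"
proof -
  define r where "r h = f (x + h) - f x - v \<bullet> h - B h h / 2" for h
  define t where "t h = f (x + h) - f x" for h
  have bil: "bilinear B" and sym: "\<And>h k. B h k = B k h" and r: "r \<in> o[nhds 0](\<lambda>h. (norm h)\<^sup>2)"
    using f by (auto simp: has_taylor2_iff_smallo r_def[abs_def])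
  obtain K where K: "K > 0" "\<And>h h'. \<bar>B h h'\<bar> \<le> K * norm h * norm h'"
    using bilinear_bounded_pos[OF bil] by auto
  have nrm0: "(\<lambda>h::'a. norm h) \<in> o[nhds 0](\<lambda>_. 1)"
    by (rule smalloI_tendsto) (auto intro!: tendsto_norm_zero filterlim_ident)
  have sq: "(\<lambda>h::'a. (norm h)\<^sup>2) \<in> O[nhds 0](\<lambda>h. norm h)"
    using landau_o.big_mult[OF landau_o.small_imp_big[OF nrm0] landau_o.big_refl, of "\<lambda>h. norm h"]
    by (simp add: power2_eq_square)
  have lin: "(\<lambda>h. v \<bullet> h) \<in> O[nhds 0](\<lambda>h. norm h)"
    by (rule landau_o.bigI[of "norm v + 1"]) (auto intro!: always_eventually order.trans[OF Cauchy_Schwarz_ineq2] mult_right_mono simp: add_nonneg_pos)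
  have quad: "(\<lambda>h. B h h / 2 + r h) \<in> O[nhds 0](\<lambda>h. (norm h)\<^sup>2)"
  proof (rule sum_in_bigo)
    show "(\<lambda>h. B h h / 2) \<in> O[nhds 0](\<lambda>h. (norm h)\<^sup>2)"
    proof (intro landau_o.bigI[of K] always_eventually allI)
      show "norm (B h h / 2) \<le> K * norm ((norm h)\<^sup>2)" for h
        using K(2)[of h h] K(1) by (simp add: power2_eq_square mult.assoc)
    qed (fact K(1))
  qed (use r in \<open>rule landau_o.small_imp_big\<close>)
  have t_eq: "t h = v \<bullet> h + (B h h / 2 + r h)" for h by (simp add: t_def r_def)
  have tO: "t \<in> O[nhds 0](\<lambda>h. norm h)"
    unfolding t_eq[abs_def] by (intro sum_in_bigo lin landau_o.big_trans[OF quad sq])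
  have t0: "(t \<longlongrightarrow> 0) (nhds 0)"
    using smalloD_tendsto[OF landau_o.big_small_trans[OF tO nrm0]] by simp
  have 1: "(\<lambda>h. g (f x + t h) - g (f x) - g1 * t h - g2 * (t h)\<^sup>2 / 2) \<in> o[nhds 0](\<lambda>h. (norm h)\<^sup>2)"
  proof -
    have "(\<lambda>h. g (f x + t h) - g (f x) - g1 * t h - g2 * (t h)\<^sup>2 / 2) \<in> o[nhds 0](\<lambda>h. (t h)\<^sup>2)"
      using landau_o.small.compose[OF g t0] .
    also have "(\<lambda>h. (t h)\<^sup>2) \<in> O[nhds 0](\<lambda>h. (norm h)\<^sup>2)"
      using landau_o.big_mult[OF tO tO] by (simp add: power2_eq_square)
    finally show ?thesis .
  qed
  \<comment> \<open>This term replaces \<open>(t h)\<^sup>2\<close> by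
    \<open>(v \<bullet> h)\<^sup>2\<close>: their difference factors as
    \<open>(t h - v \<bullet> h) * (t h + v \<bullet> h)\<close>, a quadratic quantity times a
    vanishing one.\<close>
  have 2: "(\<lambda>h. g2 / 2 * ((B h h / 2 + r h) * (t h + v \<bullet> h))) \<in> o[nhds 0](\<lambda>h. (norm h)\<^sup>2)"
  proof -
    have "(\<lambda>h. t h + v \<bullet> h) \<in> o[nhds 0](\<lambda>_. 1)"
      by (rule landau_o.big_small_trans[OF _ nrm0]) (intro sum_in_bigo tO lin)
    from landau_o.big_small_mult[OF quad this]
    have "(\<lambda>h. (B h h / 2 + r h) * (t h + v \<bullet> h)) \<in> o[nhds 0](\<lambda>h. (norm h)\<^sup>2)" by simp
    then show ?thesis by (cases "g2 = 0") simp_all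
  qed
  have 3: "(\<lambda>h. g1 * r h) \<in> o[nhds 0](\<lambda>h. (norm h)\<^sup>2)"
    using r by (cases "g1 = 0") simp_all
  have "(\<lambda>h. (g (f x + t h) - g (f x) - g1 * t h - g2 * (t h)\<^sup>2 / 2) + g2 / 2 * ((B h h / 2 + r h) * (t h + v \<bullet> h)) + g1 * r h)
     \<in> o[nhds 0](\<lambda>h. (norm h)\<^sup>2)"
    by (intro sum_in_smallo 1 2 3)
  also have "(\<lambda>h. (g (f x + t h) - g (f x) - g1 * t h - g2 * (t h)\<^sup>2 / 2) + g2 / 2 * ((B h h / 2 + r h) * (t h + v \<bullet> h)) + g1 * r h)
    = (\<lambda>h. g (f (x + h)) - g (f x) - (g1 *\<^sub>R v) \<bullet> h - (g1 * B h h + g2 * (v \<bullet> h) * (v \<bullet> h)) / 2)"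
  proof
    fix h
    have fx: "f (x + h) = f x + t h" by (simp add: t_def)
    show "(g (f x + t h) - g (f x) - g1 * t h - g2 * (t h)\<^sup>2 / 2) + g2 / 2 * ((B h h / 2 + r h) * (t h + v \<bullet> h)) + g1 * r h
      = g (f (x + h)) - g (f x) - (g1 *\<^sub>R v) \<bullet> h - (g1 * B h h + g2 * (v \<bullet> h) * (v \<bullet> h)) / 2"
      unfolding fx by (simp add: t_eq) (simp add: field_simps power2_eq_square)
  qed
  finally have R: "(\<lambda>h. g (f (x + h)) - g (f x) - (g1 *\<^sub>R v) \<bullet> h - (g1 * B h h + g2 * (v \<bullet> h) * (v \<bullet> h)) / 2)
    \<in> o[nhds 0](\<lambda>h. (norm h)\<^sup>2)" .
  have "bilinear (\<lambda>h k. g1 * B h k + g2 * (v \<bullet> h) * (v \<bullet> k))"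
    using bil unfolding bilinear_def
    by (auto simp: linear_iff inner_add_right algebra_simps)
  with R sym show ?thesis
    unfolding has_taylor2_iff_smallo by (auto simp: mult_ac)
qed

lemma has_taylor2_const: "has_taylor2 (\<lambda>_. c) x 0 (\<lambda>_ _. 0)"
  by (auto simp: has_taylor2_iff_smallo bilinear_def linear_iff)

lemma has_taylor2_inner: "has_taylor2 (\<lambda>y. y \<bullet> e) x e (\<lambda>_ _. 0)"
  by (auto simp: has_taylor2_iff_smallo bilinear_def linear_iff inner_add_left inner_commute[of e])

lemma has_taylor2_inner_self: "has_taylor2 (\<lambda>y. y \<bullet> y) x (2 *\<^sub>R x) (\<lambda>h k. 2 * (h \<bullet> k))"
proof -
  have "(x + h) \<bullet> (x + h) - x \<bullet> x - (2 *\<^sub>R x) \<bullet> h - 2 * (h \<bullet> h) / 2 = 0" for h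
    by (simp add: inner_add_left inner_add_right inner_commute)
  then show ?thesis
    unfolding has_taylor2_iff_smallo
    by (auto simp: bilinear_def linear_iff inner_add_left inner_add_right inner_commute algebra_simps)
qed

lemma has_taylor2_add:
  assumes "has_taylor2 f x v B" "has_taylor2 g x w C"
  shows "has_taylor2 (\<lambda>y. f y + g y) x (v + w) (\<lambda>h k. B h k + C h k)"
proof -
  have "(\<lambda>h. (f (x + h) - f x - v \<bullet> h - B h h / 2) + (g (x + h) - g x - w \<bullet> h - C h h / 2)) \<in> o[nhds 0](\<lambda>h. (norm h)\<^sup>2)"
    by (rule sum_in_smallo(1)) (use assms in \<open>auto simp: has_taylor2_iff_smallo\<close>)
  also have "(\<lambda>h. (f (x + h) - f x - v \<bullet> h - B h h / 2) + (g (x + h) - g x - w \<bullet> h - C h h / 2))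
     = (\<lambda>h. f (x + h) + g (x + h) - (f x + g x) - (v + w) \<bullet> h - (B h h + C h h) / 2)"
    by (auto simp: inner_add_left field_simps)
  finally show ?thesis
    using assms unfolding has_taylor2_iff_smallo
    by (auto simp: bilinear_def linear_iff algebra_simps)
qed

lemma has_taylor2_scale:
  assumes "has_taylor2 f x v B"
  shows "has_taylor2 (\<lambda>y. c * f y) x (c *\<^sub>R v) (\<lambda>h k. c * B h k)"
  using has_taylor2_compose[OF assms, of "\<lambda>t. c * t" c 0] by (simp add: algebra_simps)

text \<open>Polarisation, \<open>f * g = ((f + g)\<^sup>2 - (f - g)\<^sup>2) / 4\<close>, reduces
  products to the chain rule for squaring.\<close>

lemma has_taylor2_mult:
  assumes f: "has_taylor2 f x v B" and g: "has_taylor2 g x w C"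
  shows "has_taylor2 (\<lambda>y. f y * g y) x (f x *\<^sub>R w + g x *\<^sub>R v)
    (\<lambda>h k. f x * C h k + g x * B h k + (v \<bullet> h) * (w \<bullet> k) + (w \<bullet> h) * (v \<bullet> k))"
proof -
  have square: "has_taylor2 (\<lambda>y. (u y)\<^sup>2) x ((2 * u x) *\<^sub>R v) (\<lambda>h k. 2 * u x * B h k + 2 * (v \<bullet> h) * (v \<bullet> k))"
    if "has_taylor2 u x v B" for u v B
    using has_taylor2_compose[OF that, of "\<lambda>t. t\<^sup>2" "2 * u x" 2]
    by (simp add: power2_eq_square algebra_simps)
  have "has_taylor2 (\<lambda>y. 1 / 4 * (f y + g y)\<^sup>2 + (- 1 / 4) * (f y + (- 1) * g y)\<^sup>2) x
    ((1 / 4) *\<^sub>R ((2 * (f x + g x)) *\<^sub>R (v + w)) + (- 1 / 4) *\<^sub>R ((2 * (f x + (- 1) * g x)) *\<^sub>R (v + (- 1) *\<^sub>R w)))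
    (\<lambda>h k. 1 / 4 * (2 * (f x + g x) * (B h k + C h k) + 2 * ((v + w) \<bullet> h) * ((v + w) \<bullet> k))
      + (- 1 / 4) * (2 * (f x + (- 1) * g x) * (B h k + (- 1) * C h k)
          + 2 * ((v + (- 1) *\<^sub>R w) \<bullet> h) * ((v + (- 1) *\<^sub>R w) \<bullet> k)))"
    by (intro has_taylor2_add has_taylor2_scale square f g)
  moreover have "(\<lambda>y. 1 / 4 * (f y + g y)\<^sup>2 + (- 1 / 4) * (f y + (- 1) * g y)\<^sup>2) = (\<lambda>y. f y * g y)"
    by (auto simp: power2_eq_square field_simps)
  moreover have "(1 / 4) *\<^sub>R ((2 * (f x + g x)) *\<^sub>R (v + w)) + (- 1 / 4) *\<^sub>R ((2 * (f x + (- 1) * g x)) *\<^sub>R (v + (- 1) *\<^sub>R w))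
     = f x *\<^sub>R w + g x *\<^sub>R v"
    by (rule euclidean_eqI) (simp add: inner_add_left inner_diff_left field_simps)
  moreover have "(\<lambda>h k. 1 / 4 * (2 * (f x + g x) * (B h k + C h k) + 2 * ((v + w) \<bullet> h) * ((v + w) \<bullet> k))
      + (- 1 / 4) * (2 * (f x + (- 1) * g x) * (B h k + (- 1) * C h k)
          + 2 * ((v + (- 1) *\<^sub>R w) \<bullet> h) * ((v + (- 1) *\<^sub>R w) \<bullet> k)))
     = (\<lambda>h k. f x * C h k + g x * B h k + (v \<bullet> h) * (w \<bullet> k) + (w \<bullet> h) * (v \<bullet> k))"
    by (intro ext) (simp add: inner_add_left inner_diff_left field_simps)
  ultimately show ?thesis by simp
qed

lemma has_taylor2_sum:
  "(\<And>i. i \<in> I \<Longrightarrow> \<exists>v B. has_taylor2 (f i) x v B) \<Longrightarrow> \<exists>v B. has_taylor2 (\<lambda>y. \<Sum>i\<in>I. f i y) x v B"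
proof (induction I rule: infinite_finite_induct)
  case (insert i I)
  then obtain v B v' B' where "has_taylor2 (f i) x v B" "has_taylor2 (\<lambda>y. \<Sum>i\<in>I. f i y) x v' B'"
    by blast
  from has_taylor2_add[OF this] insert.hyps show ?case by auto
qed (auto intro: has_taylor2_const)

lemma has_taylor2_prod:
  "(\<And>i. i \<in> I \<Longrightarrow> \<exists>v B. has_taylor2 (f i) x v B) \<Longrightarrow> \<exists>v B. has_taylor2 (\<lambda>y. \<Prod>i\<in>I. f i y) x v B"
proof (induction I rule: infinite_finite_induct)
  case (insert i I)
  then obtain v B v' B' where "has_taylor2 (f i) x v B" "has_taylor2 (\<lambda>y. \<Prod>i\<in>I. f i y) x v' B'"
    by blast
  from has_taylor2_mult[OF this] insert.hyps show ?case by auto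
qed (auto intro: has_taylor2_const)

lemma has_taylor2_powr:
  assumes "has_taylor2 f x v B" "f x > 0"
  shows "has_taylor2 (\<lambda>y. f y powr p) x ((p * f x powr (p - 1)) *\<^sub>R v)
    (\<lambda>h k. p * f x powr (p - 1) * B h k + p * (p - 1) * f x powr (p - 2) * (v \<bullet> h) * (v \<bullet> k))"
  using has_taylor2_compose[OF assms(1), of "\<lambda>t. t powr p" "p * f x powr (p - 1)" "p * (p - 1) * f x powr (p - 2)"]
    powr_taylor2[OF assms(2), of p] by simp

lemma has_taylor2_norm_powr:
  fixes x :: "'a::euclidean_space" and \<gamma> :: real
  assumes x: "x \<noteq> 0"
  defines "\<phi> \<equiv> norm x powr (- \<gamma>)" and "t \<equiv> x \<bullet> x"
  shows "has_taylor2 (\<lambda>y. norm y powr (- \<gamma>)) x ((- \<gamma> * \<phi> / t) *\<^sub>R x)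
    (\<lambda>h k. \<phi> * (- \<gamma> / t * (h \<bullet> k) + \<gamma> * (\<gamma> + 2) / t\<^sup>2 * (x \<bullet> h) * (x \<bullet> k)))"
proof -
  have t: "t > 0" using x by (simp add: t_def)
  have eq: "norm y powr (- \<gamma>) = (y \<bullet> y) powr (- \<gamma> / 2)" for y :: 'a
    by (simp add: norm_eq_sqrt_inner powr_half_sqrt[symmetric] powr_powr)
  have \<phi>: "t powr (- \<gamma> / 2) = \<phi>" by (simp add: \<phi>_def eq t_def)
  have p1: "t powr (- \<gamma> / 2 - 1) = \<phi> / t" and p2: "t powr (- \<gamma> / 2 - 2) = \<phi> / t\<^sup>2"
    unfolding powr_diff \<phi> using t by (simp_all add: powr_numeral)
  have "has_taylor2 (\<lambda>y. (y \<bullet> y) powr (- \<gamma> / 2)) x ((- \<gamma> / 2 * (\<phi> / t)) *\<^sub>R (2 *\<^sub>R x))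
    (\<lambda>h k. - \<gamma> / 2 * (\<phi> / t) * (2 * (h \<bullet> k)) + - \<gamma> / 2 * (- \<gamma> / 2 - 1) * (\<phi> / t\<^sup>2) * ((2 *\<^sub>R x) \<bullet> h) * ((2 *\<^sub>R x) \<bullet> k))"
    using has_taylor2_powr[OF has_taylor2_inner_self[of x], of "- \<gamma> / 2"] t unfolding t_def[symmetric] p1 p2 by simp
  moreover have "(- \<gamma> / 2 * (\<phi> / t)) *\<^sub>R (2 *\<^sub>R x) = (- \<gamma> * \<phi> / t) *\<^sub>R x"
    by simp
  moreover have "(\<lambda>h k. - \<gamma> / 2 * (\<phi> / t) * (2 * (h \<bullet> k)) + - \<gamma> / 2 * (- \<gamma> / 2 - 1) * (\<phi> / t\<^sup>2) * ((2 *\<^sub>R x) \<bullet> h) * ((2 *\<^sub>R x) \<bullet> k))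
     = (\<lambda>h k. \<phi> * (- \<gamma> / t * (h \<bullet> k) + \<gamma> * (\<gamma> + 2) / t\<^sup>2 * (x \<bullet> h) * (x \<bullet> k)))"
    using t by (intro ext) (simp add: field_simps power2_eq_square)
  ultimately show ?thesis unfolding eq by simp
qed

text \<open>Lets the gradient \<open>v\<close> be read off from derivatives along lines, as is done
  for \<open>pi_svs\<close>.\<close>

lemma has_taylor2_imp_has_derivative:
  assumes "has_taylor2 f x v B"
  shows "(f has_derivative (\<lambda>h. v \<bullet> h)) (at x)"
  unfolding has_derivative_at
proof
  show "bounded_linear ((\<bullet>) v)" by (rule bounded_linear_inner_right)
  have bil: "bilinear B" and r: "\<And>\<eta>. \<eta> > 0 \<Longrightarrow> \<exists>\<epsilon>>0. \<forall>h. norm h < \<epsilon> \<longrightarrow>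
        \<bar>f (x + h) - f x - v \<bullet> h - B h h / 2\<bar> \<le> \<eta> * (norm h)\<^sup>2"
    using assms by (auto simp: has_taylor2_def)
  obtain K where K: "K > 0" "\<And>h h'. \<bar>B h h'\<bar> \<le> K * norm h * norm h'"
    using bilinear_bounded_pos[OF bil] by auto
  obtain \<epsilon> where \<epsilon>: "\<epsilon> > 0" "\<And>h. norm h < \<epsilon> \<Longrightarrow> \<bar>f (x + h) - f x - v \<bullet> h - B h h / 2\<bar> \<le> 1 * (norm h)\<^sup>2"
    using r[of 1] by auto
  have bd: "norm (f (x + h) - f x - v \<bullet> h) / norm h \<le> (1 + K) * norm h" if "norm h < \<epsilon>" for h
  proof (cases "h = 0")
    case False
    have "\<bar>f (x + h) - f x - v \<bullet> h\<bar> \<le> (1 + K) * norm h * norm h"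
      using \<epsilon>(2)[OF that] K(2)[of h h] by (simp add: power2_eq_square algebra_simps)
    with False show ?thesis by (simp add: divide_le_eq)
  qed simp
  show "(\<lambda>h. norm (f (x + h) - f x - v \<bullet> h) / norm h) \<midarrow>0\<rightarrow> 0"
  proof (rule Lim_null_comparison)
    show "\<forall>\<^sub>F h in at 0. norm (norm (f (x + h) - f x - v \<bullet> h) / norm h) \<le> (1 + K) * norm h"
      unfolding eventually_at using \<epsilon>(1) bd by (intro exI[of _ \<epsilon>]) (auto simp: dist_norm)
    show "(\<lambda>h. (1 + K) * norm h) \<midarrow>0\<rightarrow> 0"
      by (auto intro!: tendsto_eq_intros)
  qed
qed

text \<open>The Gram determinant is a polynomial in the entries and is positive at \<open>M\<close>,
  so closure under sums, products and powers suffices. The coefficients stay existential, which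
  avoids differentiating the Leibniz sum explicitly.\<close>

lemma has_taylor2_pi_svs:
  fixes M :: "real^'p^'n"
  assumes "det (transpose M ** M) \<noteq> 0"
  shows "\<exists>v B. has_taylor2 pi_svs M v B"
proof -
  have comp: "\<exists>v B. has_taylor2 (\<lambda>Y::real^'p^'n. Y $ a $ i) M v B" for a i
    using has_taylor2_inner[of "axis a (axis i 1)" M] by auto
  have "\<exists>v B. has_taylor2 (\<lambda>Y::real^'p^'n. det (transpose Y ** Y)) M v B"
    unfolding det_def
  proof (rule has_taylor2_sum)
    fix p :: "'p \<Rightarrow> 'p"
    have "\<exists>v B. has_taylor2 (\<lambda>Y::real^'p^'n. \<Prod>i\<in>UNIV. (transpose Y ** Y) $ i $ p i) M v B"
    proof (rule has_taylor2_prod)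
      fix i
      have "\<exists>v B. has_taylor2 (\<lambda>Y::real^'p^'n. \<Sum>a\<in>UNIV. Y $ a $ i * Y $ a $ p i) M v B"
      proof (rule has_taylor2_sum)
        fix a
        obtain v B v' B' where "has_taylor2 (\<lambda>Y::real^'p^'n. Y $ a $ i) M v B"
          "has_taylor2 (\<lambda>Y::real^'p^'n. Y $ a $ p i) M v' B'"
          using comp by blast
        from has_taylor2_mult[OF this] show "\<exists>v B. has_taylor2 (\<lambda>Y::real^'p^'n. Y $ a $ i * Y $ a $ p i) M v B"
          by blast
      qed
      then show "\<exists>v B. has_taylor2 (\<lambda>Y::real^'p^'n. (transpose Y ** Y) $ i $ p i) M v B"
        by (simp add: matrix_matrix_mult_def transpose_def)
    qed
    then obtain v B where "has_taylor2 (\<lambda>Y::real^'p^'n. \<Prod>i\<in>UNIV. (transpose Y ** Y) $ i $ p i) M v B"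
      by blast
    from has_taylor2_scale[OF this]
    show "\<exists>v B. has_taylor2 (\<lambda>Y::real^'p^'n. of_int (sign p) * (\<Prod>i\<in>UNIV. (transpose Y ** Y) $ i $ p i)) M v B"
      by blast
  qed
  then obtain v B where "has_taylor2 (\<lambda>Y::real^'p^'n. det (transpose Y ** Y)) M v B"
    by blast
  moreover have "0 < det (transpose M ** M)"
    using assms det_transpose_mult_self_nonneg[of M] by linarith
  ultimately show ?thesis
    unfolding pi_svs_eq[abs_def] using has_taylor2_powr by blast
qed

text \<open>The logarithmic derivative of \<^const>\<open>pi_svs\<close> in the direction \<open>M ** E\<close>, for an elementary matrix \<open>E\<close>,
  comes from multiplicativity of the determinant: \<open>det ((M ** A)\<^sup>T ** (M ** A)) = (det A)\<^sup>2 * det (M\<^sup>T ** M)\<close>.\<close>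

lemma pi_svs_gradient_columns:
  fixes M :: "real^'p^'n"
  assumes d: "det (transpose M ** M) \<noteq> 0" and v: "has_taylor2 pi_svs M v B"
  shows "(\<Sum>a\<in>UNIV. v $ a $ i * M $ a $ j)
    = (if i = j then - (real CARD('n) - real CARD('p) - 1) * pi_svs M else 0)"
proof -
  let ?\<delta> = "if i = j then 1 else 0 :: real"
  define \<alpha> where "\<alpha> = (real CARD('n) - real CARD('p) - 1) / 2"
  \<comment> \<open>\<open>A \<tau>\<close> is the identity plus \<open>\<tau>\<close> times an
    elementary matrix, and \<open>D\<close> is the direction in which \<open>M ** A \<tau>\<close>
    leaves \<open>M\<close>: column \<open>j\<close> of \<open>M\<close> placed in column
    \<open>i\<close>. Its inner product with \<open>v\<close> is the sum in question.\<close>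
  define D :: "real^'p^'n" where "D = (\<chi> a l. if l = i then M $ a $ j else 0)"
  define A :: "real \<Rightarrow> real^'p^'p" where "A \<tau> = (\<chi> k l. (if k = l then 1 else 0) + (if k = j \<and> l = i then \<tau> else 0))" for \<tau>
  have MA: "M + \<tau> *\<^sub>R D = M ** A \<tau>" for \<tau>
  proof -
    have "(\<Sum>k\<in>UNIV. M $ a $ k * A \<tau> $ k $ l) = M $ a $ l + (if l = i then \<tau> * M $ a $ j else 0)" for a l
    proof -
      have "(\<Sum>k\<in>UNIV. M $ a $ k * A \<tau> $ k $ l)
        = (\<Sum>k\<in>UNIV. (if k = l then M $ a $ k else 0) + (if k = j then (if l = i then \<tau> * M $ a $ k else 0) else 0))"
        by (intro sum.cong) (auto simp: A_def algebra_simps)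
      then show ?thesis by (simp add: sum.distrib)
    qed
    then show ?thesis
      by (simp add: vec_eq_iff matrix_matrix_mult_def D_def)
  qed
  \<comment> \<open>For \<open>i \<noteq> j\<close> this is a shear of determinant \<open>1\<close>:
    the prior is constant along the line, which yields the zero off-diagonal entries.\<close>
  have detA: "det (A \<tau>) = 1 + \<tau> * ?\<delta>" for \<tau>
  proof (cases "i = j")
    case True
    have "det (A \<tau>) = (\<Prod>k\<in>UNIV. A \<tau> $ k $ k)"
      using True by (intro det_diagonal) (auto simp: A_def)
    also have "\<dots> = (\<Prod>k\<in>UNIV. if k = j then 1 + \<tau> else 1)"
      using True by (intro prod.cong) (auto simp: A_def)
    finally show ?thesis using True by simp
  next
    case False
    have "A \<tau> = (\<chi> k. if k = j then row j (mat 1) + \<tau> *s row i (mat 1) else row k (mat 1))"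
      using False by (auto simp: vec_eq_iff A_def row_def mat_def)
    then show ?thesis using det_row_operation[of j i "mat 1 :: real^'p^'p" \<tau>] False by simp
  qed
  have pos: "0 < det (transpose M ** M)"
    using d det_transpose_mult_self_nonneg[of M] by linarith
  have eq: "pi_svs (M + \<tau> *\<^sub>R D) = ((1 + \<tau> * ?\<delta>)\<^sup>2 * det (transpose M ** M)) powr (- \<alpha>)" for \<tau>
  proof -
    have "transpose (M ** A \<tau>) ** (M ** A \<tau>) = transpose (A \<tau>) ** ((transpose M ** M) ** A \<tau>)"
      by (simp add: matrix_transpose_mul matrix_mul_assoc)
    then show ?thesis
      by (simp only: MA pi_svs_eq \<alpha>_def det_mul det_transpose detA) (simp add: power2_eq_square mult_ac)
  qed
  have 1: "((\<lambda>\<tau>. pi_svs (M + \<tau> *\<^sub>R D)) has_real_derivative v \<bullet> D) (at 0)"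
  proof -
    have "((\<lambda>\<tau>::real. M + \<tau> *\<^sub>R D) has_derivative (\<lambda>\<tau>. \<tau> *\<^sub>R D)) (at 0)"
      by (auto intro!: derivative_eq_intros)
    moreover have "(pi_svs has_derivative (\<lambda>h. v \<bullet> h)) (at (M + 0 *\<^sub>R D))"
      using has_taylor2_imp_has_derivative[OF v] by simp
    ultimately have "((\<lambda>\<tau>. pi_svs (M + \<tau> *\<^sub>R D)) has_derivative (\<lambda>\<tau>. v \<bullet> (\<tau> *\<^sub>R D))) (at 0)"
      by (rule has_derivative_compose)
    then show ?thesis
      unfolding has_field_derivative_def by (simp add: mult.commute[of _ "v \<bullet> D"] fun_eq_iff)
  qed
  have 2: "((\<lambda>\<tau>. pi_svs (M + \<tau> *\<^sub>R D)) has_real_derivative - (2 * \<alpha>) * ?\<delta> * pi_svs M) (at 0)"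
  proof -
    have "((\<lambda>\<tau>. ((1 + \<tau> * ?\<delta>)\<^sup>2 * det (transpose M ** M)) powr (- \<alpha>)) has_real_derivative
        (- \<alpha>) * det (transpose M ** M) powr (- \<alpha> - 1) * (2 * ?\<delta> * det (transpose M ** M))) (at 0)"
      using pos by (auto intro!: derivative_eq_intros)
    moreover have "det (transpose M ** M) powr (- \<alpha> - 1) = pi_svs M / det (transpose M ** M)"
      using pos by (simp add: powr_diff pi_svs_eq \<alpha>_def)
    ultimately show ?thesis unfolding eq using pos by (simp add: mult_ac)
  qed
  have "(\<Sum>a\<in>UNIV. v $ a $ i * M $ a $ j) = v \<bullet> D"
    by (simp add: inner_vec_def D_def if_distrib cong: if_cong)
  also have "\<dots> = - (2 * \<alpha>) * ?\<delta> * pi_svs M"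
    using DERIV_unique[OF 1 2] .
  finally show ?thesis by (cases "i = j") (simp_all add: \<alpha>_def field_simps)
qed

section \<open>The matrix quadratic risk\<close>

lemma lik_eq_gauss_dens:
  fixes M Y :: "real^'p^'n"
  assumes N: "N > 0"
  shows "lik N M Y = sqrt N ^ DIM(real^'p^'n) * gauss_dens (sqrt N *\<^sub>R (Y - M))"
proof -
  have "normal_density \<mu> (sqrt (1 / N)) y = sqrt N * std_normal_density (sqrt N * (y - \<mu>))" for \<mu> y
  proof -
    have "- (y - \<mu>)\<^sup>2 / (2 * (sqrt (1 / N))\<^sup>2) = - (sqrt N * (y - \<mu>))\<^sup>2 / 2"
      using N by (simp add: power_mult_distrib)
    moreover have "1 / sqrt (2 * pi * (sqrt (1 / N))\<^sup>2) = sqrt N * (1 / sqrt (2 * pi))"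
      using N by (simp add: real_sqrt_mult real_sqrt_divide)
    ultimately show ?thesis
      unfolding std_normal_density_def normal_density_def[of \<mu>] by (simp only: mult.assoc)
  qed
  then have "lik N M Y = (\<Prod>b\<in>Basis. sqrt N * std_normal_density (sqrt N * ((Y - M) \<bullet> b)))"
    unfolding lik_def prod_Basis_matrix by simp
  also have "\<dots> = sqrt N ^ DIM(real^'p^'n) * gauss_dens (sqrt N *\<^sub>R (Y - M))"
    unfolding prod.distrib gauss_dens_def by simp
  finally show ?thesis .
qed

text \<open>Symmetry in parameter and observation lets the one substitution
  \<open>integral_lik\<close> serve both the posterior integrals and the sampling
  expectation.\<close>

lemma lik_commute: "N > 0 \<Longrightarrow> lik N M Y = lik N Y M"
  using gauss_dens_minus[of "sqrt N *\<^sub>R (Y - M)"] by (simp add: lik_eq_gauss_dens algebra_simps)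

lemma matrix_entry_measurable:
  fixes f :: "'b \<Rightarrow> real^'p^'n"
  assumes "f \<in> borel_measurable S"
  shows "(\<lambda>x. f x $ a $ i) \<in> borel_measurable S"
  using borel_measurable_inner[OF assms borel_measurable_const[of "axis a (axis i 1)"]] by simp

lemma lik_measurable [measurable (raw)]:
  fixes f g :: "'b \<Rightarrow> real^'p^'n"
  assumes f: "f \<in> borel_measurable S" and g: "g \<in> borel_measurable S"
  shows "(\<lambda>x. lik N (f x) (g x)) \<in> borel_measurable S"
proof -
  note [measurable] = matrix_entry_measurable[OF f] matrix_entry_measurable[OF g]
  show ?thesis unfolding lik_def normal_density_def by measurable
qed

lemma lik_nonneg: "0 \<le> lik N M Y"
  by (simp add: lik_def prod_nonneg)

lemma
  fixes f :: "real^'p^'n \<Rightarrow> real"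
  assumes N: "N > 0" and [measurable]: "f \<in> borel_measurable borel"
  shows integral_lik: "(\<integral>\<theta>. lik N \<theta> Y * f \<theta> \<partial>lborel) = (\<integral>w. f (Y + (1 / sqrt N) *\<^sub>R w) \<partial>gauss)"
    and integrable_lik: "integrable lborel (\<lambda>\<theta>. lik N \<theta> Y * f \<theta>) \<longleftrightarrow> integrable gauss (\<lambda>w. f (Y + (1 / sqrt N) *\<^sub>R w))"
proof -
  let ?s = "1 / sqrt N" and ?d = "DIM(real^'p^'n)"
  have s: "?s > 0" using N by simp
  have eq: "lik N (Y + ?s *\<^sub>R w) Y = sqrt N ^ ?d * gauss_dens w" for w
    using N by (simp add: lik_eq_gauss_dens)
  have 1: "?s ^ ?d * sqrt N ^ ?d = 1"
    using N by (simp add: power_mult_distrib[symmetric] del: DIM_cart)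
  have "(\<integral>\<theta>. lik N \<theta> Y * f \<theta> \<partial>lborel) = ?s ^ ?d * (\<integral>w. sqrt N ^ ?d * (gauss_dens w * f (Y + ?s *\<^sub>R w)) \<partial>lborel)"
    by (subst integral_lborel_affine[OF _ s, of _ Y]) (simp_all only: eq mult.assoc, measurable)
  also have "\<dots> = (?s ^ ?d * sqrt N ^ ?d) * (\<integral>w. gauss_dens w * f (Y + ?s *\<^sub>R w) \<partial>lborel)"
    by (simp only: integral_mult_right_zero mult.assoc)
  also have "\<dots> = (\<integral>w. f (Y + ?s *\<^sub>R w) \<partial>gauss)"
    unfolding 1 by (subst integral_gauss) auto
  finally show "(\<integral>\<theta>. lik N \<theta> Y * f \<theta> \<partial>lborel) = (\<integral>w. f (Y + ?s *\<^sub>R w) \<partial>gauss)" .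
  have "integrable lborel (\<lambda>\<theta>. lik N \<theta> Y * f \<theta>)
      \<longleftrightarrow> integrable lborel (\<lambda>w. lik N (Y + ?s *\<^sub>R w) Y * f (Y + ?s *\<^sub>R w))"
    by (subst integrable_lborel_affine[OF _ s, of "\<lambda>\<theta>. lik N \<theta> Y * f \<theta>"]) measurable
  also have "\<dots> \<longleftrightarrow> integrable lborel (\<lambda>w. sqrt N ^ ?d * (gauss_dens w * f (Y + ?s *\<^sub>R w)))"
    by (simp only: eq mult.assoc)
  also have "\<dots> \<longleftrightarrow> integrable lborel (\<lambda>w. gauss_dens w * f (Y + ?s *\<^sub>R w))"
    using N by (subst integrable_mult_left_iff) auto
  also have "\<dots> \<longleftrightarrow> integrable gauss (\<lambda>w. f (Y + ?s *\<^sub>R w))"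
    by (subst integrable_gauss) auto
  finally show "integrable lborel (\<lambda>\<theta>. lik N \<theta> Y * f \<theta>) \<longleftrightarrow> integrable gauss (\<lambda>w. f (Y + ?s *\<^sub>R w))" .
qed

lemma
  fixes f :: "real^'p^'n \<Rightarrow> real"
  assumes N: "N > 0" and [measurable]: "f \<in> borel_measurable borel"
  shows integral_obs_dist: "(\<integral>Y. f Y \<partial>obs_dist N M) = (\<integral>z. f (M + (1 / sqrt N) *\<^sub>R z) \<partial>gauss)"
    and integrable_obs_dist: "integrable (obs_dist N M) f \<longleftrightarrow> integrable gauss (\<lambda>z. f (M + (1 / sqrt N) *\<^sub>R z))"
proof -
  have "(\<integral>Y. f Y \<partial>obs_dist N M) = (\<integral>Y. lik N M Y * f Y \<partial>lborel)"
    unfolding obs_dist_def by (subst integral_density) (auto simp: lik_nonneg)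
  also have "\<dots> = (\<integral>z. f (M + (1 / sqrt N) *\<^sub>R z) \<partial>gauss)"
    unfolding lik_commute[OF N, of M] using N by (rule integral_lik) measurable
  finally show "(\<integral>Y. f Y \<partial>obs_dist N M) = (\<integral>z. f (M + (1 / sqrt N) *\<^sub>R z) \<partial>gauss)" .
  have "integrable (obs_dist N M) f \<longleftrightarrow> integrable lborel (\<lambda>Y. lik N M Y * f Y)"
    unfolding obs_dist_def by (subst integrable_density) (auto simp: lik_nonneg)
  also have "\<dots> \<longleftrightarrow> integrable gauss (\<lambda>z. f (M + (1 / sqrt N) *\<^sub>R z))"
    unfolding lik_commute[OF N, of M] using N by (rule integrable_lik) measurable
  finally show "integrable (obs_dist N M) f \<longleftrightarrow> integrable gauss (\<lambda>z. f (M + (1 / sqrt N) *\<^sub>R z))" .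
qed

lemma integrable_componentwise:
  fixes f :: "'b \<Rightarrow> 'a::euclidean_space"
  assumes "\<And>b. b \<in> Basis \<Longrightarrow> integrable M (\<lambda>x. f x \<bullet> b)"
  shows "integrable M f"
proof -
  have "integrable M (\<lambda>x. \<Sum>b\<in>Basis. (f x \<bullet> b) *\<^sub>R b)"
    using assms by (intro Bochner_Integration.integrable_sum integrable_scaleR_left) auto
  then show ?thesis by (simp add: euclidean_representation)
qed

lemma gen_bayes_measurable [measurable]:
  fixes \<pi> :: "real^'p^'n \<Rightarrow> real"
  assumes [measurable]: "\<pi> \<in> borel_measurable borel"
  shows "gen_bayes N \<pi> \<in> borel_measurable borel"
  unfolding gen_bayes_def[abs_def] marginal_def[abs_def] by measurable

lemma gen_bayes_error:
  fixes \<pi> :: "real^'p^'n \<Rightarrow> real"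
  assumes "regular_prior \<pi> M v B c k L" and N: "N \<ge> 1" and e: "e \<in> Basis"
  shows "(gen_bayes N \<pi> (M + (1 / sqrt N) *\<^sub>R z) - M) \<bullet> e = regular_prior.scaled_error \<pi> M (1 / sqrt N) e z"
proof -
  interpret regular_prior \<pi> M v B c k L by fact
  define s where "s = 1 / sqrt N"
  have s: "0 < s" "s \<le> 1" and N0: "N > 0" using N by (auto simp: s_def)
  let ?Y = "M + s *\<^sub>R z"
  have Yw: "?Y + s *\<^sub>R w = M + s *\<^sub>R (z + w)" for w by (simp add: scaleR_add_right)
  have marg: "marginal N \<pi> ?Y = mass s z"
    unfolding marginal_def mass_def Yw[symmetric] unfolding s_def by (rule integral_lik[OF N0]) measurable
  have i0: "integrable gauss (\<lambda>w. \<pi> (M + s *\<^sub>R (z + w)))"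
    using prior_gauss_integrable_weighted[OF s, of "\<lambda>_. 1" 1] by simp
  have i1: "integrable gauss (\<lambda>w. (w \<bullet> b) * \<pi> (M + s *\<^sub>R (z + w)))" if "b \<in> Basis" for b
    by (rule prior_gauss_integrable_weighted[OF s _ abs_inner_le_one_plus[OF that]]) auto
  have split: "\<pi> (M + s *\<^sub>R (z + w)) * ((M + s *\<^sub>R (z + w)) \<bullet> b)
      = (?Y \<bullet> b) * \<pi> (M + s *\<^sub>R (z + w)) + s * ((w \<bullet> b) * \<pi> (M + s *\<^sub>R (z + w)))" for w b
    by (simp add: inner_add_left algebra_simps)
  have i2: "integrable lborel (\<lambda>\<theta>. lik N \<theta> ?Y * (\<pi> \<theta> * (\<theta> \<bullet> b)))" if "b \<in> Basis" for b
  proof -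
    have "integrable gauss (\<lambda>w. \<pi> (M + s *\<^sub>R (z + w)) * ((M + s *\<^sub>R (z + w)) \<bullet> b))"
      unfolding split using i0 i1[OF that] by (intro Bochner_Integration.integrable_add integrable_mult_right)
    moreover have "integrable lborel (\<lambda>\<theta>. lik N \<theta> ?Y * (\<pi> \<theta> * (\<theta> \<bullet> b)))
        \<longleftrightarrow> integrable gauss (\<lambda>w. \<pi> (?Y + s *\<^sub>R w) * ((?Y + s *\<^sub>R w) \<bullet> b))"
      unfolding s_def by (rule integrable_lik[OF N0]) measurable
    ultimately show ?thesis by (simp only: Yw)
  qed
  \<comment> \<open>Needed before the inner product with \<open>e\<close> may pass inside: a Bochner
    integral of a non-integrable function is \<open>0\<close> by convention.\<close>
  have int: "integrable lborel (\<lambda>\<theta>. (lik N \<theta> ?Y * \<pi> \<theta>) *\<^sub>R \<theta>)"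
  proof (rule integrable_componentwise)
    fix b :: "real^'p^'n" assume "b \<in> Basis"
    have "(\<lambda>\<theta>. (lik N \<theta> ?Y * \<pi> \<theta>) *\<^sub>R \<theta> \<bullet> b) = (\<lambda>\<theta>. lik N \<theta> ?Y * (\<pi> \<theta> * (\<theta> \<bullet> b)))"
      by (intro ext) (simp only: inner_scaleR_left mult.assoc)
    with i2[OF \<open>b \<in> Basis\<close>] show "integrable lborel (\<lambda>\<theta>. (lik N \<theta> ?Y * \<pi> \<theta>) *\<^sub>R \<theta> \<bullet> b)"
      by (simp only:)
  qed
  have "(\<integral>\<theta>. (lik N \<theta> ?Y * \<pi> \<theta>) *\<^sub>R \<theta> \<partial>lborel) \<bullet> e = (\<integral>\<theta>. lik N \<theta> ?Y * (\<pi> \<theta> * (\<theta> \<bullet> e)) \<partial>lborel)"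
    unfolding integral_inner_left[OF int, symmetric] by (simp only: inner_scaleR_left mult.assoc)
  also have "\<dots> = (\<integral>w. \<pi> (M + s *\<^sub>R (z + w)) * ((M + s *\<^sub>R (z + w)) \<bullet> e) \<partial>gauss)"
    unfolding Yw[symmetric] unfolding s_def by (rule integral_lik[OF N0]) measurable
  also have "\<dots> = (?Y \<bullet> e) * mass s z + s * (\<integral>w. (w \<bullet> e) * \<pi> (M + s *\<^sub>R (z + w)) \<partial>gauss)"
    unfolding split mass_def using i0 i1[OF e] by simp
  finally have "gen_bayes N \<pi> ?Y \<bullet> e = (?Y \<bullet> e) + s * ((\<integral>w. (w \<bullet> e) * \<pi> (M + s *\<^sub>R (z + w)) \<partial>gauss) / mass s z)"
    using mass_pos[OF s, of z] by (simp add: gen_bayes_def marg field_simps)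
  then show ?thesis
    by (simp add: scaled_error_def inner_diff_left inner_add_left flip: s_def)
qed

lemma risk_matrix_entry:
  fixes \<pi> :: "real^'p^'n \<Rightarrow> real"
  assumes reg: "regular_prior \<pi> M v B c k L" and N: "N \<ge> 1"
  shows "risk_matrix N \<pi> M $ i $ j = (\<Sum>a\<in>UNIV. \<integral>z. regular_prior.scaled_error \<pi> M (1 / sqrt N) (axis a (axis i 1)) z
      * regular_prior.scaled_error \<pi> M (1 / sqrt N) (axis a (axis j 1)) z \<partial>gauss)"
proof -
  interpret regular_prior \<pi> M v B c k L by fact
  have N0: "N > 0" and s: "0 < 1 / sqrt N" "1 / sqrt N \<le> 1" using N by auto
  let ?F = "\<lambda>Y. transpose (gen_bayes N \<pi> Y - M) ** (gen_bayes N \<pi> Y - M)"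
  let ?f = "\<lambda>i j a Y. ((gen_bayes N \<pi> Y - M) \<bullet> axis a (axis i 1)) * ((gen_bayes N \<pi> Y - M) \<bullet> axis a (axis j 1))"
  have F: "?F Y $ i $ j = (\<Sum>a\<in>UNIV. ?f i j a Y)" for Y i j
    by (simp add: matrix_matrix_mult_def transpose_def)
  have int: "integrable (obs_dist N M) (?f i j a)" for i j a
    by (subst integrable_obs_dist[OF N0])
       (auto simp: gen_bayes_error[OF reg N] simp del: inner_axis_axis_matrix intro!: integrable_scaled_error_mult s)
  have intF: "integrable (obs_dist N M) ?F"
  proof (rule integrable_componentwise)
    fix b :: "real^'p^'p" assume "b \<in> Basis"
    then obtain i j where b: "b = axis i (axis j 1)" by (auto simp: Basis_matrix)
    show "integrable (obs_dist N M) (\<lambda>Y. ?F Y \<bullet> b)"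
      unfolding b inner_axis_axis_matrix[of "?F _"] F by (intro Bochner_Integration.integrable_sum int)
  qed
  have "risk_matrix N \<pi> M $ i $ j = (\<integral>Y. ?F Y \<partial>obs_dist N M) \<bullet> axis i (axis j 1)"
    by (simp add: risk_matrix_def)
  also have "\<dots> = (\<integral>Y. (\<Sum>a\<in>UNIV. ?f i j a Y) \<partial>obs_dist N M)"
    unfolding integral_inner_left[OF intF, symmetric] inner_axis_axis_matrix[of "?F _"] F ..
  also have "\<dots> = (\<Sum>a\<in>UNIV. \<integral>Y. ?f i j a Y \<partial>obs_dist N M)"
    using int by simp
  also have "\<dots> = (\<Sum>a\<in>UNIV. \<integral>z. scaled_error (1 / sqrt N) (axis a (axis i 1)) z * scaled_error (1 / sqrt N) (axis a (axis j 1)) z \<partial>gauss)"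
    by (subst integral_obs_dist[OF N0]) (auto simp: gen_bayes_error[OF reg N] simp del: inner_axis_axis_matrix)
  finally show ?thesis .
qed

text \<open>Sums the coordinatewise expansion over the rows \<open>a\<close>. The subtracted
  diagonal term \<open>N * CARD('n)\<close> is \<open>N\<^sup>2\<close> times the risk of the
  observation itself; being common to all priors, it disappears from differences of risks.\<close>

theorem risk_matrix_expansion:
  fixes \<pi> :: "real^'p^'n \<Rightarrow> real"
  assumes reg: "regular_prior \<pi> M v B c k L"
  shows "((\<lambda>N. N\<^sup>2 * risk_matrix N \<pi> M $ i $ j - N * (if i = j then real CARD('n) else 0)) \<longlongrightarrow>
    (\<Sum>a\<in>UNIV. 2 * B (axis a (axis i 1)) (axis a (axis j 1)) / \<pi> M - (v $ a $ i / \<pi> M) * (v $ a $ j / \<pi> M))) at_top"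
proof -
  interpret regular_prior \<pi> M v B c k L by fact
  let ?e = "\<lambda>a i. axis a (axis i 1) :: real^'p^'n"
  let ?I = "\<lambda>a N. \<integral>z. scaled_error (1 / sqrt N) (?e a i) z * scaled_error (1 / sqrt N) (?e a j) z \<partial>gauss"
  have "((\<lambda>N. \<Sum>a\<in>UNIV. N\<^sup>2 * ?I a N - N * (?e a i \<bullet> ?e a j)) \<longlongrightarrow>
      (\<Sum>a\<in>UNIV. 2 * B (?e a i) (?e a j) / \<pi> M - slope (?e a i) * slope (?e a j))) at_top"
    by (intro tendsto_sum scaled_error_second_moment_expansion) auto
  then have lim: "((\<lambda>N. \<Sum>a\<in>UNIV. N\<^sup>2 * ?I a N - N * (?e a i \<bullet> ?e a j)) \<longlongrightarrow>
      (\<Sum>a\<in>UNIV. 2 * B (?e a i) (?e a j) / \<pi> M - (v $ a $ i / \<pi> M) * (v $ a $ j / \<pi> M))) at_top"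
    by (simp add: slope_def)
  have ee: "?e a i \<bullet> ?e a j = (if i = j then 1 else 0)" for a
    by (subst inner_axis_axis_matrix) (simp add: axis_def)
  have "(\<Sum>a\<in>UNIV. N\<^sup>2 * ?I a N - N * (?e a i \<bullet> ?e a j))
      = N\<^sup>2 * risk_matrix N \<pi> M $ i $ j - N * (if i = j then real CARD('n) else 0)" if "N \<ge> 1" for N
    unfolding risk_matrix_entry[OF reg that] sum_subtractf sum_distrib_left[symmetric] ee
    by simp
  then show ?thesis
    by (intro Lim_transform_eventually[OF lim] eventually_mono[OF eventually_ge_at_top[of 1]])
qed

section \<open>Comparison of the two risks\<close>

lemma regular_prior_pi_msvs1:
  fixes M :: "real^'p^'n"
  assumes np: "CARD('n) > CARD('p) + 1" and \<gamma>: "0 \<le> \<gamma>" "\<gamma> < real (CARD('p) * (CARD('p) + 1))"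
    and "0 < pi_msvs1 \<gamma> M" "has_taylor2 (pi_msvs1 \<gamma>) M v B"
  shows "\<exists>c k L. regular_prior (pi_msvs1 \<gamma>) M v B c k L"
proof (rule pi_msvs1_lower_bound[OF np \<gamma>(1)])
  fix c k assume "0 < c" "AE M in (lborel :: (real^'p^'n) measure). c / (1 + norm M) ^ k \<le> pi_msvs1 \<gamma> M"
  then have "regular_prior (pi_msvs1 \<gamma>) M v B c k (CARD('p) * (CARD('p) + 1) + 1)"
    using integrable_pi_msvs1[OF np \<gamma>] assms(4,5) by unfold_locales (auto simp: pi_msvs1_nonneg)
  then show ?thesis by blast
qed

lemma inner_self_eq_trace: "M \<bullet> M = trace (transpose M ** (M :: real^'p^'n))"
  unfolding inner_vec_def trace_def matrix_matrix_mult_def transpose_def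
  by (simp, subst sum.swap, simp)

lemma risk_matrix_msvs1_minus_svs:
  fixes M :: "real^'p^'n"
  assumes np: "CARD('n) > CARD('p) + 1" and \<gamma>: "0 \<le> \<gamma>" "\<gamma> < real (CARD('p) * (CARD('p) + 1))"
    and det: "det (transpose M ** M) \<noteq> 0"
  defines "K \<equiv> transpose M ** M"
  shows "((\<lambda>N. N\<^sup>2 * (risk_matrix N (pi_msvs1 \<gamma>) M $ i $ j - risk_matrix N pi_svs M $ i $ j)) \<longlongrightarrow>
    \<gamma> / (trace K)\<^sup>2 * (- 2 * (real CARD('p) + 1) * trace K * (if i = j then 1 else 0) + (\<gamma> + 4) * K $ i $ j)) at_top"
proof -
  have detpos: "0 < det (transpose M ** M)"
    using det det_transpose_mult_self_nonneg[of M] by linarith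
  have M0: "M \<noteq> 0"
    using det_gram_le[of M] detpos by (auto simp: power_0_left)
  define t where "t = M \<bullet> M"
  have t: "t > 0" using M0 by (simp add: t_def)
  define P where "P = pi_svs M"
  define \<phi> where "\<phi> = norm M powr (- \<gamma>)"
  have P: "P > 0" using detpos by (simp add: P_def pi_svs_eq)
  have \<phi>: "\<phi> > 0" using M0 by (simp add: \<phi>_def)
  obtain v B where vB: "has_taylor2 pi_svs M v B"
    using has_taylor2_pi_svs[OF det] by blast
  define w where "w = (- \<gamma> * \<phi> / t) *\<^sub>R M"
  define C where "C h k = \<phi> * (- \<gamma> / t * (h \<bullet> k) + \<gamma> * (\<gamma> + 2) / t\<^sup>2 * (M \<bullet> h) * (M \<bullet> k))" for h k
  have wC: "has_taylor2 (\<lambda>y. norm y powr (- \<gamma>)) M w C"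
    using has_taylor2_norm_powr[OF M0, of \<gamma>] unfolding w_def C_def \<phi>_def t_def .
  define v1 where "v1 = P *\<^sub>R w + \<phi> *\<^sub>R v"
  define B1 where "B1 h k = P * C h k + \<phi> * B h k + (v \<bullet> h) * (w \<bullet> k) + (w \<bullet> h) * (v \<bullet> k)" for h k
  have vB1: "has_taylor2 (pi_msvs1 \<gamma>) M v1 B1"
    using has_taylor2_mult[OF vB wC] unfolding v1_def B1_def P_def \<phi>_def pi_msvs1_def[abs_def] .
  \<comment> \<open>Regularity of \<open>pi_svs\<close> is then the case
    \<open>\<gamma> = 0\<close>. At \<open>Y = 0\<close> the identity rests on conventions:
    \<open>0 powr 0 = 0\<close> on the right, and on the left the determinant vanishes, so both
    sides are \<open>0\<close>.\<close>
  have svs: "pi_svs = (pi_msvs1 0 :: real^'p^'n \<Rightarrow> real)"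
  proof
    fix Y :: "real^'p^'n"
    show "pi_svs Y = pi_msvs1 0 Y"
    proof (cases "Y = 0")
      case True
      then have "det (transpose Y ** Y) = 0"
        using det_gram_le[of Y] det_transpose_mult_self_nonneg[of Y] by (simp add: power_0_left)
      with True show ?thesis by (simp add: pi_msvs1_def pi_svs_eq)
    qed (simp add: pi_msvs1_def)
  qed
  have \<pi>1: "pi_msvs1 \<gamma> M = P * \<phi>" by (simp add: pi_msvs1_def P_def \<phi>_def)
  have "0 < real (CARD('p) * (CARD('p) + 1))" by (simp only: of_nat_0_less_iff) simp
  then obtain c0 k0 L0 where reg0: "regular_prior pi_svs M v B c0 k0 L0"
    using regular_prior_pi_msvs1[OF np order.refl, of M v B] vB P unfolding svs P_def by blast
  obtain c1 k1 L1 where reg1: "regular_prior (pi_msvs1 \<gamma>) M v1 B1 c1 k1 L1"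
    using regular_prior_pi_msvs1[OF np \<gamma> _ vB1] P \<phi> \<pi>1 by auto
  let ?e = "\<lambda>a i. axis a (axis i 1) :: real^'p^'n"
  let ?\<delta> = "if i = j then 1 else 0 :: real"
  let ?S1 = "\<Sum>a\<in>UNIV. 2 * B1 (?e a i) (?e a j) / (P * \<phi>) - (v1 $ a $ i / (P * \<phi>)) * (v1 $ a $ j / (P * \<phi>))"
  let ?S0 = "\<Sum>a\<in>UNIV. 2 * B (?e a i) (?e a j) / P - (v $ a $ i / P) * (v $ a $ j / P)"
  have "((\<lambda>N. (N\<^sup>2 * risk_matrix N (pi_msvs1 \<gamma>) M $ i $ j - N * (if i = j then real CARD('n) else 0))
      - (N\<^sup>2 * risk_matrix N pi_svs M $ i $ j - N * (if i = j then real CARD('n) else 0))) \<longlongrightarrow>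
    ?S1 - ?S0) at_top"
    using tendsto_diff[OF risk_matrix_expansion[OF reg1, of i j] risk_matrix_expansion[OF reg0, of i j]]
    unfolding \<pi>1 P_def[symmetric] .
  moreover have "?S1 - ?S0
    = \<gamma> / t\<^sup>2 * (- 2 * (real CARD('p) + 1) * t * ?\<delta> + (\<gamma> + 4) * K $ i $ j)"
  proof -
    have ee: "?e a i \<bullet> ?e a j = ?\<delta>" for a
      by (subst inner_axis_axis_matrix) (simp add: axis_def)
    \<comment> \<open>\<open>B\<close> and the product of the two entries of \<open>v\<close> drop
      out. The cross terms occur with weight two in twice the Hessian and with weight one in the
      product of the slopes, so one copy survives; likewise \<open>2 * \<gamma> * (\<gamma> + 2) -
      \<gamma>\<^sup>2 = \<gamma> * (\<gamma> + 4)\<close>.\<close>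
    have summand: "2 * B1 (?e a i) (?e a j) / (P * \<phi>) - (v1 $ a $ i / (P * \<phi>)) * (v1 $ a $ j / (P * \<phi>))
        - (2 * B (?e a i) (?e a j) / P - (v $ a $ i / P) * (v $ a $ j / P))
      = (- 2 * \<gamma> / t) * ?\<delta> + (\<gamma> * (\<gamma> + 4) / t\<^sup>2) * (M $ a $ i * M $ a $ j)
        - \<gamma> / (t * P) * (v $ a $ i * M $ a $ j + v $ a $ j * M $ a $ i)" for a
    proof -
      have B1: "B1 (?e a i) (?e a j) = P * (\<phi> * (- \<gamma> / t * ?\<delta> + \<gamma> * (\<gamma> + 2) / t\<^sup>2 * M $ a $ i * M $ a $ j))
          + \<phi> * B (?e a i) (?e a j) - \<gamma> * \<phi> / t * (v $ a $ i * M $ a $ j + v $ a $ j * M $ a $ i)"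
        unfolding B1_def C_def ee w_def by (simp add: algebra_simps)
      have v1: "v1 $ a $ l = \<phi> * (v $ a $ l - P * \<gamma> / t * M $ a $ l)" for l
        by (simp add: v1_def w_def algebra_simps)
      show ?thesis
        unfolding B1 v1 using P \<phi> t by (simp add: field_simps power2_eq_square)
    qed
    have K: "(\<Sum>a\<in>UNIV. M $ a $ i * M $ a $ j) = K $ i $ j"
      by (simp add: K_def matrix_matrix_mult_def transpose_def)
    have grad: "(\<Sum>a\<in>UNIV. v $ a $ i * M $ a $ j + v $ a $ j * M $ a $ i)
        = - 2 * (real CARD('n) - real CARD('p) - 1) * P * ?\<delta>"
      unfolding sum.distrib pi_svs_gradient_columns[OF det vB] P_def by auto
    have "?S1 - ?S0
      = real CARD('n) * ((- 2 * \<gamma> / t) * ?\<delta>) + (\<gamma> * (\<gamma> + 4) / t\<^sup>2) * K $ i $ j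
        - \<gamma> / (t * P) * (- 2 * (real CARD('n) - real CARD('p) - 1) * P * ?\<delta>)"
      unfolding sum_subtractf[symmetric] summand
      unfolding sum_subtractf sum.distrib sum_distrib_left[symmetric] K grad[unfolded sum.distrib] by simp
    \<comment> \<open>The row dimension \<open>n\<close> cancels:
      \<open>- 2 * n + 2 * (n - p - 1) = - 2 * (p + 1)\<close>.\<close>
    also have "\<dots> = \<gamma> / t\<^sup>2 * (- 2 * (real CARD('p) + 1) * t * ?\<delta> + (\<gamma> + 4) * K $ i $ j)"
      using P t by (simp add: field_simps power2_eq_square)
    finally show ?thesis .
  qed
  ultimately show ?thesis
    by (simp add: right_diff_distrib t_def inner_self_eq_trace K_def)
qed

text \<open>The operator norm is at most the Frobenius norm, so \<open>K\<close> is at most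
  \<open>trace K\<close> times the identity as a quadratic form. The form in question is then at
  most a positive multiple of \<open>\<gamma> + 4 - 2 * (p + 1) = \<gamma> - (2 * p - 2)\<close>,
  which is where the upper limit on \<gamma> comes from.\<close>

lemma neg_definite_limit:
  fixes M :: "real^'p^'n"
  assumes \<gamma>: "0 < \<gamma>" "\<gamma> < 2 * real CARD('p) - 2" and M: "M \<noteq> 0"
  defines "K \<equiv> transpose M ** M"
  shows "neg_definite ((\<gamma> / (trace K)\<^sup>2) *\<^sub>R ((- 2 * (real CARD('p) + 1) * trace K) *\<^sub>R mat 1 + (\<gamma> + 4) *\<^sub>R K))"
    (is "neg_definite ?L")
  unfolding neg_definite_def
proof (intro conjI allI impI)
  define t where "t = trace K"
  have t: "t = M \<bullet> M" "t > 0" using M by (auto simp: t_def K_def inner_self_eq_trace[symmetric])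
  have "transpose K = K"
    by (simp add: K_def matrix_transpose_mul)
  then have "K $ i $ j = K $ j $ i" for i j
    by (metis transpose_def vec_lambda_beta)
  then show "transpose ?L
      = ?L"
    by (auto simp: vec_eq_iff transpose_def mat_def)
  fix x :: "real^'p" assume x: "x \<noteq> 0"
  have "norm (M *v x) \<le> norm M * norm x"
  proof -
    have "norm (M *v x) = L2_set (\<lambda>a. norm ((M *v x) $ a)) UNIV" by (simp add: norm_vec_def)
    also have "\<dots> \<le> L2_set (\<lambda>a. norm (M $ a) * norm x) UNIV"
    proof (rule L2_set_mono)
      fix a
      have "(M *v x) $ a = M $ a \<bullet> x"
        by (simp add: matrix_vector_mult_def inner_vec_def)
      then show "norm ((M *v x) $ a) \<le> norm (M $ a) * norm x"
        using Cauchy_Schwarz_ineq2[of "M $ a" x] by simp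
    qed auto
    also have "\<dots> = norm M * norm x"
      by (simp add: L2_set_left_distrib[symmetric] norm_vec_def[of M])
    finally show ?thesis .
  qed
  then have "(norm (M *v x))\<^sup>2 \<le> (norm M * norm x)\<^sup>2"
    by (intro power_mono) auto
  moreover have "x \<bullet> (K *v x) = (norm (M *v x))\<^sup>2"
    by (simp add: K_def power2_norm_eq_inner matrix_vector_mul_assoc[symmetric] dot_lmul_matrix[symmetric]
        vector_transpose_matrix inner_commute[of x])
  ultimately have Kx: "x \<bullet> (K *v x) \<le> t * (x \<bullet> x)"
    by (simp add: t power_mult_distrib power2_norm_eq_inner)
  have "x \<bullet> (((\<gamma> / t\<^sup>2) *\<^sub>R ((- 2 * (real CARD('p) + 1) * t) *\<^sub>R mat 1 + (\<gamma> + 4) *\<^sub>R K)) *v x)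
      = \<gamma> / t\<^sup>2 * ((- 2 * (real CARD('p) + 1) * t) * (x \<bullet> x) + (\<gamma> + 4) * (x \<bullet> (K *v x)))"
    by (simp add: matrix_vector_mult_add_rdistrib scaleR_matrix_vector_assoc[symmetric] inner_add_right)
  also have "\<dots> \<le> \<gamma> / t\<^sup>2 * ((- 2 * (real CARD('p) + 1) * t) * (x \<bullet> x) + (\<gamma> + 4) * (t * (x \<bullet> x)))"
    using Kx \<gamma>(1) by (intro mult_left_mono add_left_mono) auto
  also have "\<dots> = \<gamma> / t\<^sup>2 * (t * (x \<bullet> x)) * (\<gamma> - (2 * real CARD('p) - 2))"
    using t(2) by (simp add: field_simps)
  also have "\<dots> < 0"
    using \<gamma> t x by (intro mult_pos_neg mult_pos_pos divide_pos_pos) auto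
  finally show "x \<bullet> (?L *v x) < 0"
    unfolding t_def .
qed

theorem theorem3:
  fixes M :: "real^'p^'n" and \<gamma> :: real
  assumes "CARD('n) > CARD('p) + 1"
    and "0 \<le> \<gamma>" and "\<gamma> < real (CARD('p))^2 + real CARD('p)"
    and "det (transpose M ** M) \<noteq> 0"
  shows "((\<lambda>N. N^2 *\<^sub>R (risk_matrix N (pi_msvs1 \<gamma>) M - risk_matrix N pi_svs M))
            \<longlongrightarrow> (\<gamma> / (trace (transpose M ** M))^2) *\<^sub>R
                 ((- 2 * (real CARD('p) + 1) * trace (transpose M ** M)) *\<^sub>R mat 1
                  + (\<gamma> + 4) *\<^sub>R (transpose M ** M))) at_top
         \<and> (CARD('p) \<ge> 2 \<and> 0 < \<gamma> \<and> \<gamma> < 2 * real CARD('p) - 2 \<longrightarrow>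
              neg_definite ((\<gamma> / (trace (transpose M ** M))^2) *\<^sub>R
                 ((- 2 * (real CARD('p) + 1) * trace (transpose M ** M)) *\<^sub>R mat 1
                  + (\<gamma> + 4) *\<^sub>R (transpose M ** M))))"
    (is "(?f \<longlongrightarrow> ?L) at_top \<and> (?A \<longrightarrow> _)")
proof (intro conjI impI)
  have \<gamma>: "\<gamma> < real (CARD('p) * (CARD('p) + 1))"
    using assms(3) by (simp add: power2_eq_square algebra_simps)
  show "(?f \<longlongrightarrow> ?L) at_top"
  proof (intro vec_tendstoI)
    fix i j :: 'p
    show "((\<lambda>N. ?f N $ i $ j) \<longlongrightarrow> ?L $ i $ j) at_top"
      using risk_matrix_msvs1_minus_svs[OF assms(1,2) \<gamma> assms(4), of i j] by (simp add: mat_def)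
  qed
  have "M \<noteq> 0"
    using det_gram_le[of M] det_transpose_mult_self_nonneg[of M] assms(4) by (auto simp: power_0_left)
  then show "neg_definite ?L" if ?A
    using that neg_definite_limit[of \<gamma> M] by blast
qed

end
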